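(* Let $\mathcal{A}$ be an additive category, let $\mathbb{D}$ be a deflation-exact structure on $\mathcal{A}$ and let $\mathbb{I}$ be an inflation-exact structure on $\mathcal{A}$, both containing all split kernel-cokernel pairs. The conflation structure $\widehat{\mathbb{D}}\cap\widehat{\mathbb{I}}=\widehat{\mathbb{D}\cap\mathbb{I}}$ on the weak idempotent completion $\widehat{\mathcal{A}}$ of $\mathcal{A}$ is an exact structure.
   Context: A conflation structure on an additive category $\mathcal{A}$ is a class $\mathbb{C}$ of kernel-cokernel pairs (conflations), closed under isomorphisms; the kernel part of a conflation is called an inflation and the cokernel part a deflation. A conflation structure is deflation-exact if: (R0) $1_0\colon 0\to0$ is a deflation; (R1) deflations are closed under composition; (R2) the pullback of any morphism along a deflation exists, and deflations are stable under pullbacks. Dually, it is inflation-exact if: (L0) $1_0$ is an inflation; (L1) inflations are closed under composition; (L2) the pushout of any morphism along an inflation exists, and inflations are stable under pushouts. It is exact (in the sense of Quillen) if it is both deflation-exact and inflation-exact. The weak idempotent completion $\widehat{\mathcal{A}}$ is the full subcategory of the idempotent completion of $\mathcal{A}$ consisting of those $X$ for which there is $X_c\in\mathcal{A}$ with $X\oplus X_c\in\mathcal{A}$ (up to isomorphism). For any conflation structure $\mathbb{C}$ on $\mathcal{A}$, $\widehat{\mathbb{C}}$ is the conflation structure on $\widehat{\mathcal{A}}$ for which a sequence $X\to Y\to Z$ in $\widehat{\mathcal{A}}$ lies in $\widehat{\mathbb{C}}$ if and only if it is a direct summand (in $\widehat{\mathcal{A}}$) of a conflation in $\mathbb{C}$.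 *)

theory Defs
  imports "HOL-Algebra.Group"
begin

section \<open>Additive categories\<close>

text \<open>
  Composition is written in the usual order: \<open>g \<cdot> f\<close> is ``first \<open>f\<close>, then \<open>g\<close>''. The operations are
  only meaningful on the carriers \<open>Obj\<close>, \<open>Arr\<close> and on composable, respectively parallel, arrows.
\<close>

record ('o, 'm) cat =
  Obj :: "'o set"
  Arr :: "'m set"
  Dom :: "'m \<Rightarrow> 'o"
  Cod :: "'m \<Rightarrow> 'o"
  Ident :: "'o \<Rightarrow> 'm"
  Comp :: "'m \<Rightarrow> 'm \<Rightarrow> 'm"  (infixr "\<cdot>\<index>" 75)
  Plus :: "'m \<Rightarrow> 'm \<Rightarrow> 'm"  (infixl "\<boxplus>\<index>" 65)
  Null :: "'o \<Rightarrow> 'o \<Rightarrow> 'm"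

definition Hom :: "('o, 'm) cat \<Rightarrow> 'o \<Rightarrow> 'o \<Rightarrow> 'm set" where
  "Hom A X Y = {f \<in> Arr A. Dom A f = X \<and> Cod A f = Y}"

definition hom_group :: "('o, 'm) cat \<Rightarrow> 'o \<Rightarrow> 'o \<Rightarrow> 'm monoid" where
  "hom_group A X Y = \<lparr>carrier = Hom A X Y, monoid.mult = Plus A, one = Null A X Y\<rparr>"

locale category =
  fixes A :: "('o, 'm) cat" (structure)
  assumes Dom_Obj: "f \<in> Arr A \<Longrightarrow> Dom A f \<in> Obj A"
    and Cod_Obj: "f \<in> Arr A \<Longrightarrow> Cod A f \<in> Obj A"
    and Ident_Hom: "X \<in> Obj A \<Longrightarrow> Ident A X \<in> Hom A X X"
    and Comp_Hom: "f \<in> Hom A X Y \<Longrightarrow> g \<in> Hom A Y Z \<Longrightarrow> g \<cdot> f \<in> Hom A X Z"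
    and Comp_assoc: "f \<in> Hom A W X \<Longrightarrow> g \<in> Hom A X Y \<Longrightarrow> h \<in> Hom A Y Z \<Longrightarrow>
      (h \<cdot> g) \<cdot> f = h \<cdot> (g \<cdot> f)"
    and Ident_left: "f \<in> Hom A X Y \<Longrightarrow> Ident A Y \<cdot> f = f"
    and Ident_right: "f \<in> Hom A X Y \<Longrightarrow> f \<cdot> Ident A X = f"

definition is_zero_object :: "('o, 'm) cat \<Rightarrow> 'o \<Rightarrow> bool" where
  "is_zero_object A Z \<longleftrightarrow> Z \<in> Obj A \<and>
     (\<forall>X\<in>Obj A. (\<exists>!f. f \<in> Hom A Z X) \<and> (\<exists>!f. f \<in> Hom A X Z))"

text \<open>\<open>B\<close> is the biproduct of \<open>X\<close> and \<open>Y\<close>, with injections \<open>i\<close>, \<open>j\<close> and projections \<open>p\<close>, \<open>q\<close>.\<close>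

definition is_biproduct ::
  "('o, 'm) cat \<Rightarrow> 'o \<Rightarrow> 'o \<Rightarrow> 'o \<Rightarrow> 'm \<Rightarrow> 'm \<Rightarrow> 'm \<Rightarrow> 'm \<Rightarrow> bool" where
  "is_biproduct A X Y B i j p q \<longleftrightarrow>
     X \<in> Obj A \<and> Y \<in> Obj A \<and> B \<in> Obj A \<and>
     i \<in> Hom A X B \<and> j \<in> Hom A Y B \<and> p \<in> Hom A B X \<and> q \<in> Hom A B Y \<and>
     p \<cdot>\<^bsub>A\<^esub> i = Ident A X \<and> q \<cdot>\<^bsub>A\<^esub> j = Ident A Y \<and>
     q \<cdot>\<^bsub>A\<^esub> i = Null A X Y \<and> p \<cdot>\<^bsub>A\<^esub> j = Null A Y X \<and>
     (i \<cdot>\<^bsub>A\<^esub> p) \<boxplus>\<^bsub>A\<^esub> (j \<cdot>\<^bsub>A\<^esub> q) = Ident A B"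

locale additive_category = category +
  assumes Hom_comm_group:
      "X \<in> Obj A \<Longrightarrow> Y \<in> Obj A \<Longrightarrow> comm_group (hom_group A X Y)"
    and Comp_Plus_left: "f \<in> Hom A X Y \<Longrightarrow> g \<in> Hom A Y Z \<Longrightarrow> g' \<in> Hom A Y Z \<Longrightarrow>
      (g \<boxplus> g') \<cdot> f = (g \<cdot> f) \<boxplus> (g' \<cdot> f)"
    and Comp_Plus_right: "f \<in> Hom A X Y \<Longrightarrow> f' \<in> Hom A X Y \<Longrightarrow> g \<in> Hom A Y Z \<Longrightarrow>
      g \<cdot> (f \<boxplus> f') = (g \<cdot> f) \<boxplus> (g \<cdot> f')"
    and ex_zero_object: "\<exists>Z. is_zero_object A Z"
    and ex_biproduct: "X \<in> Obj A \<Longrightarrow> Y \<in> Obj A \<Longrightarrow> \<exists>B i j p q. is_biproduct A X Y B i j p q"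


section \<open>Limits and conflation structures\<close>

definition is_iso :: "('o, 'm) cat \<Rightarrow> 'm \<Rightarrow> bool" where
  "is_iso A f \<longleftrightarrow> f \<in> Arr A \<and> (\<exists>g \<in> Hom A (Cod A f) (Dom A f).
     g \<cdot>\<^bsub>A\<^esub> f = Ident A (Dom A f) \<and> f \<cdot>\<^bsub>A\<^esub> g = Ident A (Cod A f))"

definition is_sequence :: "('o, 'm) cat \<Rightarrow> 'm \<Rightarrow> 'm \<Rightarrow> bool" where
  "is_sequence A f g \<longleftrightarrow> f \<in> Arr A \<and> g \<in> Arr A \<and> Cod A f = Dom A g"

definition is_kernel :: "('o, 'm) cat \<Rightarrow> 'm \<Rightarrow> 'm \<Rightarrow> bool" where
  "is_kernel A k f \<longleftrightarrow> is_sequence A k f \<and> f \<cdot>\<^bsub>A\<^esub> k = Null A (Dom A k) (Cod A f) \<and>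
     (\<forall>W\<in>Obj A. \<forall>g \<in> Hom A W (Dom A f). f \<cdot>\<^bsub>A\<^esub> g = Null A W (Cod A f) \<longrightarrow>
        (\<exists>!h. h \<in> Hom A W (Dom A k) \<and> k \<cdot>\<^bsub>A\<^esub> h = g))"

definition is_cokernel :: "('o, 'm) cat \<Rightarrow> 'm \<Rightarrow> 'm \<Rightarrow> bool" where
  "is_cokernel A c f \<longleftrightarrow> is_sequence A f c \<and> c \<cdot>\<^bsub>A\<^esub> f = Null A (Dom A f) (Cod A c) \<and>
     (\<forall>W\<in>Obj A. \<forall>g \<in> Hom A (Cod A f) W. g \<cdot>\<^bsub>A\<^esub> f = Null A (Dom A f) W \<longrightarrow>
        (\<exists>!h. h \<in> Hom A (Cod A c) W \<and> h \<cdot>\<^bsub>A\<^esub> c = g))"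

definition kernel_cokernel_pair :: "('o, 'm) cat \<Rightarrow> 'm \<Rightarrow> 'm \<Rightarrow> bool" where
  "kernel_cokernel_pair A i p \<longleftrightarrow> is_kernel A i p \<and> is_cokernel A p i"

text \<open>
  Split pairs are those of the form \<open>X \<rightarrow> X \<oplus> Z \<rightarrow> Z\<close>, with the canonical injection and projection.
\<close>

definition split_kernel_cokernel_pair :: "('o, 'm) cat \<Rightarrow> 'm \<Rightarrow> 'm \<Rightarrow> bool" where
  "split_kernel_cokernel_pair A i p \<longleftrightarrow> kernel_cokernel_pair A i p \<and>
     (\<exists>s r. is_biproduct A (Dom A i) (Cod A p) (Cod A i) i s r p)"

text \<open>The pullback of \<open>f\<close> and \<open>p\<close>: here \<open>f'\<close> is parallel to \<open>f\<close> and \<open>p'\<close> is parallel to \<open>p\<close>.\<close>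

definition is_pullback :: "('o, 'm) cat \<Rightarrow> 'm \<Rightarrow> 'm \<Rightarrow> 'm \<Rightarrow> 'm \<Rightarrow> bool" where
  "is_pullback A f p f' p' \<longleftrightarrow>
     f \<in> Arr A \<and> p \<in> Arr A \<and> f' \<in> Arr A \<and> p' \<in> Arr A \<and>
     Cod A f = Cod A p \<and> Dom A f' = Dom A p' \<and>
     Cod A f' = Dom A p \<and> Cod A p' = Dom A f \<and>
     p \<cdot>\<^bsub>A\<^esub> f' = f \<cdot>\<^bsub>A\<^esub> p' \<and>
     (\<forall>W\<in>Obj A. \<forall>u \<in> Hom A W (Dom A p). \<forall>v \<in> Hom A W (Dom A f).
        p \<cdot>\<^bsub>A\<^esub> u = f \<cdot>\<^bsub>A\<^esub> v \<longrightarrow>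
        (\<exists>!h. h \<in> Hom A W (Dom A p') \<and> f' \<cdot>\<^bsub>A\<^esub> h = u \<and> p' \<cdot>\<^bsub>A\<^esub> h = v))"

definition is_pushout :: "('o, 'm) cat \<Rightarrow> 'm \<Rightarrow> 'm \<Rightarrow> 'm \<Rightarrow> 'm \<Rightarrow> bool" where
  "is_pushout A f i f' i' \<longleftrightarrow>
     f \<in> Arr A \<and> i \<in> Arr A \<and> f' \<in> Arr A \<and> i' \<in> Arr A \<and>
     Dom A f = Dom A i \<and> Cod A f' = Cod A i' \<and>
     Dom A f' = Cod A i \<and> Dom A i' = Cod A f \<and>
     f' \<cdot>\<^bsub>A\<^esub> i = i' \<cdot>\<^bsub>A\<^esub> f \<and>
     (\<forall>W\<in>Obj A. \<forall>u \<in> Hom A (Cod A i) W. \<forall>v \<in> Hom A (Cod A f) W.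
        u \<cdot>\<^bsub>A\<^esub> i = v \<cdot>\<^bsub>A\<^esub> f \<longrightarrow>
        (\<exists>!h. h \<in> Hom A (Cod A i') W \<and> h \<cdot>\<^bsub>A\<^esub> f' = u \<and> h \<cdot>\<^bsub>A\<^esub> i' = v))"

text \<open>Conflations are encoded as pairs (inflation, deflation) of arrows.\<close>

definition inflation :: "('m \<times> 'm) set \<Rightarrow> 'm \<Rightarrow> bool" where
  "inflation C i \<longleftrightarrow> (\<exists>p. (i, p) \<in> C)"

definition deflation :: "('m \<times> 'm) set \<Rightarrow> 'm \<Rightarrow> bool" where
  "deflation C p \<longleftrightarrow> (\<exists>i. (i, p) \<in> C)"

definition iso_sequences :: "('o, 'm) cat \<Rightarrow> 'm \<Rightarrow> 'm \<Rightarrow> 'm \<Rightarrow> 'm \<Rightarrow> bool" where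
  "iso_sequences A f g f' g' \<longleftrightarrow> is_sequence A f g \<and> is_sequence A f' g' \<and>
     (\<exists>a \<in> Hom A (Dom A f) (Dom A f'). \<exists>b \<in> Hom A (Cod A f) (Cod A f').
      \<exists>c \<in> Hom A (Cod A g) (Cod A g').
        is_iso A a \<and> is_iso A b \<and> is_iso A c \<and>
        b \<cdot>\<^bsub>A\<^esub> f = f' \<cdot>\<^bsub>A\<^esub> a \<and> c \<cdot>\<^bsub>A\<^esub> g = g' \<cdot>\<^bsub>A\<^esub> b)"

locale conflation_structure = additive_category +
  fixes C :: "('m \<times> 'm) set"
  assumes conflation: "(i, p) \<in> C \<Longrightarrow> kernel_cokernel_pair A i p"
    and iso_closed: "(i, p) \<in> C \<Longrightarrow> iso_sequences A i p i' p' \<Longrightarrow> (i', p') \<in> C"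

locale deflation_exact_structure = conflation_structure +
  assumes R0: "is_zero_object A Z \<Longrightarrow> deflation C (Ident A Z)"
    and R1: "deflation C p \<Longrightarrow> deflation C q \<Longrightarrow> Cod A p = Dom A q \<Longrightarrow> deflation C (q \<cdot> p)"
    and R2_ex: "deflation C p \<Longrightarrow> f \<in> Arr A \<Longrightarrow> Cod A f = Cod A p \<Longrightarrow>
      \<exists>f' p'. is_pullback A f p f' p'"
    and R2_stable: "deflation C p \<Longrightarrow> is_pullback A f p f' p' \<Longrightarrow> deflation C p'"

locale inflation_exact_structure = conflation_structure +
  assumes L0: "is_zero_object A Z \<Longrightarrow> inflation C (Ident A Z)"
    and L1: "inflation C i \<Longrightarrow> inflation C j \<Longrightarrow> Cod A i = Dom A j \<Longrightarrow> inflation C (j \<cdot> i)"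
    and L2_ex: "inflation C i \<Longrightarrow> f \<in> Arr A \<Longrightarrow> Dom A f = Dom A i \<Longrightarrow>
      \<exists>f' i'. is_pushout A f i f' i'"
    and L2_stable: "inflation C i \<Longrightarrow> is_pushout A f i f' i' \<Longrightarrow> inflation C i'"

locale exact_structure = deflation_exact_structure + inflation_exact_structure


section \<open>The weak idempotent completion\<close>

text \<open>
  The idempotent completion has as objects the pairs \<open>(X, e)\<close> with \<open>e\<close> an idempotent endomorphism
  of \<open>X\<close>; arrows \<open>(X, e) \<rightarrow> (Y, d)\<close> are the arrows \<open>f : X \<rightarrow> Y\<close> with \<open>d f e = f\<close>, stored together with
  their domain and codomain. The identity of \<open>(X, e)\<close> is \<open>e\<close>.
\<close>

type_synonym ('o, 'm) idem_obj = "'o \<times> 'm"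
type_synonym ('o, 'm) idem_arr = "('o, 'm) idem_obj \<times> 'm \<times> ('o, 'm) idem_obj"

definition idem_objects :: "('o, 'm) cat \<Rightarrow> ('o, 'm) idem_obj set" where
  "idem_objects A = {(X, e). X \<in> Obj A \<and> e \<in> Hom A X X \<and> e \<cdot>\<^bsub>A\<^esub> e = e}"

definition idempotent_completion ::
  "('o, 'm) cat \<Rightarrow> (('o, 'm) idem_obj, ('o, 'm) idem_arr) cat" where
  "idempotent_completion A =
     \<lparr>Obj = idem_objects A,
      Arr = {(P, f, Q). P \<in> idem_objects A \<and> Q \<in> idem_objects A \<and>
               f \<in> Hom A (fst P) (fst Q) \<and> snd Q \<cdot>\<^bsub>A\<^esub> f \<cdot>\<^bsub>A\<^esub> snd P = f},
      Dom = (\<lambda>(P, f, Q). P),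
      Cod = (\<lambda>(P, f, Q). Q),
      Ident = (\<lambda>P. (P, snd P, P)),
      Comp = (\<lambda>(Q', g, R) (P, f, Q). (P, g \<cdot>\<^bsub>A\<^esub> f, R)),
      Plus = (\<lambda>(P, f, Q) (P', f', Q'). (P, f \<boxplus>\<^bsub>A\<^esub> f', Q)),
      Null = (\<lambda>P Q. (P, Null A (fst P) (fst Q), Q))\<rparr>"

definition emb_obj :: "('o, 'm) cat \<Rightarrow> 'o \<Rightarrow> ('o, 'm) idem_obj" where
  "emb_obj A X = (X, Ident A X)"

definition emb_arr :: "('o, 'm) cat \<Rightarrow> 'm \<Rightarrow> ('o, 'm) idem_arr" where
  "emb_arr A f = (emb_obj A (Dom A f), f, emb_obj A (Cod A f))"

definition full_subcategory :: "('o, 'm) cat \<Rightarrow> 'o set \<Rightarrow> ('o, 'm) cat" where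
  "full_subcategory A S =
     A\<lparr>Obj := Obj A \<inter> S, Arr := {f \<in> Arr A. Dom A f \<in> S \<and> Cod A f \<in> S}\<rparr>"

text \<open>
  Membership of \<open>X \<oplus> X\<^sub>c\<close> in \<open>A\<close> up to isomorphism means that some object \<open>B\<close> of \<open>A\<close> carries the structure
  of a biproduct of \<open>X\<close> and \<open>X\<^sub>c\<close>.
\<close>

definition weak_idempotent_completion ::
  "('o, 'm) cat \<Rightarrow> (('o, 'm) idem_obj, ('o, 'm) idem_arr) cat" where
  "weak_idempotent_completion A = full_subcategory (idempotent_completion A)
     {X \<in> Obj (idempotent_completion A). \<exists>Xc\<in>Obj A. \<exists>B\<in>Obj A. \<exists>i j p q.
        is_biproduct (idempotent_completion A) X (emb_obj A Xc) (emb_obj A B) i j p q}"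

text \<open>
  \<open>is_direct_summand A f g u v\<close>: the sequence \<open>(u, v)\<close> is the biproduct of the sequence \<open>(f, g)\<close> and
  some sequence \<open>(f', g')\<close>, i.e. there are biproducts at the three vertices whose injections and
  projections are morphisms of sequences.
\<close>

definition is_direct_summand :: "('o, 'm) cat \<Rightarrow> 'm \<Rightarrow> 'm \<Rightarrow> 'm \<Rightarrow> 'm \<Rightarrow> bool" where
  "is_direct_summand A f g u v \<longleftrightarrow> is_sequence A f g \<and> is_sequence A u v \<and>
     (\<exists>f' g'. is_sequence A f' g' \<and>
       (\<exists>i1 j1 p1 q1 i2 j2 p2 q2 i3 j3 p3 q3.
         is_biproduct A (Dom A f) (Dom A f') (Dom A u) i1 j1 p1 q1 \<and>
         is_biproduct A (Cod A f) (Cod A f') (Cod A u) i2 j2 p2 q2 \<and>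
         is_biproduct A (Cod A g) (Cod A g') (Cod A v) i3 j3 p3 q3 \<and>
         u \<cdot>\<^bsub>A\<^esub> i1 = i2 \<cdot>\<^bsub>A\<^esub> f \<and> v \<cdot>\<^bsub>A\<^esub> i2 = i3 \<cdot>\<^bsub>A\<^esub> g \<and>
         u \<cdot>\<^bsub>A\<^esub> j1 = j2 \<cdot>\<^bsub>A\<^esub> f' \<and> v \<cdot>\<^bsub>A\<^esub> j2 = j3 \<cdot>\<^bsub>A\<^esub> g' \<and>
         p2 \<cdot>\<^bsub>A\<^esub> u = f \<cdot>\<^bsub>A\<^esub> p1 \<and> p3 \<cdot>\<^bsub>A\<^esub> v = g \<cdot>\<^bsub>A\<^esub> p2 \<and>
         q2 \<cdot>\<^bsub>A\<^esub> u = f' \<cdot>\<^bsub>A\<^esub> q1 \<and> q3 \<cdot>\<^bsub>A\<^esub> v = g' \<cdot>\<^bsub>A\<^esub> q2))"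

definition completed_conflations ::
  "('o, 'm) cat \<Rightarrow> ('m \<times> 'm) set \<Rightarrow> (('o, 'm) idem_arr \<times> ('o, 'm) idem_arr) set" where
  "completed_conflations A C = {(f, g). is_sequence (weak_idempotent_completion A) f g \<and>
     (\<exists>(i, p) \<in> C. is_direct_summand (weak_idempotent_completion A) f g (emb_arr A i) (emb_arr A p))}"

end

theory Submission
  imports Defs
begin

text \<open>
  Call an arrow \<open>p\<close> of the completion \<^emph>\<open>refined\<close> if \<open>p u = r d\<close> for a deflation \<open>d\<close> of \<open>A\<close> and a split
  epimorphism \<open>r\<close>. Then \<open>p\<close> is a retract of the deflation \<open>[s p, d]\<close>, where \<open>r s = 1\<close>; hence the
  completed deflation-exact structure consists of the pairs \<open>(k, p)\<close> with \<open>k\<close> a kernel of \<open>p\<close> and \<open>p\<close>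
  refined. Refined arrows are visibly stable under composition and pullback, and \<open>p\<close> is refined as soon
  as some \<open>p v\<close> is (the obscure axiom). Inflations are treated dually, in the opposite category.

  For the intersection, let \<open>(k, p)\<close> and \<open>(j, q)\<close> be conflations with \<open>q p\<close> defined, and let \<open>P\<close> be the
  pullback of \<open>p\<close> along \<open>j\<close>, with projections \<open>a\<close> and \<open>b\<close>. The map \<open>(a, b)\<close> is a pushout of \<open>k\<close>, so
  \<open>(1 \<oplus> j)(a, b) = (1, p) a\<close> is an inflation up to retracts, and therefore \<open>a = ker (q p)\<close> is one too.
  Finally, a pair in both completions lies in the completion of the intersection, because adding split
  sequences moves it into \<open>A\<close>, then makes its deflation, and then its inflation, an honest one.
\<close>

section \<open>Preliminaries on additive categories\<close>

text \<open>Each structure by itself controls one half of a conflation only: \<open>D\<close> makes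
  \<open>q p\<close> a deflation but says nothing about its kernel as an inflation of
  \<open>I\<close>. The link is the cokernel property supplied by \<open>D\<close>, which turns a
  suitable square into a pushout, and refined inflations are stable under pushouts. The split pairs
  enter through biproduct projections: \<open>[s p, d]\<close> is \<open>1 \<oplus> d\<close>
  followed by \<open>[s p, 1]\<close>, and the latter becomes a projection after a shear. In the
  completion an idempotent need not split, but a retract always has a complement. Hence summands of
  sequences are the same as retracts, where no complement has to be carried along. The honest
  deflation and the honest inflation are produced one after the other. Repairing the deflation
  replaces the inflation by a pushout, and repairing the inflation replaces the deflation by a
  pullback, so neither step undoes the other.\<close>

lemma Hom_iff [simp]: "f \<in> Hom A X Y \<longleftrightarrow> f \<in> Arr A \<and> Dom A f = X \<and> Cod A f = Y"
  by (simp add: Hom_def)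

definition neg :: "('o, 'm) cat \<Rightarrow> 'm \<Rightarrow> 'm" where
  "neg A f = inv\<^bsub>hom_group A (Dom A f) (Cod A f)\<^esub> f"

context category
begin

lemma Ident_simps [simp]:
  assumes "X \<in> Obj A"
  shows "Ident A X \<in> Arr A" "Dom A (Ident A X) = X" "Cod A (Ident A X) = X"
  using Ident_Hom[OF assms] by (simp_all add: Hom_iff)

lemma Comp_simps [simp]:
  assumes "f \<in> Arr A" "g \<in> Arr A" "Cod A f = Dom A g"
  shows "g \<cdot> f \<in> Arr A" "Dom A (g \<cdot> f) = Dom A f" "Cod A (g \<cdot> f) = Cod A g"
  using Comp_Hom[of f "Dom A f" "Dom A g" g "Cod A g"] assms by (simp_all add: Hom_iff)

lemma assoc [simp]:
  assumes "f \<in> Arr A" "g \<in> Arr A" "h \<in> Arr A" "Cod A f = Dom A g" "Cod A g = Dom A h"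
  shows "(h \<cdot> g) \<cdot> f = h \<cdot> (g \<cdot> f)"
  using Comp_assoc[of f "Dom A f" "Dom A g" g "Dom A h" h "Cod A h"] assms by (simp add: Hom_iff)

lemma Ident_Comp [simp]:
  assumes "f \<in> Arr A"
  shows "Cod A f = Y \<Longrightarrow> Ident A Y \<cdot> f = f" "Dom A f = X \<Longrightarrow> f \<cdot> Ident A X = f"
  using Ident_left[of f] Ident_right[of f] assms by (simp_all add: Hom_iff)

lemma Obj_simps [simp]: "f \<in> Arr A \<Longrightarrow> Dom A f \<in> Obj A" "f \<in> Arr A \<Longrightarrow> Cod A f \<in> Obj A"
  by (auto intro: Dom_Obj Cod_Obj)

text \<open>The simplifier nests composites to the right by \<open>assoc\<close>, so an equation
  between two-fold composites no longer matches inside a longer one. This form and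
  \<open>Comp_eq\<close> apply such an equation in front of a further arrow
  \<open>x\<close>.\<close>

lemma Comp_eq_Comp:
  assumes "g \<cdot> f = k \<cdot> h" "f \<in> Arr A" "g \<in> Arr A" "k \<in> Arr A" "h \<in> Arr A" "x \<in> Arr A"
    "Cod A f = Dom A g" "Cod A h = Dom A k" "Cod A x = Dom A f" "Cod A x = Dom A h"
  shows "g \<cdot> (f \<cdot> x) = k \<cdot> (h \<cdot> x)"
  using arg_cong[OF assms(1), of "\<lambda>y. y \<cdot> x"] assms(2-) by simp

lemma Comp_eq:
  assumes "g \<cdot> f = k" "f \<in> Arr A" "g \<in> Arr A" "x \<in> Arr A"
    "Cod A f = Dom A g" "Cod A x = Dom A f"
  shows "g \<cdot> (f \<cdot> x) = k \<cdot> x"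
  using arg_cong[OF assms(1), of "\<lambda>y. y \<cdot> x"] assms(2-) by simp

end

context additive_category
begin

lemma Null_simps [simp]:
  assumes "X \<in> Obj A" "Y \<in> Obj A"
  shows "Null A X Y \<in> Arr A" "Dom A (Null A X Y) = X" "Cod A (Null A X Y) = Y"
proof -
  interpret G: comm_group "hom_group A X Y" by (rule Hom_comm_group[OF assms])
  have "Null A X Y \<in> Hom A X Y" using G.one_closed by (simp add: hom_group_def)
  then show "Null A X Y \<in> Arr A" "Dom A (Null A X Y) = X" "Cod A (Null A X Y) = Y"
    by (simp_all add: Hom_iff)
qed

lemma Plus_simps [simp]:
  assumes "f \<in> Arr A" "g \<in> Arr A" "Dom A f = Dom A g" "Cod A f = Cod A g"
  shows "f \<boxplus> g \<in> Arr A" "Dom A (f \<boxplus> g) = Dom A g" "Cod A (f \<boxplus> g) = Cod A g"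
proof -
  interpret G: comm_group "hom_group A (Dom A g) (Cod A g)" by (rule Hom_comm_group) (use assms in auto)
  have "f \<boxplus> g \<in> Hom A (Dom A g) (Cod A g)" using G.m_closed[of f g] assms
    by (simp add: hom_group_def Hom_iff)
  then show "f \<boxplus> g \<in> Arr A" "Dom A (f \<boxplus> g) = Dom A g" "Cod A (f \<boxplus> g) = Cod A g"
    by (simp_all add: Hom_iff)
qed

lemma Plus_Null [simp]:
  assumes "f \<in> Arr A" "Dom A f = X" "Cod A f = Y"
  shows "f \<boxplus> Null A X Y = f" "Null A X Y \<boxplus> f = f"
proof -
  interpret G: comm_group "hom_group A X Y" by (rule Hom_comm_group) (use assms in auto)
  show "f \<boxplus> Null A X Y = f" "Null A X Y \<boxplus> f = f"
    using G.r_one[of f] G.l_one[of f] assms by (simp_all add: hom_group_def Hom_iff)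
qed

lemma Plus_assoc:
  assumes "f \<in> Arr A" "g \<in> Arr A" "h \<in> Arr A" "Dom A f = Dom A h" "Dom A g = Dom A h"
    "Cod A f = Cod A h" "Cod A g = Cod A h"
  shows "f \<boxplus> g \<boxplus> h = f \<boxplus> (g \<boxplus> h)"
proof -
  interpret G: comm_group "hom_group A (Dom A h) (Cod A h)" by (rule Hom_comm_group) (use assms in auto)
  show ?thesis using G.m_assoc[of f g h] assms by (simp add: hom_group_def Hom_iff)
qed

lemma Plus_comm:
  assumes "f \<in> Arr A" "g \<in> Arr A" "Dom A f = Dom A g" "Cod A f = Cod A g"
  shows "f \<boxplus> g = g \<boxplus> f"
proof -
  interpret G: comm_group "hom_group A (Dom A g) (Cod A g)" by (rule Hom_comm_group) (use assms in auto)
  show ?thesis using G.m_comm[of f g] assms by (simp add: hom_group_def Hom_iff)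
qed

lemma neg_simps [simp]:
  assumes "f \<in> Arr A"
  shows "neg A f \<in> Arr A" "Dom A (neg A f) = Dom A f" "Cod A (neg A f) = Cod A f"
proof -
  interpret G: comm_group "hom_group A (Dom A f) (Cod A f)" by (rule Hom_comm_group) (use assms in auto)
  have "neg A f \<in> Hom A (Dom A f) (Cod A f)"
    using G.inv_closed[of f] assms by (simp add: neg_def hom_group_def Hom_iff)
  then show "neg A f \<in> Arr A" "Dom A (neg A f) = Dom A f" "Cod A (neg A f) = Cod A f"
    by (simp_all add: Hom_iff)
qed

lemma Plus_neg [simp]:
  assumes "f \<in> Arr A"
  shows "f \<boxplus> neg A f = Null A (Dom A f) (Cod A f)" "neg A f \<boxplus> f = Null A (Dom A f) (Cod A f)"
proof -
  interpret G: comm_group "hom_group A (Dom A f) (Cod A f)" by (rule Hom_comm_group) (use assms in auto)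
  show "f \<boxplus> neg A f = Null A (Dom A f) (Cod A f)" "neg A f \<boxplus> f = Null A (Dom A f) (Cod A f)"
    using G.r_inv[of f] G.l_inv[of f] assms by (simp_all add: neg_def hom_group_def Hom_iff)
qed

lemma Plus_cancel:
  assumes "f \<boxplus> g = f \<boxplus> h" "f \<in> Arr A" "g \<in> Arr A" "h \<in> Arr A" "Dom A f = Dom A g" "Dom A h = Dom A g"
    "Cod A f = Cod A g" "Cod A h = Cod A g"
  shows "g = h"
proof -
  have *: "neg A f \<boxplus> (f \<boxplus> x) = x" if "x \<in> Arr A" "Dom A x = Dom A f" "Cod A x = Cod A f" for x
    using that assms(2) by (simp add: Plus_assoc[symmetric])
  have "g = neg A f \<boxplus> (f \<boxplus> g)" by (rule *[symmetric]) (use assms in simp_all)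
  also have "\<dots> = h" unfolding assms(1) by (rule *) (use assms in simp_all)
  finally show ?thesis .
qed

lemma Plus_neg_eq_Null:
  assumes "f \<boxplus> neg A g = Null A X Y" "f \<in> Arr A" "g \<in> Arr A" "Dom A f = X" "Dom A g = X" "Cod A f = Y" "Cod A g = Y"
  shows "f = g"
proof -
  have "f = f \<boxplus> (neg A g \<boxplus> g)" using assms(2-) by simp
  also have "\<dots> = f \<boxplus> neg A g \<boxplus> g" using assms(2-) by (subst Plus_assoc) simp_all
  also have "\<dots> = g" unfolding assms(1) using assms(2-) by simp
  finally show ?thesis .
qed

lemma Comp_Plus:
  assumes "f \<in> Arr A" "g \<in> Arr A" "Dom A f = Dom A g" "Cod A f = Cod A g"
  shows "h \<in> Arr A \<Longrightarrow> Cod A g = Dom A h \<Longrightarrow> h \<cdot> (f \<boxplus> g) = h \<cdot> f \<boxplus> h \<cdot> g"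
    "h \<in> Arr A \<Longrightarrow> Cod A h = Dom A g \<Longrightarrow> (f \<boxplus> g) \<cdot> h = f \<cdot> h \<boxplus> g \<cdot> h"
  using Comp_Plus_left[of h "Dom A h" "Dom A g" f "Cod A g" g]
    Comp_Plus_right[of f "Dom A g" "Cod A g" g h "Cod A h"] assms by (simp_all add: Hom_iff)

text \<open>By bilinearity a composite with a zero arrow equals its own double, and cancellation
  makes it zero.\<close>

lemma Comp_Null [simp]:
  assumes "f \<in> Arr A" "X \<in> Obj A"
  shows "Cod A f = Y \<Longrightarrow> Null A Y X \<cdot> f = Null A (Dom A f) X"
    "Dom A f = Y \<Longrightarrow> f \<cdot> Null A X Y = Null A X (Cod A f)"
proof -
  assume Y: "Cod A f = Y"
  have YO: "Y \<in> Obj A" using Y assms by auto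
  have "Null A Y X \<cdot> f \<boxplus> Null A Y X \<cdot> f = (Null A Y X \<boxplus> Null A Y X) \<cdot> f"
    using assms Y YO by (subst Comp_Plus) simp_all
  also have "\<dots> = Null A Y X \<cdot> f \<boxplus> Null A (Dom A f) X" using assms Y YO by simp
  finally show "Null A Y X \<cdot> f = Null A (Dom A f) X"
    by (rule Plus_cancel) (use assms Y YO in simp_all)
next
  assume Y: "Dom A f = Y"
  have YO: "Y \<in> Obj A" using Y assms by auto
  have "f \<cdot> Null A X Y \<boxplus> f \<cdot> Null A X Y = f \<cdot> (Null A X Y \<boxplus> Null A X Y)"
    using assms Y YO by (subst Comp_Plus) simp_all
  also have "\<dots> = f \<cdot> Null A X Y \<boxplus> Null A X (Cod A f)" using assms Y YO by simp
  finally show "f \<cdot> Null A X Y = Null A X (Cod A f)"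
    by (rule Plus_cancel) (use assms Y YO in simp_all)
qed

lemma neg_Null [simp]:
  assumes "X \<in> Obj A" "Y \<in> Obj A"
  shows "neg A (Null A X Y) = Null A X Y"
proof -
  have "neg A (Null A X Y) = Null A X Y \<boxplus> neg A (Null A X Y)"
    using assms by (simp del: Plus_neg)
  then show ?thesis using assms by simp
qed

lemma neg_Comp:
  assumes "f \<in> Arr A" "g \<in> Arr A" "Cod A f = Dom A g"
  shows "neg A g \<cdot> f = neg A (g \<cdot> f)" "g \<cdot> neg A f = neg A (g \<cdot> f)"
proof -
  have "g \<cdot> f \<boxplus> neg A g \<cdot> f = (g \<boxplus> neg A g) \<cdot> f" using assms by (subst Comp_Plus) simp_all
  also have "\<dots> = g \<cdot> f \<boxplus> neg A (g \<cdot> f)" using assms by simp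
  finally show "neg A g \<cdot> f = neg A (g \<cdot> f)" by (rule Plus_cancel) (use assms in simp_all)
  have "g \<cdot> f \<boxplus> g \<cdot> neg A f = g \<cdot> (f \<boxplus> neg A f)" using assms by (subst Comp_Plus) simp_all
  also have "\<dots> = g \<cdot> f \<boxplus> neg A (g \<cdot> f)" using assms by simp
  finally show "g \<cdot> neg A f = neg A (g \<cdot> f)" by (rule Plus_cancel) (use assms in simp_all)
qed

end

section \<open>The opposite category and the dual notions\<close>

definition opc :: "('o, 'm) cat \<Rightarrow> ('o, 'm) cat" where
  "opc A = A\<lparr>Dom := Cod A, Cod := Dom A, Comp := (\<lambda>g f. f \<cdot>\<^bsub>A\<^esub> g), Null := (\<lambda>X Y. Null A Y X)\<rparr>"

lemma opc_simps [simp]: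
  "Obj (opc A) = Obj A" "Arr (opc A) = Arr A" "Dom (opc A) = Cod A" "Cod (opc A) = Dom A"
  "Ident (opc A) = Ident A" "g \<cdot>\<^bsub>opc A\<^esub> f = f \<cdot>\<^bsub>A\<^esub> g" "Plus (opc A) = Plus A"
  "Null (opc A) X Y = Null A Y X" "Hom (opc A) X Y = Hom A Y X"
  by (auto simp: opc_def Hom_def)

lemma opc_opc [simp]: "opc (opc A) = A"
  by (simp add: opc_def)

text \<open>\<open>is_kernel\<close> and \<open>is_cokernel\<close> both name the universal arrow
  first, and \<open>is_pullback\<close> and \<open>is_pushout\<close> list parallel arrows in the
  same order. Hence their arguments stay in place under duality, whereas the arrows of a sequence
  and the maps of a biproduct are exchanged.\<close>

lemma opc_iff:
  "is_zero_object (opc A) Z \<longleftrightarrow> is_zero_object A Z"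
  "is_sequence (opc A) f g \<longleftrightarrow> is_sequence A g f"
  "is_kernel (opc A) f g \<longleftrightarrow> is_cokernel A f g"
  "is_cokernel (opc A) f g \<longleftrightarrow> is_kernel A f g"
  "kernel_cokernel_pair (opc A) f g \<longleftrightarrow> kernel_cokernel_pair A g f"
  "is_pullback (opc A) f p f' p' \<longleftrightarrow> is_pushout A f p f' p'"
  "is_pushout (opc A) f p f' p' \<longleftrightarrow> is_pullback A f p f' p'"
  "is_iso (opc A) f \<longleftrightarrow> is_iso A f"
  "is_biproduct (opc A) X Y B i j p q \<longleftrightarrow> is_biproduct A X Y B p q i j"
  by (auto simp: is_zero_object_def is_sequence_def is_kernel_def is_cokernel_def
      kernel_cokernel_pair_def is_pullback_def is_pushout_def is_iso_def is_biproduct_def)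

lemma (in category) op_category: "category (opc A)"
  by unfold_locales (auto simp: Hom_iff)

lemma (in additive_category) op_additive: "additive_category (opc A)"
proof (intro additive_category.intro additive_category_axioms.intro op_category)
  fix X Y assume "X \<in> Obj (opc A)" "Y \<in> Obj (opc A)"
  then show "comm_group (hom_group (opc A) X Y)"
    using Hom_comm_group[of Y X] by (simp add: hom_group_def)
next
  fix f X Y g Z g'
  assume "f \<in> Hom (opc A) X Y" "g \<in> Hom (opc A) Y Z" "g' \<in> Hom (opc A) Y Z"
  then show "(g \<boxplus>\<^bsub>opc A\<^esub> g') \<cdot>\<^bsub>opc A\<^esub> f = g \<cdot>\<^bsub>opc A\<^esub> f \<boxplus>\<^bsub>opc A\<^esub> g' \<cdot>\<^bsub>opc A\<^esub> f"
    using Comp_Plus_right[of g Z Y g' f X] by simp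
next
  fix f X Y f' g Z
  assume "f \<in> Hom (opc A) X Y" "f' \<in> Hom (opc A) X Y" "g \<in> Hom (opc A) Y Z"
  then show "g \<cdot>\<^bsub>opc A\<^esub> (f \<boxplus>\<^bsub>opc A\<^esub> f') = g \<cdot>\<^bsub>opc A\<^esub> f \<boxplus>\<^bsub>opc A\<^esub> g \<cdot>\<^bsub>opc A\<^esub> f'"
    using Comp_Plus_left[of g Z Y f X f'] by simp
next
  show "\<exists>Z. is_zero_object (opc A) Z" using ex_zero_object by (simp add: opc_iff)
next
  fix X Y assume "X \<in> Obj (opc A)" "Y \<in> Obj (opc A)"
  then obtain B i j p q where "is_biproduct A X Y B i j p q" using ex_biproduct[of X Y] by auto
  then have "is_biproduct (opc A) X Y B p q i j" by (simp add: opc_iff)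
  then show "\<exists>B i j p q. is_biproduct (opc A) X Y B i j p q" by blast
qed

subsection \<open>Retracts, biproducts, kernels and pullbacks\<close>

text \<open>A summand of a sequence without its complement: two morphisms of sequences composing to
  the identity. All conditions are equations between named arrows, so they compose and dualise
  directly; the complement is recovered in \<open>is_retract_direct_summand\<close>.\<close>

definition retraction ::
  "('o, 'm) cat \<Rightarrow> 'm \<Rightarrow> 'm \<Rightarrow> 'm \<Rightarrow> 'm \<Rightarrow> 'm \<Rightarrow> 'm \<Rightarrow> 'm \<Rightarrow> 'm \<Rightarrow> 'm \<Rightarrow> 'm \<Rightarrow> bool" where
  "retraction A f g u v i1 p1 i2 p2 i3 p3 \<longleftrightarrow> is_sequence A f g \<and> is_sequence A u v \<and>
     i1 \<in> Hom A (Dom A f) (Dom A u) \<and> p1 \<in> Hom A (Dom A u) (Dom A f) \<and>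
     i2 \<in> Hom A (Cod A f) (Cod A u) \<and> p2 \<in> Hom A (Cod A u) (Cod A f) \<and>
     i3 \<in> Hom A (Cod A g) (Cod A v) \<and> p3 \<in> Hom A (Cod A v) (Cod A g) \<and>
     p1 \<cdot>\<^bsub>A\<^esub> i1 = Ident A (Dom A f) \<and> p2 \<cdot>\<^bsub>A\<^esub> i2 = Ident A (Cod A f) \<and> p3 \<cdot>\<^bsub>A\<^esub> i3 = Ident A (Cod A g) \<and>
     u \<cdot>\<^bsub>A\<^esub> i1 = i2 \<cdot>\<^bsub>A\<^esub> f \<and> v \<cdot>\<^bsub>A\<^esub> i2 = i3 \<cdot>\<^bsub>A\<^esub> g \<and>
     p2 \<cdot>\<^bsub>A\<^esub> u = f \<cdot>\<^bsub>A\<^esub> p1 \<and> p3 \<cdot>\<^bsub>A\<^esub> v = g \<cdot>\<^bsub>A\<^esub> p2"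

definition is_retract :: "('o, 'm) cat \<Rightarrow> 'm \<Rightarrow> 'm \<Rightarrow> 'm \<Rightarrow> 'm \<Rightarrow> bool" where
  "is_retract A f g u v \<longleftrightarrow> (\<exists>i1 p1 i2 p2 i3 p3. retraction A f g u v i1 p1 i2 p2 i3 p3)"

lemma retraction_op:
  "retraction (opc A) g f v u p3 i3 p2 i2 p1 i1 \<longleftrightarrow> retraction A f g u v i1 p1 i2 p2 i3 p3"
  unfolding retraction_def opc_simps opc_iff is_sequence_def Hom_iff
  by (rule iffI; elim conjE; intro conjI; simp)

lemma is_retract_op: "is_retract (opc A) g f v u \<longleftrightarrow> is_retract A f g u v"
  unfolding is_retract_def retraction_op[symmetric, of A] by blast

context additive_category
begin

section \<open>Biproducts\<close>

lemma biproduct_simps: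
  assumes "is_biproduct A X Y B i j p q"
  shows "X \<in> Obj A" "Y \<in> Obj A" "B \<in> Obj A" "i \<in> Arr A" "j \<in> Arr A" "p \<in> Arr A" "q \<in> Arr A"
    "Dom A i = X" "Cod A i = B" "Dom A j = Y" "Cod A j = B"
    "Dom A p = B" "Cod A p = X" "Dom A q = B" "Cod A q = Y"
    "p \<cdot> i = Ident A X" "q \<cdot> j = Ident A Y" "q \<cdot> i = Null A X Y" "p \<cdot> j = Null A Y X"
  using assms by (simp_all add: is_biproduct_def)

lemma biproduct_Comp:
  assumes "is_biproduct A X Y B i j p q" "x \<in> Arr A"
  shows "Cod A x = X \<Longrightarrow> p \<cdot> (i \<cdot> x) = x" "Cod A x = Y \<Longrightarrow> q \<cdot> (j \<cdot> x) = x"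
    "Cod A x = X \<Longrightarrow> q \<cdot> (i \<cdot> x) = Null A (Dom A x) Y" "Cod A x = Y \<Longrightarrow> p \<cdot> (j \<cdot> x) = Null A (Dom A x) X"
  using assms(2) by (simp_all add: biproduct_simps[OF assms(1)] Comp_eq[of _ _ "Ident A _"] Comp_eq[of _ _ "Null A _ _"])

lemma biproduct_swap: "is_biproduct A X Y B i j p q \<Longrightarrow> is_biproduct A Y X B j i q p"
  by (auto simp: is_biproduct_def Plus_comm[of "j \<cdot> q"])

lemma biproduct_ext:
  assumes "is_biproduct A X Y B i j p q" "x \<in> Hom A W B" "y \<in> Hom A W B" "p \<cdot> x = p \<cdot> y" "q \<cdot> x = q \<cdot> y"
  shows "x = y"
proof -
  note [simp] = biproduct_simps[OF assms(1)]
  have *: "i \<cdot> p \<boxplus> j \<cdot> q = Ident A B" using assms(1) by (simp add: is_biproduct_def)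
  have "z = i \<cdot> (p \<cdot> z) \<boxplus> j \<cdot> (q \<cdot> z)" if "z \<in> Hom A W B" for z
  proof -
    have "z = (i \<cdot> p \<boxplus> j \<cdot> q) \<cdot> z" using that unfolding * by simp
    also have "\<dots> = i \<cdot> (p \<cdot> z) \<boxplus> j \<cdot> (q \<cdot> z)" using that by (subst Comp_Plus) simp_all
    finally show ?thesis .
  qed
  from this[OF assms(2)] this[OF assms(3)] show ?thesis unfolding assms(4,5) by simp
qed

lemma biproduct_ex:
  assumes "is_biproduct A X Y B i j p q" "f \<in> Hom A W X" "g \<in> Hom A W Y"
  obtains h where "h \<in> Arr A" "Dom A h = W" "Cod A h = B" "p \<cdot> h = f" "q \<cdot> h = g"
proof
  note [simp] = biproduct_simps[OF assms(1)] biproduct_Comp[OF assms(1)]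
  have [simp]: "f \<in> Arr A" "g \<in> Arr A" "Dom A f = W" "Dom A g = W" "Cod A f = X" "Cod A g = Y"
    using assms by auto
  show "i \<cdot> f \<boxplus> j \<cdot> g \<in> Arr A" "Dom A (i \<cdot> f \<boxplus> j \<cdot> g) = W" "Cod A (i \<cdot> f \<boxplus> j \<cdot> g) = B"
    by simp_all
  show "p \<cdot> (i \<cdot> f \<boxplus> j \<cdot> g) = f" "q \<cdot> (i \<cdot> f \<boxplus> j \<cdot> g) = g"
    by (subst Comp_Plus; simp)+
qed

lemma biproduct_coext:
  assumes "is_biproduct A X Y B i j p q" "x \<in> Hom A B W" "y \<in> Hom A B W" "x \<cdot> i = y \<cdot> i" "x \<cdot> j = y \<cdot> j"
  shows "x = y"
  using additive_category.biproduct_ext[OF op_additive, unfolded opc_iff opc_simps, OF assms] .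

lemma biproduct_coex:
  assumes "is_biproduct A X Y B i j p q" "f \<in> Hom A X W" "g \<in> Hom A Y W"
  obtains h where "h \<in> Arr A" "Dom A h = B" "Cod A h = W" "h \<cdot> i = f" "h \<cdot> j = g"
  using additive_category.biproduct_ex[OF op_additive, unfolded opc_iff opc_simps, OF assms] by blast

text \<open>The automorphism \<open>1 \<boxplus> i w q\<close> of \<open>B\<close> fixes
  \<open>i\<close> and \<open>q\<close> and changes \<open>p\<close> into
  \<open>p \<boxplus> w q\<close>. Thus any arrow \<open>[1, w]\<close> out of a biproduct is itself
  a biproduct projection.\<close>

lemma biproduct_shear:
  assumes "is_biproduct A X Y B i j p q" "w \<in> Hom A Y X"
  obtains j' p' where "is_biproduct A X Y B i j' p' q" "p' \<cdot> j = w"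
proof
  note B [simp] = biproduct_simps[OF assms(1)] biproduct_Comp[OF assms(1)]
  have [simp]: "w \<in> Arr A" "Dom A w = Y" "Cod A w = X" using assms by auto
  let ?p = "p \<boxplus> w \<cdot> q" and ?j = "j \<boxplus> i \<cdot> neg A w"
  have *: "i \<cdot> ?p \<boxplus> ?j \<cdot> q = Ident A B"
  proof (rule biproduct_ext[OF assms(1)])
    have "p \<cdot> (i \<cdot> ?p \<boxplus> ?j \<cdot> q) = p \<cdot> (i \<cdot> ?p) \<boxplus> p \<cdot> (?j \<cdot> q)" by (subst Comp_Plus) simp_all
    also have "p \<cdot> (i \<cdot> ?p) = ?p" by simp
    also have "p \<cdot> (?j \<cdot> q) = neg A (w \<cdot> q)" by (simp add: Comp_Plus neg_Comp)
    also have "?p \<boxplus> neg A (w \<cdot> q) = p" by (simp add: Plus_assoc)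
    finally show "p \<cdot> (i \<cdot> ?p \<boxplus> ?j \<cdot> q) = p \<cdot> Ident A B" by simp
    show "q \<cdot> (i \<cdot> ?p \<boxplus> ?j \<cdot> q) = q \<cdot> Ident A B" by (simp add: Comp_Plus)
  qed simp_all
  show "is_biproduct A X Y B i ?j ?p q"
    unfolding is_biproduct_def by (intro conjI *) (simp_all add: Comp_Plus neg_Comp)
  show "?p \<cdot> j = w" by (simp add: Comp_Plus)
qed

section \<open>Kernels, cokernels and pullbacks\<close>

lemma kernelD:
  assumes "is_kernel A k f"
  shows "k \<in> Arr A" "f \<in> Arr A" "Cod A k = Dom A f" "f \<cdot> k = Null A (Dom A k) (Cod A f)"
  using assms by (auto simp: is_kernel_def is_sequence_def)

lemma kernel_ex:
  assumes "is_kernel A k f" "x \<in> Arr A" "Cod A x = Dom A f" "f \<cdot> x = Null A (Dom A x) (Cod A f)"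
  obtains h where "h \<in> Arr A" "Dom A h = Dom A x" "Cod A h = Dom A k" "k \<cdot> h = x"
proof -
  have "\<exists>!h. h \<in> Hom A (Dom A x) (Dom A k) \<and> k \<cdot> h = x"
    using assms(1) Obj_simps(1)[OF assms(2)] assms(2-4) unfolding is_kernel_def by simp
  then show thesis using that unfolding Hom_iff by blast
qed

lemma kernel_ext:
  assumes "is_kernel A k f" "x \<in> Hom A W (Dom A k)" "y \<in> Hom A W (Dom A k)" "k \<cdot> x = k \<cdot> y"
  shows "x = y"
proof -
  note [simp] = kernelD[OF assms(1)]
  have "f \<cdot> (k \<cdot> y) = Null A W (Cod A f)" using assms by (simp add: Comp_eq[of f k "Null A _ _"])
  moreover have "W \<in> Obj A" "k \<cdot> y \<in> Hom A W (Dom A f)" using assms by auto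
  ultimately have "\<exists>!h. h \<in> Hom A W (Dom A k) \<and> k \<cdot> h = k \<cdot> y"
    using assms(1) unfolding is_kernel_def by blast
  then show ?thesis using assms by blast
qed

lemma kernelI:
  assumes "k \<in> Arr A" "f \<in> Arr A" "Cod A k = Dom A f" "f \<cdot> k = Null A (Dom A k) (Cod A f)"
    and "\<And>x. x \<in> Arr A \<Longrightarrow> Cod A x = Dom A f \<Longrightarrow> f \<cdot> x = Null A (Dom A x) (Cod A f) \<Longrightarrow>
      \<exists>h\<in>Arr A. Dom A h = Dom A x \<and> Cod A h = Dom A k \<and> k \<cdot> h = x"
    and "\<And>x y. x \<in> Arr A \<Longrightarrow> y \<in> Arr A \<Longrightarrow> Dom A x = Dom A y \<Longrightarrow> Cod A x = Dom A k \<Longrightarrow> Cod A y = Dom A k \<Longrightarrow>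
      k \<cdot> x = k \<cdot> y \<Longrightarrow> x = y"
  shows "is_kernel A k f"
  unfolding is_kernel_def is_sequence_def
proof (intro conjI ballI impI)
  fix W x assume *: "x \<in> Hom A W (Dom A f)" "f \<cdot> x = Null A W (Cod A f)"
  then obtain h where h: "h \<in> Hom A (Dom A x) (Dom A k) \<and> k \<cdot> h = x"
    using assms(5)[of x] by auto
  show "\<exists>!h. h \<in> Hom A W (Dom A k) \<and> k \<cdot> h = x"
    by (rule ex1I[of _ h]) (use h * in \<open>auto intro: assms(6)\<close>)
qed (use assms in auto)

lemma pullbackD:
  assumes "is_pullback A f p f' p'"
  shows "f \<in> Arr A" "p \<in> Arr A" "f' \<in> Arr A" "p' \<in> Arr A" "Cod A f = Cod A p" "Dom A f' = Dom A p'"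
    "Cod A f' = Dom A p" "Cod A p' = Dom A f" "p \<cdot> f' = f \<cdot> p'"
  using assms by (auto simp: is_pullback_def)

lemma pullback_ex:
  assumes "is_pullback A f p f' p'" "u \<in> Hom A W (Dom A p)" "v \<in> Hom A W (Dom A f)" "p \<cdot> u = f \<cdot> v"
  obtains h where "h \<in> Arr A" "Dom A h = W" "Cod A h = Dom A p'" "f' \<cdot> h = u" "p' \<cdot> h = v"
proof -
  have "W \<in> Obj A" using assms(2) by auto
  then have "\<exists>!h. h \<in> Hom A W (Dom A p') \<and> f' \<cdot> h = u \<and> p' \<cdot> h = v"
    using assms unfolding is_pullback_def by simp
  then show thesis using that unfolding Hom_iff by blast
qed

lemma pullback_ext:
  assumes "is_pullback A f p f' p'" "x \<in> Hom A W (Dom A p')" "y \<in> Hom A W (Dom A p')"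
    "f' \<cdot> x = f' \<cdot> y" "p' \<cdot> x = p' \<cdot> y"
  shows "x = y"
proof -
  note [simp] = pullbackD[OF assms(1)]
  have "p \<cdot> (f' \<cdot> y) = f \<cdot> (p' \<cdot> y)" by (rule Comp_eq_Comp) (use assms in simp_all)
  moreover have "W \<in> Obj A" "f' \<cdot> y \<in> Hom A W (Dom A p)" "p' \<cdot> y \<in> Hom A W (Dom A f)" using assms by auto
  ultimately have "\<exists>!h. h \<in> Hom A W (Dom A p') \<and> f' \<cdot> h = f' \<cdot> y \<and> p' \<cdot> h = p' \<cdot> y"
    using assms(1) unfolding is_pullback_def by blast
  then show ?thesis using assms by blast
qed

lemma pullbackI:
  assumes "f \<in> Arr A" "p \<in> Arr A" "f' \<in> Arr A" "p' \<in> Arr A" "Cod A f = Cod A p" "Dom A f' = Dom A p'"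
    "Cod A f' = Dom A p" "Cod A p' = Dom A f" "p \<cdot> f' = f \<cdot> p'"
    and "\<And>u v. u \<in> Arr A \<Longrightarrow> v \<in> Arr A \<Longrightarrow> Dom A u = Dom A v \<Longrightarrow> Cod A u = Dom A p \<Longrightarrow> Cod A v = Dom A f \<Longrightarrow>
      p \<cdot> u = f \<cdot> v \<Longrightarrow> \<exists>h\<in>Arr A. Dom A h = Dom A v \<and> Cod A h = Dom A p' \<and> f' \<cdot> h = u \<and> p' \<cdot> h = v"
    and "\<And>x y. x \<in> Arr A \<Longrightarrow> y \<in> Arr A \<Longrightarrow> Dom A x = Dom A y \<Longrightarrow> Cod A x = Dom A p' \<Longrightarrow> Cod A y = Dom A p' \<Longrightarrow>
      f' \<cdot> x = f' \<cdot> y \<Longrightarrow> p' \<cdot> x = p' \<cdot> y \<Longrightarrow> x = y"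
  shows "is_pullback A f p f' p'"
  unfolding is_pullback_def
proof (intro conjI ballI impI)
  fix W u v assume *: "u \<in> Hom A W (Dom A p)" "v \<in> Hom A W (Dom A f)" "p \<cdot> u = f \<cdot> v"
  then obtain h where h: "h \<in> Hom A (Dom A v) (Dom A p') \<and> f' \<cdot> h = u \<and> p' \<cdot> h = v"
    using assms(10)[of u v] by auto
  show "\<exists>!h. h \<in> Hom A W (Dom A p') \<and> f' \<cdot> h = u \<and> p' \<cdot> h = v"
    by (rule ex1I[of _ h]) (use h * in \<open>auto intro: assms(11)\<close>)
qed (use assms in auto)

text \<open>Here \<open>f'\<close> is \<open>f \<oplus> 1\<close> on the summand \<open>M\<close>.
  Being the pullback of \<open>f\<close> along the projection \<open>p2\<close>, it inherits every
  property stable under pullbacks.\<close>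

lemma biproduct_pullback:
  assumes "is_biproduct A K M K' i1 j1 p1 q1" "is_biproduct A Y M Y' i2 j2 p2 q2" "f \<in> Hom A K Y"
  obtains f' where "f' \<in> Hom A K' Y'" "f' \<cdot> i1 = i2 \<cdot> f" "f' \<cdot> j1 = j2" "p2 \<cdot> f' = f \<cdot> p1" "q2 \<cdot> f' = q1"
    "is_pullback A p2 f p1 f'"
proof -
  note [simp] = biproduct_simps[OF assms(1)] biproduct_simps[OF assms(2)]
    biproduct_Comp[OF assms(1)] biproduct_Comp[OF assms(2)]
  have [simp]: "f \<in> Arr A" "Dom A f = K" "Cod A f = Y" using assms by auto
  obtain f' where [simp]: "f' \<in> Arr A" "Dom A f' = K'" "Cod A f' = Y'" "p2 \<cdot> f' = f \<cdot> p1" "q2 \<cdot> f' = q1"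
    by (rule biproduct_ex[OF assms(2), of "f \<cdot> p1" K' q1]) auto
  have [simp]: "p2 \<cdot> (f' \<cdot> x) = f \<cdot> (p1 \<cdot> x)" "q2 \<cdot> (f' \<cdot> x) = q1 \<cdot> x" if "x \<in> Arr A" "Cod A x = K'" for x
    using that by (simp_all add: Comp_eq[of p2 f'] Comp_eq[of q2 f'])
  have "f' \<cdot> i1 = i2 \<cdot> f" "f' \<cdot> j1 = j2"
    by (rule biproduct_ext[OF assms(2)]; simp)+
  moreover have "is_pullback A p2 f p1 f'"
  proof (rule pullbackI; simp)
    fix u v assume [simp]: "u \<in> Arr A" "v \<in> Arr A" "Dom A u = Dom A v" "Cod A u = K" "Cod A v = Y'"
      and e: "f \<cdot> u = p2 \<cdot> v"
    obtain h where [simp]: "h \<in> Arr A" "Dom A h = Dom A v" "Cod A h = K'" "p1 \<cdot> h = u" "q1 \<cdot> h = q2 \<cdot> v"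
      by (rule biproduct_ex[OF assms(1), of u "Dom A v" "q2 \<cdot> v"]) auto
    have [simp]: "f' \<cdot> h = v" by (rule biproduct_ext[OF assms(2)]) (simp_all add: e)
    show "\<exists>h\<in>Arr A. Dom A h = Dom A v \<and> Cod A h = K' \<and> p1 \<cdot> h = u \<and> f' \<cdot> h = v"
      by (intro bexI[of _ h]) simp_all
  next
    fix x y assume [simp]: "x \<in> Arr A" "y \<in> Arr A" "Dom A x = Dom A y" "Cod A x = K'" "Cod A y = K'"
      and *: "p1 \<cdot> x = p1 \<cdot> y" "f' \<cdot> x = f' \<cdot> y"
    have "q2 \<cdot> (f' \<cdot> x) = q2 \<cdot> (f' \<cdot> y)" unfolding * ..
    then have "q1 \<cdot> x = q1 \<cdot> y" by simp
    from biproduct_ext[OF assms(1) _ _ *(1) this, of "Dom A y"] show "x = y" by simp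
  qed
  ultimately show thesis by (intro that) simp_all
qed

text \<open>Again \<open>f'\<close> is \<open>f \<oplus> 1\<close>, now seen as the pushout of
  \<open>f\<close> along the injection \<open>i1\<close>.\<close>

lemma biproduct_pushout:
  assumes "is_biproduct A K M K' i1 j1 p1 q1" "is_biproduct A Y M Y' i2 j2 p2 q2" "f \<in> Hom A K Y"
  obtains f' where "f' \<in> Hom A K' Y'" "f' \<cdot> i1 = i2 \<cdot> f" "f' \<cdot> j1 = j2" "p2 \<cdot> f' = f \<cdot> p1" "q2 \<cdot> f' = q1"
    "is_pushout A i1 f i2 f'"
proof -
  obtain f' where "f' \<in> Hom A K' Y'" "p2 \<cdot> f' = f \<cdot> p1" "q2 \<cdot> f' = q1" "f' \<cdot> i1 = i2 \<cdot> f" "f' \<cdot> j1 = j2"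
    "is_pushout A i1 f i2 f'"
    by (rule additive_category.biproduct_pullback[OF op_additive, unfolded opc_iff opc_simps, OF assms(2,1,3)])
  then show thesis by (intro that)
qed

text \<open>\<open>k'\<close> is the arrow into the pullback with components \<open>k\<close> and
  \<open>0\<close>.\<close>

lemma pullback_kernel:
  assumes "is_pullback A f p f' p'" "is_kernel A k p"
  obtains k' where "k' \<in> Hom A (Dom A k) (Dom A p')" "f' \<cdot> k' = k" "is_kernel A k' p'"
proof -
  note [simp] = pullbackD[OF assms(1)] kernelD[OF assms(2)]
  obtain k' where k' [simp]: "k' \<in> Arr A" "Dom A k' = Dom A k" "Cod A k' = Dom A p'" "f' \<cdot> k' = k"
    "p' \<cdot> k' = Null A (Dom A k) (Dom A f)"
    by (rule pullback_ex[OF assms(1), of k "Dom A k" "Null A (Dom A k) (Dom A f)"]) auto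
  have "is_kernel A k' p'"
  proof (rule kernelI; simp)
    fix x assume [simp]: "x \<in> Arr A" "Cod A x = Dom A p'" and x: "p' \<cdot> x = Null A (Dom A x) (Dom A f)"
    have "p \<cdot> (f' \<cdot> x) = f \<cdot> (p' \<cdot> x)" by (rule Comp_eq_Comp) simp_all
    then have *: "p \<cdot> (f' \<cdot> x) = Null A (Dom A x) (Cod A p)" unfolding x by simp
    obtain h where [simp]: "h \<in> Arr A" "Dom A h = Dom A x" "Cod A h = Dom A k" "k \<cdot> h = f' \<cdot> x"
      by (rule kernel_ex[OF assms(2), of "f' \<cdot> x"]) (use * in auto)
    have [simp]: "k' \<cdot> h = x"
      by (rule pullback_ext[OF assms(1)])
        (simp_all add: x Comp_eq[OF k'(4)] Comp_eq[OF k'(5)])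
    show "\<exists>h\<in>Arr A. Dom A h = Dom A x \<and> Cod A h = Dom A k \<and> k' \<cdot> h = x"
      by (intro bexI[of _ h]) simp_all
  next
    fix x y assume [simp]: "x \<in> Arr A" "y \<in> Arr A" "Dom A x = Dom A y" "Cod A x = Dom A k" "Cod A y = Dom A k"
      and e: "k' \<cdot> x = k' \<cdot> y"
    have "f' \<cdot> (k' \<cdot> x) = f' \<cdot> (k' \<cdot> y)" unfolding e ..
    then have "k \<cdot> x = k \<cdot> y" by (simp add: Comp_eq[OF k'(4)])
    from kernel_ext[OF assms(2) _ _ this, of "Dom A y"] show "x = y" by simp
  qed
  from that[OF _ _ this] show thesis by simp
qed

text \<open>\<open>a\<close> is the preimage under \<open>p\<close> of the kernel of
  \<open>q\<close>. If \<open>q p\<close> kills \<open>x\<close>, then \<open>p x\<close> factors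
  through \<open>j\<close>, and this factor together with \<open>x\<close> gives the arrow into the
  pullback.\<close>

lemma pullback_of_kernel:
  assumes "is_pullback A j p a b" "is_kernel A j q"
  shows "is_kernel A a (q \<cdot> p)"
proof -
  note [simp] = pullbackD[OF assms(1)] kernelD[OF assms(2)]
  have [simp]: "Cod A p = Dom A q" using pullbackD(5)[OF assms(1)] kernelD(3)[OF assms(2)] by (simp del: pullbackD)
  show ?thesis
  proof (rule kernelI; simp?)
    show "q \<cdot> (j \<cdot> b) = Null A (Dom A b) (Cod A q)" by (simp add: Comp_eq[of q j "Null A _ _"])
  next
    fix x assume [simp]: "x \<in> Arr A" "Cod A x = Dom A p" and x: "q \<cdot> (p \<cdot> x) = Null A (Dom A x) (Cod A q)"
    obtain y where [simp]: "y \<in> Arr A" "Dom A y = Dom A x" "Cod A y = Dom A j" "j \<cdot> y = p \<cdot> x"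
      by (rule kernel_ex[OF assms(2) _ _ , of "p \<cdot> x"]) (use x in auto)
    obtain h where "h \<in> Arr A" "Dom A h = Dom A x" "Cod A h = Dom A b" "a \<cdot> h = x"
      by (rule pullback_ex[OF assms(1), of x "Dom A x" y]) auto
    then show "\<exists>h\<in>Arr A. Dom A h = Dom A x \<and> Cod A h = Dom A b \<and> a \<cdot> h = x" by blast
  next
    fix x y assume [simp]: "x \<in> Arr A" "y \<in> Arr A" "Dom A x = Dom A y" "Cod A x = Dom A b" "Cod A y = Dom A b"
      and e: "a \<cdot> x = a \<cdot> y"
    have "j \<cdot> (b \<cdot> x) = p \<cdot> (a \<cdot> x)" by (rule Comp_eq_Comp) simp_all
    also have "\<dots> = j \<cdot> (b \<cdot> y)" unfolding e by (rule Comp_eq_Comp) simp_all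
    finally have *: "j \<cdot> (b \<cdot> x) = j \<cdot> (b \<cdot> y)" .
    from kernel_ext[OF assms(2) _ _ *, of "Dom A y"] have "b \<cdot> x = b \<cdot> y" by simp
    from pullback_ext[OF assms(1) _ _ e this, of "Dom A y"] show "x = y" by simp
  qed
qed

lemma cokernel_ex:
  assumes "is_cokernel A c f" "x \<in> Arr A" "Dom A x = Cod A f" "x \<cdot> f = Null A (Dom A f) (Cod A x)"
  obtains h where "h \<in> Arr A" "Cod A h = Cod A x" "Dom A h = Cod A c" "h \<cdot> c = x"
  using additive_category.kernel_ex[OF op_additive, unfolded opc_iff opc_simps, OF assms] by blast

lemma cokernel_ext:
  assumes "is_cokernel A c f" "x \<in> Hom A (Cod A c) W" "y \<in> Hom A (Cod A c) W" "x \<cdot> c = y \<cdot> c"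
  shows "x = y"
  using additive_category.kernel_ext[OF op_additive, unfolded opc_iff opc_simps, OF assms] .

lemma cokernelI:
  assumes "c \<in> Arr A" "f \<in> Arr A" "Dom A c = Cod A f" "c \<cdot> f = Null A (Dom A f) (Cod A c)"
    and "\<And>x. x \<in> Arr A \<Longrightarrow> Dom A x = Cod A f \<Longrightarrow> x \<cdot> f = Null A (Dom A f) (Cod A x) \<Longrightarrow>
      \<exists>h\<in>Arr A. Cod A h = Cod A x \<and> Dom A h = Cod A c \<and> h \<cdot> c = x"
    and "\<And>x y. x \<in> Arr A \<Longrightarrow> y \<in> Arr A \<Longrightarrow> Cod A x = Cod A y \<Longrightarrow> Dom A x = Cod A c \<Longrightarrow> Dom A y = Cod A c \<Longrightarrow>
      x \<cdot> c = y \<cdot> c \<Longrightarrow> x = y"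
  shows "is_cokernel A c f"
  using additive_category.kernelI[OF op_additive, unfolded opc_iff opc_simps, OF assms] .

section \<open>Retracts of sequences\<close>

lemma retraction_simps:
  assumes "retraction A f g u v i1 p1 i2 p2 i3 p3"
  shows "f \<in> Arr A" "g \<in> Arr A" "u \<in> Arr A" "v \<in> Arr A" "Cod A f = Dom A g" "Cod A u = Dom A v"
    "i1 \<in> Arr A" "Dom A i1 = Dom A f" "Cod A i1 = Dom A u" "p1 \<in> Arr A" "Dom A p1 = Dom A u" "Cod A p1 = Dom A f"
    "i2 \<in> Arr A" "Dom A i2 = Dom A g" "Cod A i2 = Dom A v" "p2 \<in> Arr A" "Dom A p2 = Dom A v" "Cod A p2 = Dom A g"
    "i3 \<in> Arr A" "Dom A i3 = Cod A g" "Cod A i3 = Cod A v" "p3 \<in> Arr A" "Dom A p3 = Cod A v" "Cod A p3 = Cod A g"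
    "p1 \<cdot> i1 = Ident A (Dom A f)" "p2 \<cdot> i2 = Ident A (Dom A g)" "p3 \<cdot> i3 = Ident A (Cod A g)"
    "u \<cdot> i1 = i2 \<cdot> f" "v \<cdot> i2 = i3 \<cdot> g" "p2 \<cdot> u = f \<cdot> p1" "p3 \<cdot> v = g \<cdot> p2"
  using assms by (simp_all add: retraction_def is_sequence_def)

lemma retraction_Comp:
  assumes "retraction A f g u v i1 p1 i2 p2 i3 p3" "x \<in> Arr A"
  shows "Cod A x = Dom A f \<Longrightarrow> p1 \<cdot> (i1 \<cdot> x) = x" "Cod A x = Dom A g \<Longrightarrow> p2 \<cdot> (i2 \<cdot> x) = x"
    "Cod A x = Cod A g \<Longrightarrow> p3 \<cdot> (i3 \<cdot> x) = x"
    "Cod A x = Dom A f \<Longrightarrow> u \<cdot> (i1 \<cdot> x) = i2 \<cdot> (f \<cdot> x)" "Cod A x = Dom A g \<Longrightarrow> v \<cdot> (i2 \<cdot> x) = i3 \<cdot> (g \<cdot> x)"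
    "Cod A x = Dom A u \<Longrightarrow> p2 \<cdot> (u \<cdot> x) = f \<cdot> (p1 \<cdot> x)" "Cod A x = Dom A v \<Longrightarrow> p3 \<cdot> (v \<cdot> x) = g \<cdot> (p2 \<cdot> x)"
  using assms(2) retraction_simps[OF assms(1)]
  by (simp_all add: Comp_eq[of p1 i1] Comp_eq[of p2 i2] Comp_eq[of p3 i3] Comp_eq[of u i1] Comp_eq[of v i2]
      Comp_eq[of p2 u] Comp_eq[of p3 v])

lemma retract_trans:
  assumes "is_retract A f g u v" "is_retract A u v s t"
  shows "is_retract A f g s t"
proof -
  obtain i1 p1 i2 p2 i3 p3 where r: "retraction A f g u v i1 p1 i2 p2 i3 p3"
    using assms(1) unfolding is_retract_def by blast
  obtain j1 q1 j2 q2 j3 q3 where r': "retraction A u v s t j1 q1 j2 q2 j3 q3"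
    using assms(2) unfolding is_retract_def by blast
  note [simp] = retraction_simps[OF r] retraction_simps[OF r'] retraction_Comp[OF r] retraction_Comp[OF r']
  have "retraction A f g s t (j1 \<cdot> i1) (p1 \<cdot> q1) (j2 \<cdot> i2) (p2 \<cdot> q2) (j3 \<cdot> i3) (p3 \<cdot> q3)"
    unfolding retraction_def is_sequence_def by simp
  then show ?thesis unfolding is_retract_def by blast
qed

text \<open>Send a test arrow to the larger sequence by \<open>i2\<close>, factor it there through
  \<open>u\<close>, and return by \<open>p1\<close>. Uniqueness holds because \<open>i1\<close> is a
  split monomorphism.\<close>

lemma retraction_kernel:
  assumes "retraction A f g u v i1 p1 i2 p2 i3 p3" "is_kernel A u v"
  shows "is_kernel A f g"
proof -
  note [simp] = retraction_simps[OF assms(1)] retraction_Comp[OF assms(1)]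
  have vu: "v \<cdot> (u \<cdot> x) = Null A (Dom A x) (Cod A v)" if "x \<in> Arr A" "Cod A x = Dom A u" for x
    using that kernelD[OF assms(2)] by (simp add: Comp_eq[of v u])
  have "i3 \<cdot> (g \<cdot> f) = v \<cdot> (u \<cdot> i1)" by simp
  then have "p3 \<cdot> (i3 \<cdot> (g \<cdot> f)) = p3 \<cdot> Null A (Dom A f) (Cod A v)" unfolding vu[of i1, simplified] by simp
  then have gf [simp]: "g \<cdot> f = Null A (Dom A f) (Cod A g)" by simp
  show ?thesis
  proof (rule kernelI; simp?)
    fix x assume [simp]: "x \<in> Arr A" "Cod A x = Dom A g" "g \<cdot> x = Null A (Dom A x) (Cod A g)"
    obtain h where h [simp]: "h \<in> Arr A" "Dom A h = Dom A x" "Cod A h = Dom A u" "u \<cdot> h = i2 \<cdot> x"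
      by (rule kernel_ex[OF assms(2), of "i2 \<cdot> x"]) auto
    have "f \<cdot> (p1 \<cdot> h) = p2 \<cdot> (u \<cdot> h)" by (simp del: h(4))
    then show "\<exists>h\<in>Arr A. Dom A h = Dom A x \<and> Cod A h = Dom A f \<and> f \<cdot> h = x"
      by (intro bexI[of _ "p1 \<cdot> h"] conjI) simp_all
  next
    fix x y assume [simp]: "x \<in> Arr A" "y \<in> Arr A" "Dom A x = Dom A y" "Cod A x = Dom A f" "Cod A y = Dom A f"
      and e: "f \<cdot> x = f \<cdot> y"
    have "u \<cdot> (i1 \<cdot> x) = u \<cdot> (i1 \<cdot> y)" by (simp add: e)
    from kernel_ext[OF assms(2) _ _ this, of "Dom A y"] have *: "i1 \<cdot> x = i1 \<cdot> y" by simp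
    have "p1 \<cdot> (i1 \<cdot> x) = p1 \<cdot> (i1 \<cdot> y)" unfolding * ..
    then show "x = y" by simp
  qed
qed

lemma retract_kernel: "is_retract A f g u v \<Longrightarrow> is_kernel A u v \<Longrightarrow> is_kernel A f g"
  unfolding is_retract_def using retraction_kernel by blast

lemma retract_cokernel: "is_retract A f g u v \<Longrightarrow> is_cokernel A v u \<Longrightarrow> is_cokernel A g f"
  using additive_category.retract_kernel[OF op_additive, of g f v u] by (simp add: is_retract_op opc_iff)

lemma retract_kernel_cokernel_pair:
  "is_retract A f g u v \<Longrightarrow> kernel_cokernel_pair A u v \<Longrightarrow> kernel_cokernel_pair A f g"
  unfolding kernel_cokernel_pair_def using retract_kernel retract_cokernel by blast

text \<open>The left-hand components of a retraction come for free from the two kernels, and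
  \<open>p1 i1 = 1\<close> follows because \<open>k\<close> is monic. Hence only the square between
  the deflations has to be constructed.\<close>

lemma retraction_of_kernels:
  assumes "is_kernel A k p" "is_kernel A k' d"
    and i: "i2 \<in> Hom A (Dom A p) (Dom A d)" "p2 \<in> Hom A (Dom A d) (Dom A p)"
      "i3 \<in> Hom A (Cod A p) (Cod A d)" "p3 \<in> Hom A (Cod A d) (Cod A p)"
    and e: "p2 \<cdot> i2 = Ident A (Dom A p)" "p3 \<cdot> i3 = Ident A (Cod A p)" "d \<cdot> i2 = i3 \<cdot> p" "p3 \<cdot> d = p \<cdot> p2"
  obtains i1 p1 where "retraction A k p k' d i1 p1 i2 p2 i3 p3"
proof -
  note [simp] = kernelD[OF assms(1)] kernelD[OF assms(2)] e
  have [simp]: "i2 \<in> Arr A" "p2 \<in> Arr A" "i3 \<in> Arr A" "p3 \<in> Arr A" "Dom A i2 = Dom A p" "Cod A i2 = Dom A d"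
    "Dom A p2 = Dom A d" "Cod A p2 = Dom A p" "Dom A i3 = Cod A p" "Cod A i3 = Cod A d" "Dom A p3 = Cod A d"
    "Cod A p3 = Cod A p" using i by auto
  have [simp]: "d \<cdot> (i2 \<cdot> k) = Null A (Dom A k) (Cod A d)"
    using Comp_eq_Comp[OF e(3), of k] by simp
  have [simp]: "p \<cdot> (p2 \<cdot> k') = Null A (Dom A k') (Cod A p)"
    using Comp_eq_Comp[OF e(4), of k'] by simp
  obtain i1 where i1 [simp]: "i1 \<in> Arr A" "Dom A i1 = Dom A k" "Cod A i1 = Dom A k'" "k' \<cdot> i1 = i2 \<cdot> k"
    by (rule kernel_ex[OF assms(2), of "i2 \<cdot> k"]) auto
  obtain p1 where p1 [simp]: "p1 \<in> Arr A" "Dom A p1 = Dom A k'" "Cod A p1 = Dom A k" "k \<cdot> p1 = p2 \<cdot> k'"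
    by (rule kernel_ex[OF assms(1), of "p2 \<cdot> k'"]) auto
  have "k \<cdot> (p1 \<cdot> i1) = p2 \<cdot> (k' \<cdot> i1)" by (rule Comp_eq_Comp) simp_all
  also have "\<dots> = k \<cdot> Ident A (Dom A k)" by (simp add: Comp_eq[OF e(1)])
  finally have "k \<cdot> (p1 \<cdot> i1) = k \<cdot> Ident A (Dom A k)" .
  from kernel_ext[OF assms(1) _ _ this, of "Dom A k"] have "p1 \<cdot> i1 = Ident A (Dom A k)" by simp
  then show thesis by (intro that[of i1 p1]) (simp add: retraction_def is_sequence_def)
qed

lemma is_direct_summand_retract:
  assumes "is_direct_summand A f g u v" shows "is_retract A f g u v"
proof -
  from assms obtain f' g' i1 j1 p1 q1 i2 j2 p2 q2 i3 j3 p3 q3 where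
    *: "is_biproduct A (Dom A f) (Dom A f') (Dom A u) i1 j1 p1 q1"
      "is_biproduct A (Cod A f) (Cod A f') (Cod A u) i2 j2 p2 q2"
      "is_biproduct A (Cod A g) (Cod A g') (Cod A v) i3 j3 p3 q3"
      "u \<cdot> i1 = i2 \<cdot> f" "v \<cdot> i2 = i3 \<cdot> g" "p2 \<cdot> u = f \<cdot> p1" "p3 \<cdot> v = g \<cdot> p2"
    unfolding is_direct_summand_def by blast
  have "retraction A f g u v i1 p1 i2 p2 i3 p3"
    using assms *(4-) biproduct_simps[OF *(1)] biproduct_simps[OF *(2)] biproduct_simps[OF *(3)]
    by (simp add: retraction_def is_direct_summand_def)
  then show ?thesis unfolding is_retract_def by blast
qed

text \<open>The new pair is the sum of \<open>(k, p)\<close> and the split sequence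
  \<open>M \<rightarrow> M \<rightarrow> 0\<close>, so \<open>k'\<close> is
  \<open>k \<oplus> 1\<close> and the codomain of the deflation does not change. The pushout square
  is recorded because it transports properties of \<open>k\<close> to \<open>k'\<close>.\<close>

lemma biproduct_add_left:
  assumes kc: "kernel_cokernel_pair A k p"
    and b1: "is_biproduct A (Dom A k) M X' i1 j1 p1 q1" and b2: "is_biproduct A (Dom A p) M Y' i2 j2 p2 q2"
  obtains k' where "k' \<in> Hom A X' Y'" "kernel_cokernel_pair A k' (p \<cdot> p2)" "is_pushout A i1 k i2 k'"
    "is_retract A k p k' (p \<cdot> p2)"
proof -
  have K: "is_kernel A k p" and C: "is_cokernel A p k" using kc by (auto simp: kernel_cokernel_pair_def)
  note [simp] = biproduct_simps[OF b1] biproduct_simps[OF b2] biproduct_Comp[OF b1] biproduct_Comp[OF b2] kernelD[OF K]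
  obtain k' where k'H: "k' \<in> Hom A X' Y'" and k' [simp]: "k' \<cdot> i1 = i2 \<cdot> k" "k' \<cdot> j1 = j2" "p2 \<cdot> k' = k \<cdot> p1" "q2 \<cdot> k' = q1"
    and po: "is_pushout A i1 k i2 k'"
    by (rule biproduct_pushout[OF b1 b2, of k]) auto
  have [simp]: "k' \<in> Arr A" "Dom A k' = X'" "Cod A k' = Y'" using k'H by auto
  have [simp]: "k' \<cdot> (i1 \<cdot> x) = i2 \<cdot> (k \<cdot> x)" "p \<cdot> (k \<cdot> x) = Null A (Dom A x) (Cod A p)" if "x \<in> Arr A" "Cod A x = Dom A k" for x
    using that by (simp_all add: Comp_eq[of k' i1] Comp_eq[of p k])
  have [simp]: "p2 \<cdot> (k' \<cdot> x) = k \<cdot> (p1 \<cdot> x)" "q2 \<cdot> (k' \<cdot> x) = q1 \<cdot> x" if "x \<in> Arr A" "Cod A x = X'" for x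
    using that by (simp_all add: Comp_eq[of p2 k'] Comp_eq[of q2 k'])
  have "is_kernel A k' (p \<cdot> p2)"
  proof (rule kernelI; simp?)
    fix x assume [simp]: "x \<in> Arr A" "Cod A x = Y'" "p \<cdot> (p2 \<cdot> x) = Null A (Dom A x) (Cod A p)"
    obtain h where [simp]: "h \<in> Arr A" "Dom A h = Dom A x" "Cod A h = Dom A k" "k \<cdot> h = p2 \<cdot> x"
      by (rule kernel_ex[OF K, of "p2 \<cdot> x"]) auto
    obtain y where [simp]: "y \<in> Arr A" "Dom A y = Dom A x" "Cod A y = X'" "p1 \<cdot> y = h" "q1 \<cdot> y = q2 \<cdot> x"
      by (rule biproduct_ex[OF b1, of h "Dom A x" "q2 \<cdot> x"]) auto
    have [simp]: "k' \<cdot> y = x" by (rule biproduct_ext[OF b2, of _ "Dom A x"]) simp_all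
    show "\<exists>h\<in>Arr A. Dom A h = Dom A x \<and> Cod A h = X' \<and> k' \<cdot> h = x"
      by (intro bexI[of _ y]) simp_all
  next
    fix x y assume [simp]: "x \<in> Arr A" "y \<in> Arr A" "Dom A x = Dom A y" "Cod A x = X'" "Cod A y = X'"
      and e: "k' \<cdot> x = k' \<cdot> y"
    have "p2 \<cdot> (k' \<cdot> x) = p2 \<cdot> (k' \<cdot> y)" "q2 \<cdot> (k' \<cdot> x) = q2 \<cdot> (k' \<cdot> y)" unfolding e by simp_all
    then have *: "k \<cdot> (p1 \<cdot> x) = k \<cdot> (p1 \<cdot> y)" "q1 \<cdot> x = q1 \<cdot> y" by simp_all
    from kernel_ext[OF K _ _ *(1), of "Dom A y"] have "p1 \<cdot> x = p1 \<cdot> y" by simp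
    from biproduct_ext[OF b1 _ _ this *(2), of "Dom A y"] show "x = y" by simp
  qed
  moreover have "is_cokernel A (p \<cdot> p2) k'"
  proof (rule cokernelI; simp?)
    fix x assume [simp]: "x \<in> Arr A" "Dom A x = Y'" and x: "x \<cdot> k' = Null A X' (Cod A x)"
    have xj: "x \<cdot> j2 = Null A M (Cod A x)" using Comp_eq[OF x, of j1] by simp
    have "x \<cdot> (i2 \<cdot> k) = Null A (Dom A k) (Cod A x)" using Comp_eq[OF x, of i1] by simp
    then obtain h where h: "h \<in> Arr A" "Cod A h = Cod A x" "Dom A h = Cod A p" "h \<cdot> p = x \<cdot> i2"
      by (rule_tac cokernel_ex[OF C, of "x \<cdot> i2"]) auto
    note [simp] = h(1-3)
    have [simp]: "h \<cdot> (p \<cdot> p2) = x"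
    proof (rule biproduct_coext[OF b2, of _ "Cod A x"])
      show "(h \<cdot> (p \<cdot> p2)) \<cdot> i2 = x \<cdot> i2" using h(4) by simp
      show "(h \<cdot> (p \<cdot> p2)) \<cdot> j2 = x \<cdot> j2" using xj by simp
    qed simp_all
    show "\<exists>h\<in>Arr A. Cod A h = Cod A x \<and> Dom A h = Cod A p \<and> h \<cdot> (p \<cdot> p2) = x"
      by (intro bexI[of _ h]) simp_all
  next
    fix x y assume [simp]: "x \<in> Arr A" "y \<in> Arr A" "Cod A x = Cod A y" "Dom A x = Cod A p" "Dom A y = Cod A p"
      and e: "x \<cdot> (p \<cdot> p2) = y \<cdot> (p \<cdot> p2)"
    have "(x \<cdot> (p \<cdot> p2)) \<cdot> i2 = (y \<cdot> (p \<cdot> p2)) \<cdot> i2" unfolding e ..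
    then have "x \<cdot> p = y \<cdot> p" by simp
    from cokernel_ext[OF C _ _ this, of "Cod A y"] show "x = y" by simp
  qed
  moreover have "retraction A k p k' (p \<cdot> p2) i1 p1 i2 p2 (Ident A (Cod A p)) (Ident A (Cod A p))"
    by (simp add: retraction_def is_sequence_def)
  then have "is_retract A k p k' (p \<cdot> p2)" unfolding is_retract_def by blast
  ultimately show thesis using po k'H by (intro that) (simp_all add: kernel_cokernel_pair_def)
qed

end

section \<open>Deflations up to retracts\<close>

text \<open>
  In the application \<open>A\<close> is the weak idempotent completion, and \<open>S\<close> consists of the objects of the original
  category.
\<close>

locale ambient_category = additive_category +
  fixes S :: "'a set"
  assumes S_Obj: "X \<in> S \<Longrightarrow> X \<in> Obj A"
    and S_complement: "W \<in> Obj A \<Longrightarrow> \<exists>V\<in>S. \<exists>U\<in>S. \<exists>i j p q. is_biproduct A W V U i j p q"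
    and S_biproduct: "V \<in> S \<Longrightarrow> U \<in> S \<Longrightarrow> \<exists>T\<in>S. \<exists>i j p q. is_biproduct A V U T i j p q"
    and retract_complement: "i \<in> Hom A X Y \<Longrightarrow> p \<in> Hom A Y X \<Longrightarrow> p \<cdot> i = Ident A X \<Longrightarrow>
      \<exists>Z j q. is_biproduct A X Z Y i j p q"

definition refined :: "('o, 'm) cat \<Rightarrow> 'm set \<Rightarrow> 'm \<Rightarrow> bool" where
  "refined A \<Delta> p \<longleftrightarrow> p \<in> Arr A \<and> (\<exists>d\<in>\<Delta>. \<exists>u r s. d \<in> Arr A \<and>
     u \<in> Hom A (Dom A d) (Dom A p) \<and> r \<in> Hom A (Cod A d) (Cod A p) \<and> s \<in> Hom A (Cod A p) (Cod A d) \<and>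
     r \<cdot>\<^bsub>A\<^esub> s = Ident A (Cod A p) \<and> p \<cdot>\<^bsub>A\<^esub> u = r \<cdot>\<^bsub>A\<^esub> d)"

lemma refinedI:
  assumes "d \<in> \<Delta>" "p \<in> Arr A" "d \<in> Arr A" "u \<in> Hom A (Dom A d) (Dom A p)" "r \<in> Hom A (Cod A d) (Cod A p)"
    "s \<in> Hom A (Cod A p) (Cod A d)" "r \<cdot>\<^bsub>A\<^esub> s = Ident A (Cod A p)" "p \<cdot>\<^bsub>A\<^esub> u = r \<cdot>\<^bsub>A\<^esub> d"
  shows "refined A \<Delta> p"
  unfolding refined_def using assms by blast

text \<open>What a deflation-exact structure on the objects in \<open>S\<close> looks like when all
  universal properties are taken in the ambient category. The membership conditions keep the arrows
  involved between objects of the original category.\<close>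

locale deflation_class = ambient_category +
  fixes \<Delta> :: "'b set"
  assumes \<Delta>_Arr: "d \<in> \<Delta> \<Longrightarrow> d \<in> Arr A \<and> Dom A d \<in> S \<and> Cod A d \<in> S"
    and \<Delta>_kernel: "d \<in> \<Delta> \<Longrightarrow> \<exists>k. kernel_cokernel_pair A k d \<and> Dom A k \<in> S"
    and \<Delta>_Comp: "d \<in> \<Delta> \<Longrightarrow> e \<in> \<Delta> \<Longrightarrow> Cod A d = Dom A e \<Longrightarrow> e \<cdot> d \<in> \<Delta>"
    and \<Delta>_pullback: "d \<in> \<Delta> \<Longrightarrow> f \<in> Arr A \<Longrightarrow> Dom A f \<in> S \<Longrightarrow> Cod A f = Cod A d \<Longrightarrow>
      \<exists>a d'. is_pullback A f d a d' \<and> Dom A d' \<in> S"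
    and \<Delta>_stable: "d \<in> \<Delta> \<Longrightarrow> is_pullback A f d a d' \<Longrightarrow> Dom A f \<in> S \<Longrightarrow> Dom A d' \<in> S \<Longrightarrow> d' \<in> \<Delta>"
    and \<Delta>_split: "is_biproduct A X Y B i j p q \<Longrightarrow> X \<in> S \<Longrightarrow> Y \<in> S \<Longrightarrow> B \<in> S \<Longrightarrow> q \<in> \<Delta>"

context ambient_category
begin

text \<open>Complements of the three objects exist by \<open>retract_complement\<close>. Since
  injections and projections commute with \<open>u\<close> and \<open>v\<close>, the off-diagonal
  components of \<open>u\<close> and \<open>v\<close> vanish, and the diagonal ones on the
  complements form the second summand.\<close>

lemma is_retract_direct_summand:
  assumes "is_retract A f g u v" shows "is_direct_summand A f g u v"
proof -
  obtain i1 p1 i2 p2 i3 p3 where r: "retraction A f g u v i1 p1 i2 p2 i3 p3"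
    using assms unfolding is_retract_def by blast
  note [simp] = retraction_simps[OF r] retraction_Comp[OF r]
  obtain X j1 q1 where b1: "is_biproduct A (Dom A f) X (Dom A u) i1 j1 p1 q1"
    using retract_complement[of i1 "Dom A f" "Dom A u" p1] by auto
  obtain Y j2 q2 where b2: "is_biproduct A (Dom A g) Y (Dom A v) i2 j2 p2 q2"
    using retract_complement[of i2 "Dom A g" "Dom A v" p2] by auto
  obtain Z j3 q3 where b3: "is_biproduct A (Cod A g) Z (Cod A v) i3 j3 p3 q3"
    using retract_complement[of i3 "Cod A g" "Cod A v" p3] by auto
  note [simp] = biproduct_simps[OF b1] biproduct_simps[OF b2] biproduct_simps[OF b3]
    biproduct_Comp[OF b1] biproduct_Comp[OF b2] biproduct_Comp[OF b3]
  let ?f = "q2 \<cdot> (u \<cdot> j1)" and ?g = "q3 \<cdot> (v \<cdot> j2)"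
  have "u \<cdot> j1 = j2 \<cdot> ?f" by (rule biproduct_ext[OF b2, of _ X]) simp_all
  moreover have "v \<cdot> j2 = j3 \<cdot> ?g" by (rule biproduct_ext[OF b3, of _ Y]) simp_all
  moreover have "q2 \<cdot> u = ?f \<cdot> q1" by (rule biproduct_coext[OF b1, of _ Y]) simp_all
  moreover have "q3 \<cdot> v = ?g \<cdot> q2" by (rule biproduct_coext[OF b2, of _ Z]) simp_all
  ultimately show ?thesis using b1 b2 b3
    unfolding is_direct_summand_def is_sequence_def
    apply -
    apply (rule conjI, simp)
    apply (rule conjI, simp)
    apply (rule exI[of _ ?f], rule exI[of _ ?g])
    apply (rule conjI, simp)
    apply (rule exI[of _ i1], rule exI[of _ j1], rule exI[of _ p1], rule exI[of _ q1])
    apply (rule exI[of _ i2], rule exI[of _ j2], rule exI[of _ p2], rule exI[of _ q2])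
    apply (rule exI[of _ i3], rule exI[of _ j3], rule exI[of _ p3], rule exI[of _ q3])
    by simp
qed

end

context deflation_class
begin

section \<open>Permanence properties of refined arrows\<close>

lemma refined_right_factor:
  assumes "refined A \<Delta> (a \<cdot> v)" "v \<in> Arr A" "a \<in> Arr A" "Cod A v = Dom A a"
  shows "refined A \<Delta> a"
proof -
  note [simp] = assms(2-4)
  obtain d u r s where *: "d \<in> \<Delta>" "u \<in> Hom A (Dom A d) (Dom A v)" "r \<in> Hom A (Cod A d) (Cod A a)"
    "s \<in> Hom A (Cod A a) (Cod A d)" "r \<cdot> s = Ident A (Cod A a)" "(a \<cdot> v) \<cdot> u = r \<cdot> d" "d \<in> Arr A"
    using assms(1) unfolding refined_def by auto
  show ?thesis
    by (rule refinedI[OF *(1), of _ _ "v \<cdot> u" r s]) (use * in auto)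
qed

lemma refined_Comp:
  assumes "refined A \<Delta> p" "refined A \<Delta> q" "Cod A p = Dom A q"
  shows "refined A \<Delta> (q \<cdot> p)"
proof -
  obtain d u r s where *: "d \<in> \<Delta>" "d \<in> Arr A" "u \<in> Hom A (Dom A d) (Dom A p)" "r \<in> Hom A (Cod A d) (Cod A p)"
    "s \<in> Hom A (Cod A p) (Cod A d)" "r \<cdot> s = Ident A (Cod A p)" and pu: "p \<cdot> u = r \<cdot> d" and "p \<in> Arr A"
    using assms(1) unfolding refined_def by auto
  obtain e v t w where e: "e \<in> \<Delta>" "e \<in> Arr A" "v \<in> Hom A (Dom A e) (Dom A q)" "t \<in> Hom A (Cod A e) (Cod A q)"
    "w \<in> Hom A (Cod A q) (Cod A e)" "t \<cdot> w = Ident A (Cod A q)" and qv: "q \<cdot> v = t \<cdot> e" and "q \<in> Arr A"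
    using assms(2) unfolding refined_def by auto
  have [simp]: "d \<in> Arr A" "u \<in> Arr A" "r \<in> Arr A" "s \<in> Arr A" "p \<in> Arr A" "Dom A u = Dom A d" "Cod A u = Dom A p"
    "Dom A r = Cod A d" "Cod A r = Dom A q" "Dom A s = Dom A q" "Cod A s = Cod A d" "Cod A p = Dom A q"
    "e \<in> Arr A" "v \<in> Arr A" "t \<in> Arr A" "q \<in> Arr A" "Dom A v = Dom A e" "Cod A v = Dom A q"
    "Dom A t = Cod A e" "Cod A t = Cod A q"
    using * e assms(3) \<open>p \<in> Arr A\<close> \<open>q \<in> Arr A\<close> by simp_all
  \<comment> \<open>The section \<open>s\<close> moves \<open>v\<close> into \<open>Cod A d\<close>,
    so that \<open>d\<close> itself can be pulled back, along an arrow whose domain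
    \<open>Dom A e\<close> lies in \<open>S\<close>. Afterwards \<open>r s = 1\<close> removes
    \<open>s\<close> again.\<close>
  obtain a d1 where pb: "is_pullback A (s \<cdot> v) d a d1" and S: "Dom A d1 \<in> S"
    using \<Delta>_pullback[OF *(1), of "s \<cdot> v"] \<Delta>_Arr[OF e(1)] by auto
  note [simp] = pullbackD(3,4)[OF pb] pullbackD(6-9)[OF pb, simplified]
  have d1: "d1 \<in> \<Delta>" by (rule \<Delta>_stable[OF *(1) pb _ S]) (use \<Delta>_Arr[OF e(1)] in simp)
  have "p \<cdot> (u \<cdot> a) = r \<cdot> (d \<cdot> a)" by (rule Comp_eq_Comp[OF pu]) simp_all
  also have "\<dots> = r \<cdot> (s \<cdot> (v \<cdot> d1))" by simp
  also have "\<dots> = v \<cdot> d1" using Comp_eq[OF *(6), of "v \<cdot> d1"] by simp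
  finally have "(q \<cdot> p) \<cdot> (u \<cdot> a) = q \<cdot> (v \<cdot> d1)" by simp
  also have "\<dots> = t \<cdot> (e \<cdot> d1)" by (rule Comp_eq_Comp[OF qv]) simp_all
  finally have qpu: "(q \<cdot> p) \<cdot> (u \<cdot> a) = t \<cdot> (e \<cdot> d1)" .
  have "e \<cdot> d1 \<in> \<Delta>" by (rule \<Delta>_Comp[OF d1 e(1)]) simp
  from refinedI[OF this, of "q \<cdot> p" A "u \<cdot> a" t w] show ?thesis using e qpu by simp
qed

lemma refined_pullback:
  assumes pb: "is_pullback A f p f' p'" and "refined A \<Delta> p"
  shows "refined A \<Delta> p'"
proof -
  note P [simp] = pullbackD[OF pb]
  obtain d u r s where *: "d \<in> \<Delta>" "d \<in> Arr A" "u \<in> Hom A (Dom A d) (Dom A p)" "r \<in> Hom A (Cod A d) (Cod A p)"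
    "s \<in> Hom A (Cod A p) (Cod A d)" "r \<cdot> s = Ident A (Cod A p)" and pu: "p \<cdot> u = r \<cdot> d"
    using assms(2) unfolding refined_def by auto
  have [simp]: "d \<in> Arr A" "u \<in> Arr A" "r \<in> Arr A" "s \<in> Arr A" "Dom A u = Dom A d" "Cod A u = Dom A p"
    "Dom A r = Cod A d" "Cod A r = Cod A p" "Dom A s = Cod A p" "Cod A s = Cod A d"
    using * by simp_all
  \<comment> \<open>\<open>Dom A f\<close> need not lie in \<open>S\<close>, so the pullback of
    \<open>d\<close> is taken over the larger object \<open>U\<close>. The projection
    \<open>q\<close>, with section \<open>i\<close>, becomes the split epimorphism in the refinement
    of \<open>p'\<close>.\<close>
  obtain V U i j q x where S: "U \<in> S" and b: "is_biproduct A (Dom A f) V U i j q x"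
    using S_complement[of "Dom A f"] by auto
  note [simp] = biproduct_simps[OF b]
  obtain a d1 where pb1: "is_pullback A (s \<cdot> (f \<cdot> q)) d a d1" and S1: "Dom A d1 \<in> S"
    using \<Delta>_pullback[OF *(1), of "s \<cdot> (f \<cdot> q)"] S by auto
  note [simp] = pullbackD(3,4)[OF pb1] pullbackD(6-9)[OF pb1, simplified]
  have d1: "d1 \<in> \<Delta>" by (rule \<Delta>_stable[OF *(1) pb1 _ S1]) (use S in simp)
  have "p \<cdot> (u \<cdot> a) = r \<cdot> (d \<cdot> a)" by (rule Comp_eq_Comp[OF pu]) simp_all
  also have "\<dots> = r \<cdot> (s \<cdot> (f \<cdot> (q \<cdot> d1)))" by simp
  also have "\<dots> = f \<cdot> (q \<cdot> d1)" using Comp_eq[OF *(6), of "f \<cdot> (q \<cdot> d1)"] by simp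
  finally have "p \<cdot> (u \<cdot> a) = f \<cdot> (q \<cdot> d1)" .
  then obtain h where "h \<in> Arr A" "Dom A h = Dom A d1" "Cod A h = Dom A p'" "f' \<cdot> h = u \<cdot> a" "p' \<cdot> h = q \<cdot> d1"
    by (rule_tac pullback_ex[OF pb, of "u \<cdot> a" "Dom A d1" "q \<cdot> d1"]) auto
  then show ?thesis using refinedI[OF d1, of p' A h q i] by simp
qed

text \<open>\<open>\<Delta>_split\<close> provides projections of biproducts inside
  \<open>S\<close>, so the deflation used is the projection of \<open>V \<oplus> U\<close> onto
  \<open>U\<close>, of which \<open>Z\<close> is a retract.\<close>

lemma refined_Ident:
  assumes "Z \<in> Obj A"
  shows "refined A \<Delta> (Ident A Z)"
proof -
  obtain V U i j p q where VU: "V \<in> S" "U \<in> S" and b: "is_biproduct A Z V U i j p q"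
    using S_complement[OF assms] by blast
  obtain T i' j' p' q' where T: "T \<in> S" and b': "is_biproduct A V U T i' j' p' q'"
    using S_biproduct[OF VU] by blast
  note [simp] = biproduct_simps[OF b] biproduct_simps[OF b']
  have "q' \<in> \<Delta>" using \<Delta>_split[OF b' VU T] .
  from refinedI[OF this, of "Ident A Z" A "p \<cdot> q'" p i] show ?thesis using assms by simp
qed

text \<open>
  The arrow \<open>h = [h i, h j]\<close> is \<open>1 \<oplus> h j\<close>, a pullback of \<open>h j\<close>, followed by a sheared projection.
\<close>

lemma \<Delta>_extend:
  assumes b: "is_biproduct A Y1 Y0 Y i j p q" and S: "Y1 \<in> S" "Y \<in> S"
    and h: "h \<in> Arr A" "Dom A h = Y" and d: "h \<cdot> j \<in> \<Delta>"
  shows "h \<in> \<Delta>"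
proof -
  note [simp] = biproduct_simps[OF b] h
  have Z: "Cod A h \<in> S" and Y0: "Y0 \<in> S" using \<Delta>_Arr[OF d] by simp_all
  obtain V i' j' p' q' where V: "V \<in> S" and b': "is_biproduct A Y1 (Cod A h) V i' j' p' q'"
    using S_biproduct[OF S(1) Z] by blast
  note [simp] = biproduct_simps[OF b'] biproduct_Comp[OF b']
  obtain e where e: "e \<in> Hom A Y V" "e \<cdot> j = j' \<cdot> (h \<cdot> j)" "e \<cdot> i = i'" "is_pullback A q' (h \<cdot> j) q e"
    by (rule biproduct_pullback[OF biproduct_swap[OF b] biproduct_swap[OF b'], of "h \<cdot> j"]) auto
  have [simp]: "e \<in> Arr A" "Dom A e = Y" "Cod A e = V" using e by auto
  have e\<Delta>: "e \<in> \<Delta>" by (rule \<Delta>_stable[OF d e(4)]) (use V S in simp_all)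
  obtain k l where b'': "is_biproduct A (Cod A h) Y1 V j' k l p'" and l: "l \<cdot> i' = h \<cdot> i"
    by (rule biproduct_shear[OF biproduct_swap[OF b'], of "h \<cdot> i"]) auto
  note [simp] = biproduct_simps[OF b''] biproduct_Comp[OF b'']
  have "l \<in> \<Delta>" by (rule \<Delta>_split[OF biproduct_swap[OF b'']]) (use S Z V in simp_all)
  then have "l \<cdot> e \<in> \<Delta>" by (intro \<Delta>_Comp e\<Delta>) simp_all
  moreover have "l \<cdot> e = h"
  proof (rule biproduct_coext[OF b, of _ "Cod A h"])
    show "(l \<cdot> e) \<cdot> i = h \<cdot> i" "(l \<cdot> e) \<cdot> j = h \<cdot> j" by (simp_all add: e(2,3) l)
  qed simp_all
  ultimately show ?thesis by simp
qed

lemma refined_\<Delta>: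
  assumes "d \<in> \<Delta>" shows "refined A \<Delta> d"
  using refinedI[OF assms, of d A "Ident A (Dom A d)" "Ident A (Cod A d)" "Ident A (Cod A d)"] \<Delta>_Arr[OF assms] by simp

lemma refined_retract:
  assumes "is_retract A k p k' p'" "refined A \<Delta> p'"
  shows "refined A \<Delta> p"
proof -
  obtain i1 p1 i2 p2 i3 p3 where r: "retraction A k p k' p' i1 p1 i2 p2 i3 p3"
    using assms unfolding is_retract_def by blast
  note [simp] = retraction_simps[OF r] retraction_Comp[OF r]
  obtain d u r s where d: "d \<in> \<Delta>" "d \<in> Arr A" "u \<in> Hom A (Dom A d) (Dom A p')" "r \<in> Hom A (Cod A d) (Cod A p')"
    "s \<in> Hom A (Cod A p') (Cod A d)" and rs: "r \<cdot> s = Ident A (Cod A p')" and pu: "p' \<cdot> u = r \<cdot> d"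
    using assms(2) unfolding refined_def by auto
  have [simp]: "d \<in> Arr A" "u \<in> Arr A" "r \<in> Arr A" "s \<in> Arr A" "Dom A u = Dom A d" "Cod A u = Dom A p'"
    "Dom A r = Cod A d" "Cod A r = Cod A p'" "Dom A s = Cod A p'" "Cod A s = Cod A d"
    using d by simp_all
  have "p \<cdot> (p2 \<cdot> u) = p3 \<cdot> (p' \<cdot> u)" by simp
  also have "\<dots> = p3 \<cdot> (r \<cdot> d)" unfolding pu ..
  finally have "p \<cdot> (p2 \<cdot> u) = p3 \<cdot> (r \<cdot> d)" .
  moreover have "r \<cdot> (s \<cdot> i3) = i3" by (simp add: Comp_eq[OF rs])
  ultimately show ?thesis using refinedI[OF d(1), of p A "p2 \<cdot> u" "p3 \<cdot> r" "s \<cdot> i3"] by simp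
qed

text \<open>In the arrow \<open>[s p, d]\<close> the summand \<open>Dom A p\<close> has to be
  enlarged to an object \<open>U\<close> of \<open>S\<close>, which gives
  \<open>e = [s p q, d]\<close> with \<open>q\<close> the projection of \<open>U\<close>. It
  restricts to \<open>d\<close> on the second summand, so \<open>\<Delta>_extend\<close> applies.
  The retraction consists of the injection of \<open>Dom A p\<close> and \<open>w = [q, u]\<close>
  on the middle terms and of \<open>s\<close> and \<open>r\<close> on the right.\<close>

lemma refined_ex_retract:
  assumes k: "is_kernel A k p" and "refined A \<Delta> p"
  obtains k' d where "d \<in> \<Delta>" "kernel_cokernel_pair A k' d" "Dom A k' \<in> S" "is_retract A k p k' d"
proof -
  note [simp] = kernelD[OF k]
  obtain d u r s where d: "d \<in> \<Delta>" "d \<in> Arr A" "u \<in> Hom A (Dom A d) (Dom A p)" "r \<in> Hom A (Cod A d) (Cod A p)"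
    "s \<in> Hom A (Cod A p) (Cod A d)" and rs: "r \<cdot> s = Ident A (Cod A p)" and pu: "p \<cdot> u = r \<cdot> d"
    using assms(2) unfolding refined_def by auto
  have [simp]: "d \<in> Arr A" "u \<in> Arr A" "r \<in> Arr A" "s \<in> Arr A" "Dom A u = Dom A d" "Cod A u = Dom A p"
    "Dom A r = Cod A d" "Cod A r = Cod A p" "Dom A s = Cod A p" "Cod A s = Cod A d"
    using d by simp_all
  obtain V U i j q x where U: "U \<in> S" and b: "is_biproduct A (Dom A p) V U i j q x"
    using S_complement[of "Dom A p"] by auto
  have Y: "Dom A d \<in> S" using \<Delta>_Arr[OF d(1)] by simp
  obtain T i' j' p' q' where T: "T \<in> S" and b': "is_biproduct A U (Dom A d) T i' j' p' q'"
    using S_biproduct[OF U Y] by blast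
  note [simp] = biproduct_simps[OF b] biproduct_simps[OF b'] biproduct_Comp[OF b] biproduct_Comp[OF b']
  obtain e where e: "e \<in> Arr A" "Dom A e = T" "Cod A e = Cod A d" "e \<cdot> i' = s \<cdot> (p \<cdot> q)" "e \<cdot> j' = d"
    by (rule biproduct_coex[OF b', of "s \<cdot> (p \<cdot> q)" "Cod A d" d]) auto
  obtain w where w: "w \<in> Arr A" "Dom A w = T" "Cod A w = Dom A p" "w \<cdot> i' = q" "w \<cdot> j' = u"
    by (rule biproduct_coex[OF b', of q "Dom A p" u]) auto
  note [simp] = e w
  have [simp]: "e \<cdot> (i' \<cdot> y) = s \<cdot> (p \<cdot> (q \<cdot> y))" "w \<cdot> (i' \<cdot> y) = q \<cdot> y" if "y \<in> Arr A" "Cod A y = U" for y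
    using that by (simp_all add: Comp_eq[OF e(4)] Comp_eq[OF w(4)])
  have [simp]: "r \<cdot> (s \<cdot> y) = y" if "y \<in> Arr A" "Cod A y = Cod A p" for y
    using that by (simp add: Comp_eq[OF rs])
  have e\<Delta>: "e \<in> \<Delta>" by (rule \<Delta>_extend[OF b']) (use U T d in simp_all)
  then obtain k' where k': "kernel_cokernel_pair A k' e" "Dom A k' \<in> S" using \<Delta>_kernel by blast
  have re: "r \<cdot> e = p \<cdot> w"
    by (rule biproduct_coext[OF b', of _ "Cod A p"]) (simp_all add: pu)
  obtain i1 p1 where "retraction A k p k' e i1 p1 (i' \<cdot> i) w s r"
    by (rule retraction_of_kernels[OF k, of k' e "i' \<cdot> i" w s r])
      (use k'(1) rs re in \<open>simp_all add: kernel_cokernel_pair_def\<close>)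
  then have "is_retract A k p k' e" unfolding is_retract_def by blast
  with e\<Delta> k' show thesis by (rule that)
qed

text \<open>The cokernel property of an honest conflation passes to its retracts. So for a refined
  arrow it suffices to find a kernel.\<close>

lemma refined_kernel_cokernel_pair:
  assumes "is_kernel A k p" "refined A \<Delta> p"
  shows "kernel_cokernel_pair A k p"
  using refined_ex_retract[OF assms] retract_kernel_cokernel_pair by metis

text \<open>Once the objects lie in \<open>S\<close>, adding a single split sequence
  \<open>P \<rightarrow> P \<rightarrow> 0\<close> to \<open>(k, p)\<close> turns \<open>p\<close>
  into a member of \<open>\<Delta>\<close>. The object \<open>P\<close> is the domain of a deflation
  \<open>d1\<close> that factors through \<open>p\<close>.\<close>

lemma refined_add_left:
  assumes kc: "kernel_cokernel_pair A k p" and p: "refined A \<Delta> p"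
    and S: "Dom A k \<in> S" "Dom A p \<in> S" "Cod A p \<in> S"
  obtains k' p' f f' where "p' \<in> \<Delta>" "kernel_cokernel_pair A k' p'" "Dom A k' \<in> S" "is_retract A k p k' p'"
    "is_pushout A f k f' k'" "Cod A p' = Cod A p"
proof -
  have K: "is_kernel A k p" using kc by (simp add: kernel_cokernel_pair_def)
  note [simp] = kernelD[OF K]
  obtain d u r s where d: "d \<in> \<Delta>" "d \<in> Arr A" "u \<in> Hom A (Dom A d) (Dom A p)" "r \<in> Hom A (Cod A d) (Cod A p)"
    "s \<in> Hom A (Cod A p) (Cod A d)" and rs: "r \<cdot> s = Ident A (Cod A p)" and pu: "p \<cdot> u = r \<cdot> d"
    using p unfolding refined_def by auto
  have [simp]: "d \<in> Arr A" "u \<in> Arr A" "r \<in> Arr A" "s \<in> Arr A" "Dom A u = Dom A d" "Cod A u = Dom A p"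
    "Dom A r = Cod A d" "Cod A r = Cod A p" "Dom A s = Cod A p" "Cod A s = Cod A d"
    using d by simp_all
  \<comment> \<open>Pulling \<open>d\<close> back along the section \<open>s\<close> removes the
    split epimorphism \<open>r\<close>: the result \<open>d1\<close> ends in \<open>Cod A p\<close>
    and equals \<open>p (u a)\<close>.\<close>
  obtain a d1 where pb: "is_pullback A s d a d1" and P: "Dom A d1 \<in> S"
    using \<Delta>_pullback[OF d(1), of s] S by auto
  note [simp] = pullbackD(3,4)[OF pb] pullbackD(6-9)[OF pb, simplified]
  have d1: "d1 \<in> \<Delta>" by (rule \<Delta>_stable[OF d(1) pb _ P]) (use S in simp)
  have "p \<cdot> (u \<cdot> a) = r \<cdot> (d \<cdot> a)" by (rule Comp_eq_Comp[OF pu]) simp_all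
  also have "\<dots> = d1" by (simp add: Comp_eq[OF rs])
  finally have w: "p \<cdot> (u \<cdot> a) = d1" .
  obtain T i j q x where T: "T \<in> S" and b: "is_biproduct A (Dom A p) (Dom A d1) T i j q x"
    using S_biproduct[OF S(2) P] by blast
  \<comment> \<open>The sheared projection is \<open>q' = [1, u a]\<close>, hence
    \<open>p q' = [p, d1]\<close>. One arrow is thus both the deflation of the enlarged pair and an
    extension of \<open>d1\<close>.\<close>
  obtain j' q' where b': "is_biproduct A (Dom A p) (Dom A d1) T i j' q' x" and q': "q' \<cdot> j = u \<cdot> a"
    by (rule biproduct_shear[OF b, of "u \<cdot> a"]) auto
  obtain T' l m n y where T': "T' \<in> S" and b'': "is_biproduct A (Dom A k) (Dom A d1) T' l m n y"
    using S_biproduct[OF S(1) P] by blast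
  note [simp] = biproduct_simps[OF b] biproduct_simps[OF b'] biproduct_simps[OF b'']
  obtain k' where k': "k' \<in> Hom A T' T" "kernel_cokernel_pair A k' (p \<cdot> q')" "is_pushout A l k i k'"
    "is_retract A k p k' (p \<cdot> q')"
    by (rule biproduct_add_left[OF kc b'' b'])
  have "p \<cdot> q' \<in> \<Delta>"
    by (rule \<Delta>_extend[OF b]) (use S T d1 w q' in simp_all)
  then show thesis by (rule that[of _ k' l i]) (use k' T' in simp_all)
qed

text \<open>
  The pullback is split off a pullback of a deflation \<open>d\<close>. The complementary summand is known beforehand: it
  consists of complements of \<open>Dom A k\<close> and \<open>Dom A f\<close>, so the splitting takes place in the ambient category.
\<close>

lemma refined_pullback_ex:
  assumes k: "is_kernel A k p" and p: "refined A \<Delta> p" and f: "f \<in> Arr A" "Cod A f = Cod A p"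
  shows "\<exists>f' p'. is_pullback A f p f' p'"
proof -
  obtain k' d where d: "d \<in> \<Delta>" "kernel_cokernel_pair A k' d" "Dom A k' \<in> S" "is_retract A k p k' d"
    by (rule refined_ex_retract[OF k p])
  have K': "is_kernel A k' d" using d by (simp add: kernel_cokernel_pair_def)
  obtain i1 p1 i2 p2 i3 p3 where r: "retraction A k p k' d i1 p1 i2 p2 i3 p3"
    using d(4) unfolding is_retract_def by blast
  note [simp] = retraction_simps[OF r] retraction_Comp[OF r] f
  obtain X1 j1 q1 where b1: "is_biproduct A (Dom A k) X1 (Dom A k') i1 j1 p1 q1"
    using retract_complement[of i1 "Dom A k" "Dom A k'" p1] by auto
  obtain V U i j q x where U: "U \<in> S" and b: "is_biproduct A (Dom A f) V U i j q x"
    using S_complement[of "Dom A f"] by auto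
  note [simp] = biproduct_simps[OF b] biproduct_simps[OF b1] biproduct_Comp[OF b] biproduct_Comp[OF b1]
  \<comment> \<open>\<open>C = X1 \<oplus> V\<close> is the part by which the pullback over
    \<open>U\<close> will exceed the desired one: \<open>X1\<close> comes from enlarging the kernel
    of \<open>p\<close> to that of \<open>d\<close>, and \<open>V\<close> from enlarging
    \<open>Dom A f\<close> to \<open>U\<close>.\<close>
  obtain C \<alpha> \<beta> \<gamma> \<delta> where c: "is_biproduct A X1 V C \<alpha> \<beta> \<gamma> \<delta>"
    using ex_biproduct[of X1 V] by auto
  note [simp] = biproduct_simps[OF c] biproduct_Comp[OF c]
  obtain a d1 where pb: "is_pullback A (i3 \<cdot> (f \<cdot> q)) d a d1"
    using \<Delta>_pullback[OF d(1), of "i3 \<cdot> (f \<cdot> q)"] U by auto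
  note [simp] = pullbackD(3,4)[OF pb] pullbackD(6-9)[OF pb, simplified]
  have da [simp]: "d \<cdot> (a \<cdot> y) = i3 \<cdot> (f \<cdot> (q \<cdot> (d1 \<cdot> y)))" if "y \<in> Arr A" "Cod A y = Dom A d1" for y
    using that Comp_eq_Comp[OF pullbackD(9)[OF pb], of y] by simp
  have dk [simp]: "d \<cdot> (k' \<cdot> y) = Null A (Dom A y) (Cod A d)" if "y \<in> Arr A" "Cod A y = Dom A k'" for y
    using that kernelD[OF K'] by (simp add: Comp_eq[of d k'])
  have mono: "y = z" if "k' \<cdot> y = k' \<cdot> z" "y \<in> Hom A W (Dom A k')" "z \<in> Hom A W (Dom A k')" for y z W
    using kernel_ext[OF K' that(2,3,1)] .

  \<comment> \<open>\<open>X1\<close> and \<open>V\<close> enter the large pullback with components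
    \<open>(k' j1, 0)\<close> and \<open>(0, j)\<close>, and \<open>m = [m1, m2]\<close> is the
    resulting inclusion of \<open>C\<close>.\<close>
  obtain m1 where m1 [simp]: "m1 \<in> Arr A" "Dom A m1 = X1" "Cod A m1 = Dom A d1" "a \<cdot> m1 = k' \<cdot> j1"
    "d1 \<cdot> m1 = Null A X1 U"
    by (rule pullback_ex[OF pb, of "k' \<cdot> j1" X1 "Null A X1 U"]) auto
  obtain m2 where m2 [simp]: "m2 \<in> Arr A" "Dom A m2 = V" "Cod A m2 = Dom A d1" "a \<cdot> m2 = Null A V (Dom A d)"
    "d1 \<cdot> m2 = j"
    by (rule pullback_ex[OF pb, of "Null A V (Dom A d)" V j]) auto
  obtain m where m [simp]: "m \<in> Arr A" "Dom A m = C" "Cod A m = Dom A d1" "m \<cdot> \<alpha> = m1" "m \<cdot> \<beta> = m2"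
    by (rule biproduct_coex[OF c, of m1 "Dom A d1" m2]) auto

  \<comment> \<open>The part of \<open>a\<close> outside the summand \<open>Dom A p\<close>. It is
    killed by \<open>d\<close>, so it factors through \<open>k'\<close> as \<open>t\<close>, and the
    components of the retraction \<open>n\<close> of \<open>m\<close> are read off from
    \<open>t\<close> and \<open>x d1\<close>.\<close>
  let ?c = "a \<boxplus> neg A (i2 \<cdot> (p2 \<cdot> a))"
  have p3d: "p \<cdot> (p2 \<cdot> y) = p3 \<cdot> (d \<cdot> y)" if "y \<in> Arr A" "Cod A y = Dom A d" for y
    using that by simp
  have "d \<cdot> (i2 \<cdot> (p2 \<cdot> a)) = i3 \<cdot> (p \<cdot> (p2 \<cdot> a))" by simp
  also have "\<dots> = i3 \<cdot> (f \<cdot> (q \<cdot> d1))" by (subst p3d) simp_all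
  finally have "d \<cdot> ?c = Null A (Dom A d1) (Cod A d)" by (simp add: Comp_Plus neg_Comp)
  then obtain t where t [simp]: "t \<in> Arr A" "Dom A t = Dom A d1" "Cod A t = Dom A k'" and kt: "k' \<cdot> t = ?c"
    by (rule_tac kernel_ex[OF K', of ?c]) auto
  have kt': "k' \<cdot> (t \<cdot> y) = a \<cdot> y \<boxplus> neg A (i2 \<cdot> (p2 \<cdot> (a \<cdot> y)))" if "y \<in> Arr A" "Cod A y = Dom A d1" for y
    using that by (simp add: Comp_eq[OF kt] Comp_Plus neg_Comp)
  obtain n where n [simp]: "n \<in> Arr A" "Dom A n = Dom A d1" "Cod A n = C" "\<gamma> \<cdot> n = q1 \<cdot> t" "\<delta> \<cdot> n = x \<cdot> d1"
    by (rule biproduct_ex[OF c, of "q1 \<cdot> t" "Dom A d1" "x \<cdot> d1"]) auto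
  have n' [simp]: "\<gamma> \<cdot> (n \<cdot> y) = q1 \<cdot> (t \<cdot> y)" "\<delta> \<cdot> (n \<cdot> y) = x \<cdot> (d1 \<cdot> y)" if "y \<in> Arr A" "Cod A y = Dom A d1" for y
    using that by (simp_all add: Comp_eq[OF n(4)] Comp_eq[OF n(5)])

  have [simp]: "t \<cdot> m1 = j1" by (rule mono[of _ _ X1]) (simp_all add: kt')
  have [simp]: "t \<cdot> m2 = Null A V (Dom A k')" by (rule mono[of _ _ V]) (simp_all add: kt')
  have 1: "n \<cdot> m1 = \<alpha>" by (rule biproduct_ext[OF c, of _ X1]) simp_all
  have 2: "n \<cdot> m2 = \<beta>" by (rule biproduct_ext[OF c, of _ V]) simp_all
  have "n \<cdot> m = Ident A C" by (rule biproduct_coext[OF c, of _ C]) (simp_all add: 1 2)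
  then obtain P h l where e: "is_biproduct A C P (Dom A d1) m h n l"
    using retract_complement[of m C "Dom A d1" n] by auto
  note [simp] = biproduct_simps[OF e] biproduct_Comp[OF e]

  \<comment> \<open>Since \<open>p2\<close> kills \<open>?c\<close>, the arrow \<open>t\<close>
    lands in the summand \<open>X1\<close>. On the complement \<open>P\<close> of \<open>C\<close>
    this component vanishes too, so \<open>t h = 0\<close>, and \<open>a h\<close> and
    \<open>d1 h\<close> lie in the summands \<open>Dom A p\<close> and
    \<open>Dom A f\<close>.\<close>
  have "k \<cdot> (p1 \<cdot> t) = p2 \<cdot> (k' \<cdot> t)" by simp
  also have "\<dots> = k \<cdot> Null A (Dom A d1) (Dom A k)" unfolding kt by (simp add: Comp_Plus neg_Comp)
  finally have "k \<cdot> (p1 \<cdot> t) = k \<cdot> Null A (Dom A d1) (Dom A k)" .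
  from kernel_ext[OF k _ _ this, of "Dom A d1"] have p1t: "p1 \<cdot> t = Null A (Dom A d1) (Dom A k)" by simp
  have q1th: "q1 \<cdot> (t \<cdot> h) = Null A P X1" using n'(1)[of h] by (simp del: n')
  have th: "t \<cdot> h = Null A P (Dom A k')"
    by (rule biproduct_ext[OF b1, of _ P]) (simp_all add: q1th Comp_eq[OF p1t])
  have "a \<cdot> h \<boxplus> neg A (i2 \<cdot> (p2 \<cdot> (a \<cdot> h))) = Null A P (Dom A d)" using kt'[of h] unfolding th by simp
  then have ah: "a \<cdot> h = i2 \<cdot> (p2 \<cdot> (a \<cdot> h))" by (rule Plus_neg_eq_Null) simp_all
  have xh: "x \<cdot> (d1 \<cdot> h) = Null A P V" using n'(2)[of h] by (simp del: n')
  have dh: "d1 \<cdot> h = i \<cdot> (q \<cdot> (d1 \<cdot> h))"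
    by (rule biproduct_ext[OF b, of _ P]) (simp_all add: xh)

  have "is_pullback A f p (p2 \<cdot> (a \<cdot> h)) (q \<cdot> (d1 \<cdot> h))"
  proof (rule pullbackI; simp?)
    show "p \<cdot> (p2 \<cdot> (a \<cdot> h)) = f \<cdot> (q \<cdot> (d1 \<cdot> h))" by (subst p3d) simp_all
  next
    fix u v assume [simp]: "u \<in> Arr A" "v \<in> Arr A" "Dom A u = Dom A v" "Cod A u = Dom A p" "Cod A v = Dom A f"
      "p \<cdot> u = f \<cdot> v"
    \<comment> \<open>A compatible pair \<open>u\<close>, \<open>v\<close> induces \<open>y\<close>
      into the large pullback. Both components of \<open>n y\<close> vanish, so \<open>y\<close>
      comes from \<open>P\<close>.\<close>
    obtain y where y [simp]: "y \<in> Arr A" "Dom A y = Dom A v" "Cod A y = Dom A d1" "a \<cdot> y = i2 \<cdot> u" "d1 \<cdot> y = i \<cdot> v"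
      by (rule pullback_ex[OF pb, of "i2 \<cdot> u" "Dom A v" "i \<cdot> v"]) auto
    have [simp]: "t \<cdot> y = Null A (Dom A v) (Dom A k')"
      by (rule mono[of _ _ "Dom A v"]) (simp_all add: kt' kernelD[OF K'])
    have ny: "n \<cdot> y = Null A (Dom A v) C" by (rule biproduct_ext[OF c, of _ "Dom A v"]) simp_all
    have [simp]: "h \<cdot> (l \<cdot> y) = y" by (rule biproduct_ext[OF e, of _ "Dom A v"]) (simp_all add: ny)
    show "\<exists>h'\<in>Arr A. Dom A h' = Dom A v \<and> Cod A h' = P \<and> (p2 \<cdot> (a \<cdot> h)) \<cdot> h' = u \<and> (q \<cdot> (d1 \<cdot> h)) \<cdot> h' = v"
      by (intro bexI[of _ "l \<cdot> y"]) simp_all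
  next
    fix y z assume [simp]: "y \<in> Arr A" "z \<in> Arr A" "Dom A y = Dom A z" "Cod A y = P" "Cod A z = P"
      and yz: "p2 \<cdot> (a \<cdot> (h \<cdot> y)) = p2 \<cdot> (a \<cdot> (h \<cdot> z))" "q \<cdot> (d1 \<cdot> (h \<cdot> y)) = q \<cdot> (d1 \<cdot> (h \<cdot> z))"
    have A: "a \<cdot> (h \<cdot> w) = i2 \<cdot> (p2 \<cdot> (a \<cdot> (h \<cdot> w)))" "d1 \<cdot> (h \<cdot> w) = i \<cdot> (q \<cdot> (d1 \<cdot> (h \<cdot> w)))"
      if "w \<in> Arr A" "Cod A w = P" for w
      using that Comp_eq[OF ah, of w] Comp_eq[OF dh, of w] by simp_all
    have "a \<cdot> (h \<cdot> y) = a \<cdot> (h \<cdot> z)" by (subst (1 2) A(1); simp add: yz)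
    moreover have "d1 \<cdot> (h \<cdot> y) = d1 \<cdot> (h \<cdot> z)" by (subst (1 2) A(2); simp add: yz)
    ultimately have *: "h \<cdot> y = h \<cdot> z" by (rule pullback_ext[OF pb, of _ "Dom A z", rotated 2]) simp_all
    have "l \<cdot> (h \<cdot> y) = l \<cdot> (h \<cdot> z)" unfolding * ..
    then show "y = z" by simp
  qed
  then show ?thesis by blast
qed

end

section \<open>The intersection of the two structures\<close>

lemma (in category) iso_sequences_inverse:
  assumes "iso_sequences A f g f' g'"
  obtains a b c a' b' c' where
    "a \<in> Hom A (Dom A f) (Dom A f')" "b \<in> Hom A (Cod A f) (Cod A f')" "c \<in> Hom A (Cod A g) (Cod A g')"
    "a' \<in> Hom A (Dom A f') (Dom A f)" "b' \<in> Hom A (Cod A f') (Cod A f)" "c' \<in> Hom A (Cod A g') (Cod A g)"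
    "a \<cdot> a' = Ident A (Dom A f')" "b \<cdot> b' = Ident A (Cod A f')" "c \<cdot> c' = Ident A (Cod A g')"
    "a' \<cdot> a = Ident A (Dom A f)" "b' \<cdot> b = Ident A (Cod A f)" "c' \<cdot> c = Ident A (Cod A g)"
    "b \<cdot> f = f' \<cdot> a" "c \<cdot> g = g' \<cdot> b" "f \<cdot> a' = b' \<cdot> f'" "g \<cdot> b' = c' \<cdot> g'"
proof -
  obtain a b c where abc: "is_sequence A f g" "is_sequence A f' g'"
    "a \<in> Hom A (Dom A f) (Dom A f')" "b \<in> Hom A (Cod A f) (Cod A f')" "c \<in> Hom A (Cod A g) (Cod A g')"
    "is_iso A a" "is_iso A b" "is_iso A c" "b \<cdot> f = f' \<cdot> a" "c \<cdot> g = g' \<cdot> b"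
    using assms unfolding iso_sequences_def by blast
  obtain a' b' c' where abc':
    "a' \<in> Hom A (Dom A f') (Dom A f)" "b' \<in> Hom A (Cod A f') (Cod A f)" "c' \<in> Hom A (Cod A g') (Cod A g)"
    "a \<cdot> a' = Ident A (Dom A f')" "b \<cdot> b' = Ident A (Cod A f')" "c \<cdot> c' = Ident A (Cod A g')"
    "a' \<cdot> a = Ident A (Dom A f)" "b' \<cdot> b = Ident A (Cod A f)" "c' \<cdot> c = Ident A (Cod A g)"
    using abc(3-8) unfolding is_iso_def by auto
  have inverse: "x \<cdot> v = w \<cdot> x'"
    if "x \<in> Arr A" "x' \<in> Arr A" "v \<in> Hom A (Dom A x') (Dom A x)" "w \<in> Hom A (Cod A x') (Cod A x)"
      "s \<in> Hom A (Dom A x) (Dom A x')" "t \<in> Hom A (Cod A x) (Cod A x')"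
      "s \<cdot> v = Ident A (Dom A x')" "w \<cdot> t = Ident A (Cod A x)" "t \<cdot> x = x' \<cdot> s" for x x' v w s t
  proof -
    have "x \<cdot> v = (w \<cdot> t) \<cdot> (x \<cdot> v)" using that(1-6) unfolding that(8) by simp
    also have "\<dots> = w \<cdot> (t \<cdot> (x \<cdot> v))" using that by (subst assoc) simp_all
    also have "t \<cdot> (x \<cdot> v) = x' \<cdot> (s \<cdot> v)" by (rule Comp_eq_Comp[OF that(9)]) (use that in simp_all)
    also have "w \<cdot> (x' \<cdot> (s \<cdot> v)) = w \<cdot> x'" using that(1-6) unfolding that(7) by simp
    finally show ?thesis .
  qed
  have "f \<cdot> a' = b' \<cdot> f'"
    by (rule inverse[of f f' a' b' a b]) (use abc abc' in \<open>simp_all add: is_sequence_def\<close>)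
  moreover have "g \<cdot> b' = c' \<cdot> g'"
    by (rule inverse[of g g' b' c' b c]) (use abc abc' in \<open>simp_all add: is_sequence_def\<close>)
  ultimately show thesis using that abc(3-5,9,10) abc' by blast
qed

lemma (in category) iso_sequences_sym:
  assumes "iso_sequences A f g f' g'"
  shows "iso_sequences A f' g' f g"
proof -
  obtain a b c a' b' c' where
    *: "a \<in> Hom A (Dom A f) (Dom A f')" "b \<in> Hom A (Cod A f) (Cod A f')" "c \<in> Hom A (Cod A g) (Cod A g')"
    "a' \<in> Hom A (Dom A f') (Dom A f)" "b' \<in> Hom A (Cod A f') (Cod A f)" "c' \<in> Hom A (Cod A g') (Cod A g)"
    "a \<cdot> a' = Ident A (Dom A f')" "b \<cdot> b' = Ident A (Cod A f')" "c \<cdot> c' = Ident A (Cod A g')"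
    "a' \<cdot> a = Ident A (Dom A f)" "b' \<cdot> b = Ident A (Cod A f)" "c' \<cdot> c = Ident A (Cod A g)"
    "b \<cdot> f = f' \<cdot> a" "c \<cdot> g = g' \<cdot> b" "f \<cdot> a' = b' \<cdot> f'" "g \<cdot> b' = c' \<cdot> g'"
    by (rule iso_sequences_inverse[OF assms])
  have "is_iso A a'" "is_iso A b'" "is_iso A c'"
    using * unfolding is_iso_def by auto
  moreover have "is_sequence A f g" "is_sequence A f' g'" using assms by (simp_all add: iso_sequences_def)
  ultimately show ?thesis using *(4-6) *(15,16)[symmetric] unfolding iso_sequences_def by blast
qed

text \<open>Passing to the opposite category reverses the three component isomorphisms, so symmetry
  is used to restore their direction.\<close>

lemma iso_sequences_op:
  assumes "category A"
  shows "iso_sequences (opc A) g f g' f' \<longleftrightarrow> iso_sequences A f g f' g'"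
proof -
  have *: "iso_sequences A f' g' f g" if "iso_sequences (opc A) g f g' f'" for A :: "('o, 'm) cat" and f g f' g'
  proof -
    from that obtain a b c where "is_sequence A f g" "is_sequence A f' g'"
      "a \<in> Hom A (Cod A g') (Cod A g)" "b \<in> Hom A (Dom A g') (Dom A g)" "c \<in> Hom A (Dom A f') (Dom A f)"
      "is_iso A a" "is_iso A b" "is_iso A c" "g \<cdot>\<^bsub>A\<^esub> b = a \<cdot>\<^bsub>A\<^esub> g'" "f \<cdot>\<^bsub>A\<^esub> c = b \<cdot>\<^bsub>A\<^esub> f'"
      unfolding iso_sequences_def opc_simps opc_iff by blast
    moreover from this(1,2) have "Dom A g' = Cod A f'" "Dom A g = Cod A f" by (simp_all add: is_sequence_def)
    ultimately have *: "is_sequence A f g" "is_sequence A f' g'"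
      "c \<in> Hom A (Dom A f') (Dom A f)" "b \<in> Hom A (Cod A f') (Cod A f)" "a \<in> Hom A (Cod A g') (Cod A g)"
      "is_iso A c" "is_iso A b" "is_iso A a" "b \<cdot>\<^bsub>A\<^esub> f' = f \<cdot>\<^bsub>A\<^esub> c" "a \<cdot>\<^bsub>A\<^esub> g' = g \<cdot>\<^bsub>A\<^esub> b"
      by simp_all
    show ?thesis unfolding iso_sequences_def
      using *(1,2) by (intro conjI bexI[OF _ *(3)] bexI[OF _ *(4)] bexI[OF _ *(5)]) (use * in simp_all)
  qed
  interpret category A by fact
  interpret op: category "opc A" by (rule op_category)
  show ?thesis
    using *[of A g f g' f'] *[of "opc A" f g f' g'] iso_sequences_sym[of f g f' g']
      iso_sequences_sym[of f' g' f g] op.iso_sequences_sym[of g' f' g f]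
    unfolding opc_opc by (rule_tac iffI) iprover+
qed

lemma inflation_exact_op:
  assumes "additive_category A"
  shows "inflation_exact_structure A C \<longleftrightarrow> deflation_exact_structure (opc A) (C\<inverse>)"
proof -
  interpret additive_category A by fact
  interpret op: additive_category "opc A" by (rule op_additive)
  have infl: "deflation (C\<inverse>) = inflation C" by (auto simp: deflation_def inflation_def)
  have comp: "(\<forall>p q. inflation C p \<longrightarrow> inflation C q \<longrightarrow> Dom A p = Cod A q \<longrightarrow> inflation C (p \<cdot>\<^bsub>A\<^esub> q)) \<longleftrightarrow>
      (\<forall>i j. inflation C i \<longrightarrow> inflation C j \<longrightarrow> Cod A i = Dom A j \<longrightarrow> inflation C (j \<cdot>\<^bsub>A\<^esub> i))"
    by (rule iffI; intro allI impI; metis)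
  have cs: "conflation_structure A C \<longleftrightarrow> conflation_structure (opc A) (C\<inverse>)"
    unfolding conflation_structure_def conflation_structure_axioms_def opc_iff iso_sequences_op[OF category_axioms]
      using additive_category_axioms op.additive_category_axioms by auto
  show ?thesis
    unfolding inflation_exact_structure_def deflation_exact_structure_def cs
      inflation_exact_structure_axioms_def deflation_exact_structure_axioms_def opc_iff opc_simps infl
    unfolding comp by blast
qed

section \<open>Completed structures in terms of refined arrows\<close>

definition conflations_of :: "('o, 'm) cat \<Rightarrow> 'o set \<Rightarrow> 'm set \<Rightarrow> ('m \<times> 'm) set" where
  "conflations_of A S \<Delta> = {(k, d). kernel_cokernel_pair A k d \<and> Dom A k \<in> S \<and> d \<in> \<Delta>}"

text \<open>\<open>completed_conflations\<close> with the embedding removed: \<open>C\<close> is a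
  set of pairs in the ambient category itself.\<close>

definition summands :: "('o, 'm) cat \<Rightarrow> ('m \<times> 'm) set \<Rightarrow> ('m \<times> 'm) set" where
  "summands A C = {(f, g). is_sequence A f g \<and> (\<exists>(u, v)\<in>C. is_direct_summand A f g u v)}"

lemma (in ambient_category) summands_iff:
  "(f, g) \<in> summands A C \<longleftrightarrow> (\<exists>u v. (u, v) \<in> C \<and> is_retract A f g u v)"
proof -
  have "is_direct_summand A f g u v \<longleftrightarrow> is_retract A f g u v" for u v
    using is_retract_direct_summand is_direct_summand_retract by blast
  moreover have "is_sequence A f g" if "is_retract A f g u v" for u v
    using that by (auto simp: is_retract_def retraction_def)
  ultimately show ?thesis unfolding summands_def by auto
qed

text \<open>Kernels and refinement are inherited by retracts, and members of \<open>\<Delta>\<close>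
  are refined by themselves; the converse is \<open>refined_ex_retract\<close>.\<close>

lemma (in deflation_class) summands_conflations_of:
  "(k, p) \<in> summands A (conflations_of A S \<Delta>) \<longleftrightarrow> is_kernel A k p \<and> refined A \<Delta> p"
proof
  assume "(k, p) \<in> summands A (conflations_of A S \<Delta>)"
  then show "is_kernel A k p \<and> refined A \<Delta> p"
    unfolding summands_iff conflations_of_def kernel_cokernel_pair_def
    using retract_kernel refined_retract refined_\<Delta> by blast
next
  assume "is_kernel A k p \<and> refined A \<Delta> p"
  then show "(k, p) \<in> summands A (conflations_of A S \<Delta>)"
    unfolding summands_iff conflations_of_def using refined_ex_retract[of k p] by (simp, metis)
qed

text \<open>\<open>\<Gamma>\<close> stands for the inflations of the second structure, regarded as
  deflations of the opposite category. The two classes are otherwise unrelated and meet only in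
  \<open>exact_pairs\<close>.\<close>

locale two_sided = deflation_class + op: deflation_class "opc A" S \<Gamma> for \<Gamma>
begin

text \<open>This set is self-dual: passing to the opposite category and exchanging
  \<open>\<Delta>\<close> with \<open>\<Gamma>\<close> merely turns the pairs around, so each
  one-sided result also yields its dual.\<close>

definition exact_pairs where
  "exact_pairs = {(k, p). kernel_cokernel_pair A k p \<and> refined A \<Delta> p \<and> refined (opc A) \<Gamma> k}"

lemma op_two_sided: "two_sided (opc A) S \<Gamma> \<Delta>"
  unfolding two_sided_def opc_opc
  using deflation_class_axioms op.deflation_class_axioms by blast

lemma exact_pairsI:
  assumes "is_kernel A k p" "refined A \<Delta> p" "refined (opc A) \<Gamma> k"
  shows "(k, p) \<in> exact_pairs"
  using assms refined_kernel_cokernel_pair by (auto simp: exact_pairs_def)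

lemma exact_pairs_Int: "summands A (conflations_of A S \<Delta>) \<inter> summands A ((conflations_of (opc A) S \<Gamma>)\<inverse>) = exact_pairs"
proof -
  have *: "(k, p) \<in> summands A (C\<inverse>) \<longleftrightarrow> (p, k) \<in> summands (opc A) C" for k p C
    unfolding summands_iff op.summands_iff is_retract_op by auto
  show ?thesis
    by (auto simp: exact_pairs_def summands_conflations_of * op.summands_conflations_of opc_iff kernel_cokernel_pair_def
        simp del: converse_iff)
qed

text \<open>Adding \<open>M \<rightarrow> M \<rightarrow> 0\<close> is harmless on both sides: the
  new deflation restricts to \<open>p\<close> along \<open>i2\<close>, so
  \<open>refined_right_factor\<close> applies, and the new inflation is a pushout of
  \<open>k\<close>.\<close>

lemma exact_pairs_left:
  assumes "(k, p) \<in> exact_pairs" "is_biproduct A (Dom A k) M X' i1 j1 p1 q1" "is_biproduct A (Dom A p) M Y' i2 j2 p2 q2"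
  obtains k' p' where "(k', p') \<in> exact_pairs" "is_retract A k p k' p'" "Dom A k' = X'" "Dom A p' = Y'" "Cod A p' = Cod A p"
proof -
  have kc: "kernel_cokernel_pair A k p" and p: "refined A \<Delta> p" and k: "refined (opc A) \<Gamma> k"
    using assms(1) by (auto simp: exact_pairs_def)
  have "is_kernel A k p" using kc by (simp add: kernel_cokernel_pair_def)
  note [simp] = kernelD[OF this] biproduct_simps[OF assms(3)]
  obtain k' where k': "k' \<in> Hom A X' Y'" "kernel_cokernel_pair A k' (p \<cdot> p2)" "is_pushout A i1 k i2 k'"
    "is_retract A k p k' (p \<cdot> p2)"
    by (rule biproduct_add_left[OF kc assms(2,3)])
  have "(p \<cdot> p2) \<cdot> i2 = p" by simp
  then have "refined A \<Delta> (p \<cdot> p2)" using p by (intro refined_right_factor[of "p \<cdot> p2" i2]) simp_all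
  moreover have "refined (opc A) \<Gamma> k'"
    by (rule op.refined_pullback[of i1 k i2 k']) (use k' k in \<open>simp_all add: opc_iff\<close>)
  ultimately have "(k', p \<cdot> p2) \<in> exact_pairs" using k' by (simp add: exact_pairs_def)
  then show thesis by (rule that) (use k' in simp_all)
qed

lemma exact_pairs_right:
  assumes "(k, p) \<in> exact_pairs" "is_biproduct A (Cod A p) M Z' i1 j1 p1 q1" "is_biproduct A (Dom A p) M Y' i2 j2 p2 q2"
  obtains k' p' where "(k', p') \<in> exact_pairs" "is_retract A k p k' p'" "Dom A k' = Dom A k" "Dom A p' = Y'" "Cod A p' = Z'"
proof -
  interpret dual: two_sided "opc A" S \<Gamma> \<Delta> by (rule op_two_sided)
  have E: "(a, b) \<in> dual.exact_pairs \<longleftrightarrow> (b, a) \<in> exact_pairs" for a b by (auto simp: dual.exact_pairs_def exact_pairs_def opc_iff)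
  have seq: "Cod A a = Dom A b" if "(a, b) \<in> exact_pairs" for a b
    using that by (auto simp: exact_pairs_def kernel_cokernel_pair_def is_kernel_def is_sequence_def)
  obtain k' p' where "(k', p') \<in> exact_pairs" "is_retract A k p k' p'" "Dom A k' = Dom A k" "Cod A k' = Y'" "Cod A p' = Z'"
    using dual.exact_pairs_left[of p k M Z' p1 q1 i1 j1 Y' p2 q2 i2 j2, unfolded E opc_iff is_retract_op opc_simps] assms seq[OF assms(1)]
    by metis
  then show thesis using that seq by metis
qed

text \<open>The objects are moved into \<open>S\<close> from left to right, each by adding a
  complement \<open>V\<close> from \<open>S\<close>. Since \<open>S\<close> is closed under
  biproducts, an object already treated stays in \<open>S\<close> when a later complement is added
  to it.\<close>

lemma exact_pairs_summands: "summands A (conflations_of A S \<Delta> \<inter> (conflations_of (opc A) S \<Gamma>)\<inverse>) = exact_pairs"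
proof
  show "summands A (conflations_of A S \<Delta> \<inter> (conflations_of (opc A) S \<Gamma>)\<inverse>) \<subseteq> exact_pairs"
    unfolding exact_pairs_Int[symmetric] by (auto simp: summands_def)
  show "exact_pairs \<subseteq> summands A (conflations_of A S \<Delta> \<inter> (conflations_of (opc A) S \<Gamma>)\<inverse>)"
  proof (rule subrelI)
    fix k p assume kp: "(k, p) \<in> exact_pairs"
    have simps [simp]: "b \<in> Arr A" "a \<in> Arr A" "Cod A a = Dom A b" if "(a, b) \<in> exact_pairs" for a b
      using that by (auto simp: exact_pairs_def kernel_cokernel_pair_def is_kernel_def is_sequence_def)
    obtain V U i j q r where U: "U \<in> S" and b: "is_biproduct A (Dom A k) V U i j q r"
      using S_complement[of "Dom A k"] simps[OF kp] by auto
    obtain T i' j' q' r' where "is_biproduct A (Dom A p) V T i' j' q' r'"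
      using ex_biproduct[of "Dom A p" V] simps[OF kp] biproduct_simps(2)[OF b] by auto
    then obtain k1 p1 where 1: "(k1, p1) \<in> exact_pairs" "is_retract A k p k1 p1" "Dom A k1 \<in> S"
      using exact_pairs_left[OF kp b] U by metis
    obtain V2 U2 i2 j2 q2 r2 where U2: "U2 \<in> S" "V2 \<in> S" and b2: "is_biproduct A (Dom A p1) V2 U2 i2 j2 q2 r2"
      using S_complement[of "Dom A p1"] simps[OF 1(1)] by auto
    obtain T2 i2' j2' q2' r2' where "T2 \<in> S" "is_biproduct A (Dom A k1) V2 T2 i2' j2' q2' r2'"
      using S_biproduct[OF 1(3) U2(2)] by blast
    then obtain k2 p2 where 2: "(k2, p2) \<in> exact_pairs" "is_retract A k1 p1 k2 p2" "Dom A k2 \<in> S" "Dom A p2 \<in> S"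
      using exact_pairs_left[OF 1(1) _ b2] U2 by metis
    obtain V3 U3 i3 j3 q3 r3 where U3: "U3 \<in> S" "V3 \<in> S" and b3: "is_biproduct A (Cod A p2) V3 U3 i3 j3 q3 r3"
      using S_complement[of "Cod A p2"] simps[OF 2(1)] by auto
    obtain T3 i3' j3' q3' r3' where "T3 \<in> S" "is_biproduct A (Dom A p2) V3 T3 i3' j3' q3' r3'"
      using S_biproduct[OF 2(4) U3(2)] by blast
    then obtain k3 p3 where 3: "(k3, p3) \<in> exact_pairs" "is_retract A k2 p2 k3 p3" "Dom A k3 \<in> S" "Dom A p3 \<in> S" "Cod A p3 \<in> S"
      using exact_pairs_right[OF 2(1) b3] U3 2(3) by metis
    have kc3: "kernel_cokernel_pair A k3 p3" and p3: "refined A \<Delta> p3" and k3: "refined (opc A) \<Gamma> k3"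
      using 3(1) by (auto simp: exact_pairs_def)
    obtain k4 p4 f f' where p4: "p4 \<in> \<Delta>" "kernel_cokernel_pair A k4 p4" "Dom A k4 \<in> S" "is_retract A k3 p3 k4 p4"
      "is_pushout A f k3 f' k4" "Cod A p4 = Cod A p3"
      by (rule refined_add_left[OF kc3 p3 3(3-5)])
    \<comment> \<open>Enlarging the deflation changed the inflation only by a pushout, so the dual
      construction is still available.\<close>
    have k4: "refined (opc A) \<Gamma> k4"
      by (rule op.refined_pullback[of f k3 f' k4]) (use p4 k3 in \<open>simp_all add: opc_iff\<close>)
    have seq4: "Cod A k4 = Dom A p4" using p4(2) by (auto simp: kernel_cokernel_pair_def is_kernel_def is_sequence_def)
    obtain p5 k5 g g' where 5: "k5 \<in> \<Gamma>" "kernel_cokernel_pair A k5 p5" "Cod A p5 \<in> S" "is_retract A k4 p4 k5 p5"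
      "is_pullback A g p4 g' p5" "Dom A k5 = Dom A k4"
      by (rule op.refined_add_left[of p4 k4, unfolded opc_iff is_retract_op opc_simps])
        (use p4 k4 seq4 3(5) \<Delta>_Arr[OF p4(1)] in simp_all)
    have seq5: "Cod A k5 = Dom A p5" using 5(2) by (auto simp: kernel_cokernel_pair_def is_kernel_def is_sequence_def)
    have "p5 \<in> \<Delta>"
      \<comment> \<open>Making the inflation honest changed \<open>p4\<close> only by a pullback
        along an arrow with domain in \<open>S\<close>, so the deflation remains in
        \<open>\<Delta>\<close>.\<close>
      by (rule \<Delta>_stable[OF p4(1) 5(5)]) (use 5(3) pullbackD(8)[OF 5(5)] op.\<Delta>_Arr[OF 5(1)] seq5 in simp_all)
    then have "(k5, p5) \<in> conflations_of A S \<Delta> \<inter> (conflations_of (opc A) S \<Gamma>)\<inverse>"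
      using 5 p4 by (simp add: conflations_of_def opc_iff)
    moreover have "is_retract A k p k5 p5"
      using 1(2) 2(2) 3(2) p4(4) 5(4) retract_trans by metis
    ultimately show "(k, p) \<in> summands A (conflations_of A S \<Delta> \<inter> (conflations_of (opc A) S \<Gamma>)\<inverse>)"
      unfolding summands_iff by blast
  qed
qed

lemma refined_op_right_factor:
  assumes "refined (opc A) \<Gamma> (v \<cdot> a)" "v \<in> Arr A" "a \<in> Arr A" "Cod A a = Dom A v"
  shows "refined (opc A) \<Gamma> a"
  using op.refined_right_factor[of a v] assms by simp

lemma exact_pairs_Comp:
  assumes "(k, p) \<in> exact_pairs" "(j, q) \<in> exact_pairs" "Cod A p = Dom A q"
  shows "\<exists>i. (i, q \<cdot> p) \<in> exact_pairs"
proof -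
  have kp: "is_kernel A k p" "refined A \<Delta> p" "refined (opc A) \<Gamma> k"
    and jq: "is_kernel A j q" "refined A \<Delta> q" "refined (opc A) \<Gamma> j"
    using assms by (auto simp: exact_pairs_def kernel_cokernel_pair_def)
  have jp: "Cod A j = Cod A p" using assms(3) kernelD(3)[OF jq(1)] by simp
  obtain a b where pb: "is_pullback A j p a b"
    using refined_pullback_ex[OF kp(1,2) kernelD(1)[OF jq(1)] jp] by blast
  have b: "refined A \<Delta> b" by (rule refined_pullback[OF pb kp(2)])
  obtain k' where k': "k' \<in> Hom A (Dom A k) (Dom A b)" "a \<cdot> k' = k" "is_kernel A k' b"
    by (rule pullback_kernel[OF pb kp(1)])
  \<comment> \<open>\<open>b\<close> is refined and has kernel \<open>k'\<close>, hence it is the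
    cokernel of \<open>k'\<close>. This contribution of the deflation side makes the square below a
    pushout.\<close>
  have cok: "is_cokernel A b k'"
    using refined_kernel_cokernel_pair[OF k'(3) b] by (simp add: kernel_cokernel_pair_def)
  note [simp] = pullbackD(1-5)[OF pb] pullbackD(6-9)[OF pb] assms(3)
  have [simp]: "k \<in> Arr A" "Cod A k = Dom A p" "k' \<in> Arr A" "Dom A k' = Dom A k" "Cod A k' = Dom A b" "q \<in> Arr A"
    using k'(1) kernelD[OF kp(1)] kernelD[OF jq(1)] by simp_all
  have bk' [simp]: "b \<cdot> k' = Null A (Dom A k) (Dom A j)" using kernelD(4)[OF k'(3)] by simp

  obtain V i1 j1 p1 q1 where bV: "is_biproduct A (Dom A p) (Dom A j) V i1 j1 p1 q1"
    using ex_biproduct[of "Dom A p" "Dom A j"] by auto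
  obtain W i2 j2 p2 q2 where bW: "is_biproduct A (Dom A p) (Dom A q) W i2 j2 p2 q2"
    using ex_biproduct[of "Dom A p" "Dom A q"] by auto
  note [simp] = biproduct_simps[OF bV] biproduct_simps[OF bW] biproduct_Comp[OF bV] biproduct_Comp[OF bW]
  obtain m where m [simp]: "m \<in> Arr A" "Dom A m = Dom A b" "Cod A m = V" "p1 \<cdot> m = a" "q1 \<cdot> m = b"
    by (rule biproduct_ex[OF bV, of a "Dom A b" b]) auto
  have m' [simp]: "p1 \<cdot> (m \<cdot> y) = a \<cdot> y" "q1 \<cdot> (m \<cdot> y) = b \<cdot> y" if "y \<in> Arr A" "Cod A y = Dom A b" for y
    using that by (simp_all add: Comp_eq[OF m(4)] Comp_eq[OF m(5)])
  have mk': "i1 \<cdot> k = m \<cdot> k'"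
    by (rule biproduct_ext[OF bV, of _ "Dom A k"]) (simp_all add: k'(2))
  \<comment> \<open>Here \<open>m = (a, b)\<close>, and the square is a pushout in \<open>A\<close>.
    If \<open>u k = v k'\<close>, then \<open>v - u a\<close> kills \<open>k'\<close> and so equals
    \<open>z b\<close> for some \<open>z\<close>; the induced arrow is \<open>[u, z]\<close>, as
    \<open>u a + z b = v\<close>.\<close>
  have "is_pullback (opc A) k' k i1 m"
  proof (rule op.pullbackI; simp add: mk')
    fix u v assume [simp]: "u \<in> Arr A" "v \<in> Arr A" "Cod A u = Cod A v" "Dom A u = Dom A p" "Dom A v = Dom A b"
      and uv: "u \<cdot> k = v \<cdot> k'"
    let ?w = "v \<boxplus> neg A (u \<cdot> a)"
    have "?w \<cdot> k' = Null A (Dom A k) (Cod A v)" by (simp add: Comp_Plus neg_Comp k'(2) uv)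
    then obtain z where z: "z \<in> Arr A" "Cod A z = Cod A v" "Dom A z = Dom A j" and zb: "z \<cdot> b = ?w"
      by (rule_tac cokernel_ex[OF cok, of ?w]) auto
    note [simp] = z
    obtain h where h [simp]: "h \<in> Arr A" "Dom A h = V" "Cod A h = Cod A v" "h \<cdot> i1 = u" "h \<cdot> j1 = z"
      by (rule biproduct_coex[OF bV, of u "Cod A v" z]) auto
    have "i1 \<cdot> p1 \<boxplus> j1 \<cdot> q1 = Ident A V" using bV by (simp add: is_biproduct_def)
    then have "h \<cdot> m = h \<cdot> ((i1 \<cdot> p1 \<boxplus> j1 \<cdot> q1) \<cdot> m)" by simp
    also have "\<dots> = (h \<cdot> i1) \<cdot> a \<boxplus> (h \<cdot> j1) \<cdot> b" by (simp add: Comp_Plus del: h(4,5))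
    also have "\<dots> = u \<cdot> a \<boxplus> ?w" by (simp add: zb)
    also have "\<dots> = ?w \<boxplus> u \<cdot> a" by (rule Plus_comm) simp_all
    also have "\<dots> = v" by (subst Plus_assoc) simp_all
    finally have "h \<cdot> m = v" .
    then show "\<exists>h\<in>Arr A. Cod A h = Cod A v \<and> Dom A h = V \<and> h \<cdot> i1 = u \<and> h \<cdot> m = v"
      by (rule_tac bexI[of _ h]) simp_all
  next
    fix x y assume [simp]: "x \<in> Arr A" "y \<in> Arr A" "Cod A x = Cod A y" "Dom A x = V" "Dom A y = V"
      and xy: "x \<cdot> i1 = y \<cdot> i1" "x \<cdot> m = y \<cdot> m"
    have split: "z \<cdot> m = (z \<cdot> i1) \<cdot> a \<boxplus> (z \<cdot> j1) \<cdot> b" if "z \<in> Arr A" "Dom A z = V" for z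
    proof -
      have "i1 \<cdot> p1 \<boxplus> j1 \<cdot> q1 = Ident A V" using bV by (simp add: is_biproduct_def)
      then have "z \<cdot> m = z \<cdot> ((i1 \<cdot> p1 \<boxplus> j1 \<cdot> q1) \<cdot> m)" using that by simp
      also have "\<dots> = (z \<cdot> i1) \<cdot> a \<boxplus> (z \<cdot> j1) \<cdot> b" using that by (simp add: Comp_Plus)
      finally show ?thesis .
    qed
    have "(y \<cdot> i1) \<cdot> a \<boxplus> (x \<cdot> j1) \<cdot> b = (y \<cdot> i1) \<cdot> a \<boxplus> (y \<cdot> j1) \<cdot> b"
      using xy(2) unfolding split[OF \<open>x \<in> Arr A\<close> \<open>Dom A x = V\<close>] split[OF \<open>y \<in> Arr A\<close> \<open>Dom A y = V\<close>] xy(1) .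
    then have "(x \<cdot> j1) \<cdot> b = (y \<cdot> j1) \<cdot> b" by (rule Plus_cancel) simp_all
    from cokernel_ext[OF cok _ _ this, of "Cod A y"] have "x \<cdot> j1 = y \<cdot> j1" by simp
    from biproduct_coext[OF bV _ _ xy(1) this, of "Cod A y"] show "x = y" by simp
  qed
  then have m\<Gamma>: "refined (opc A) \<Gamma> m" by (rule op.refined_pullback) (rule kp(3))

  obtain n where n: "n \<in> Hom A V W" "n \<cdot> j1 = j2 \<cdot> j" "n \<cdot> i1 = i2" "q2 \<cdot> n = j \<cdot> q1" "p2 \<cdot> n = p1"
    "is_pushout A j1 j j2 n"
    \<comment> \<open>\<open>n\<close> is \<open>1 \<oplus> j\<close>, a pushout of the inflation
      \<open>j\<close>.\<close>
    by (rule biproduct_pushout[OF biproduct_swap[OF bV] biproduct_swap[OF bW], of j]) (use kernelD[OF jq(1)] in auto)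
  have n\<Gamma>: "refined (opc A) \<Gamma> n"
    by (rule op.refined_pullback[of j1 j j2 n]) (use n jq in \<open>simp_all add: opc_iff\<close>)
  have [simp]: "n \<in> Arr A" "Dom A n = V" "Cod A n = W" using n(1) by simp_all
  have nm: "refined (opc A) \<Gamma> (n \<cdot> m)" using op.refined_Comp[OF n\<Gamma> m\<Gamma>] by simp
  have pq [simp]: "Cod A p = Dom A q" by (rule assms(3))
  \<comment> \<open>\<open>v = (1, p)\<close> is the graph of \<open>p\<close>. From
    \<open>p a = j b\<close> one gets \<open>v a = n m\<close>, a composite of refined inflations,
    and the dual obscure axiom discards \<open>v\<close>.\<close>
  obtain v where v: "v \<in> Arr A" "Dom A v = Dom A p" "Cod A v = W" "p2 \<cdot> v = Ident A (Dom A p)" "q2 \<cdot> v = p"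
    by (rule biproduct_ex[OF bW, of "Ident A (Dom A p)" "Dom A p" p]) auto
  note [simp] = v(1-3)
  have "v \<cdot> a = n \<cdot> m"
  proof (rule biproduct_ext[OF bW, of _ "Dom A b"])
    show "p2 \<cdot> (v \<cdot> a) = p2 \<cdot> (n \<cdot> m)" by (simp add: Comp_eq[OF v(4)] Comp_eq[OF n(5)])
    have "q2 \<cdot> (n \<cdot> m) = j \<cdot> (q1 \<cdot> m)" by (rule Comp_eq_Comp[OF n(4)]) simp_all
    then show "q2 \<cdot> (v \<cdot> a) = q2 \<cdot> (n \<cdot> m)" by (simp add: Comp_eq[OF v(5)])
  qed simp_all
  then have "refined (opc A) \<Gamma> a" using nm by (intro refined_op_right_factor[of v a]) simp_all
  moreover have "refined A \<Delta> (q \<cdot> p)" using kp(2) jq(2) by (rule refined_Comp) simp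
  moreover have "is_kernel A a (q \<cdot> p)" by (rule pullback_of_kernel[OF pb jq(1)])
  ultimately show ?thesis using exact_pairsI by blast
qed

section \<open>Verification of the axioms of an exact structure\<close>

lemma deflation_exact_structure_exact_pairs: "deflation_exact_structure A exact_pairs"
proof (intro deflation_exact_structure.intro deflation_exact_structure_axioms.intro conflation_structure.intro
    conflation_structure_axioms.intro additive_category_axioms)
  show "kernel_cokernel_pair A i p" if "(i, p) \<in> exact_pairs" for i p using that by (simp add: exact_pairs_def)
next
  fix i p i' p' assume E: "(i, p) \<in> exact_pairs" and iso: "iso_sequences A i p i' p'"
  obtain a b c a' b' c' where
    *: "a \<in> Hom A (Dom A i) (Dom A i')" "b \<in> Hom A (Cod A i) (Cod A i')" "c \<in> Hom A (Cod A p) (Cod A p')"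
    "a' \<in> Hom A (Dom A i') (Dom A i)" "b' \<in> Hom A (Cod A i') (Cod A i)" "c' \<in> Hom A (Cod A p') (Cod A p)"
    "a \<cdot> a' = Ident A (Dom A i')" "b \<cdot> b' = Ident A (Cod A i')" "c \<cdot> c' = Ident A (Cod A p')"
    "a' \<cdot> a = Ident A (Dom A i)" "b' \<cdot> b = Ident A (Cod A i)" "c' \<cdot> c = Ident A (Cod A p)"
    "b \<cdot> i = i' \<cdot> a" "c \<cdot> p = p' \<cdot> b" "i \<cdot> a' = b' \<cdot> i'" "p \<cdot> b' = c' \<cdot> p'"
    by (rule iso_sequences_inverse[OF iso])
  \<comment> \<open>An isomorphism of sequences is in particular a retraction, and all three
    conditions in \<open>exact_pairs\<close> pass to retracts.\<close>
  have "retraction A i' p' i p a' a b' b c' c"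
    using iso * unfolding retraction_def iso_sequences_def by blast
  then have r: "is_retract A i' p' i p" unfolding is_retract_def by blast
  then show "(i', p') \<in> exact_pairs" using E
    unfolding exact_pairs_def using retract_kernel_cokernel_pair refined_retract op.refined_retract[of p' i' p i]
    by (simp add: is_retract_op)
next
  fix Z assume Z: "is_zero_object A Z"
  have [simp]: "Z \<in> Obj A" using Z by (simp add: is_zero_object_def)
  have u: "f = g" if "f \<in> Hom A X Z" "g \<in> Hom A X Z" "X \<in> Obj A" for f g X
    using Z that unfolding is_zero_object_def by blast
  have "is_kernel A (Ident A Z) (Ident A Z)"
  proof (rule kernelI; simp?)
    show "Ident A Z = Null A Z Z" by (rule u[of _ Z]) simp_all
  next
    fix x assume "x \<in> Arr A" "Cod A x = Z"
    then show "\<exists>h\<in>Arr A. Dom A h = Dom A x \<and> Cod A h = Z \<and> Ident A Z \<cdot> h = x"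
      by (auto intro!: bexI[of _ x])
  qed
  then show "deflation exact_pairs (Ident A Z)"
    unfolding deflation_def using exact_pairsI refined_Ident[of Z] op.refined_Ident[of Z] by auto
next
  fix p q assume "deflation exact_pairs p" "deflation exact_pairs q" "Cod A p = Dom A q"
  then show "deflation exact_pairs (q \<cdot> p)" unfolding deflation_def using exact_pairs_Comp by blast
next
  fix p f assume "deflation exact_pairs p" "f \<in> Arr A" "Cod A f = Cod A p"
  then show "\<exists>f' p'. is_pullback A f p f' p'"
    unfolding deflation_def exact_pairs_def kernel_cokernel_pair_def using refined_pullback_ex by blast
next
  fix p f f' p' assume "deflation exact_pairs p" and pb: "is_pullback A f p f' p'"
  then obtain k where k: "is_kernel A k p" "refined A \<Delta> p" "refined (opc A) \<Gamma> k"
    by (auto simp: deflation_def exact_pairs_def kernel_cokernel_pair_def)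
  obtain k' where k': "k' \<in> Hom A (Dom A k) (Dom A p')" "f' \<cdot> k' = k" "is_kernel A k' p'"
    by (rule pullback_kernel[OF pb k(1)])
  \<comment> \<open>Since \<open>f' k' = k\<close> is a refined inflation, the dual obscure axiom
    gives the same for \<open>k'\<close>, whatever \<open>f'\<close> is.\<close>
  have "refined (opc A) \<Gamma> k'"
    by (rule refined_op_right_factor[of f']) (use k k' pullbackD[OF pb] in simp_all)
  then have "(k', p') \<in> exact_pairs" using exact_pairsI k'(3) refined_pullback[OF pb k(2)] by blast
  then show "deflation exact_pairs p'" unfolding deflation_def by blast
qed

lemma exact_structure_exact_pairs: "exact_structure A exact_pairs"
proof -
  interpret dual: two_sided "opc A" S \<Gamma> \<Delta> by (rule op_two_sided)
  have "dual.exact_pairs = exact_pairs\<inverse>" by (auto simp: dual.exact_pairs_def exact_pairs_def opc_iff)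
  then have "inflation_exact_structure A exact_pairs"
    using dual.deflation_exact_structure_exact_pairs inflation_exact_op[OF additive_category_axioms] by simp
  then show ?thesis using deflation_exact_structure_exact_pairs by (simp add: exact_structure_def)
qed

end

section \<open>Transfer from \<open>A\<close> to its completion\<close>

lemma (in additive_category) biproduct_kernel:
  assumes "is_biproduct A X Y B i j p q" shows "is_kernel A i q"
proof -
  note [simp] = biproduct_simps[OF assms] biproduct_Comp[OF assms]
  show ?thesis
  proof (rule kernelI; simp?)
    fix x assume [simp]: "x \<in> Arr A" "Cod A x = B" "q \<cdot> x = Null A (Dom A x) Y"
    have "i \<cdot> (p \<cdot> x) = x" by (rule biproduct_ext[OF assms, of _ "Dom A x"]) simp_all
    then show "\<exists>h\<in>Arr A. Dom A h = Dom A x \<and> Cod A h = X \<and> i \<cdot> h = x"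
      by (auto intro!: bexI[of _ "p \<cdot> x"])
  next
    fix x y assume [simp]: "x \<in> Arr A" "y \<in> Arr A" "Dom A x = Dom A y" "Cod A x = X" "Cod A y = X"
      and e: "i \<cdot> x = i \<cdot> y"
    have "p \<cdot> (i \<cdot> x) = p \<cdot> (i \<cdot> y)" unfolding e ..
    then show "x = y" by simp
  qed
qed

lemma (in additive_category) biproduct_kernel_cokernel_pair:
  assumes "is_biproduct A X Y B i j p q" shows "kernel_cokernel_pair A i q"
  unfolding kernel_cokernel_pair_def
  using biproduct_kernel[OF assms]
    additive_category.biproduct_kernel[OF op_additive, of Y X B q p j i] biproduct_swap[OF assms]
  by (simp add: opc_iff)

text \<open>With closure under isomorphisms this shows that a deflation forms a conflation with any
  of its kernels, so that a conflation structure is determined by its deflations.\<close>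

lemma (in additive_category) kernel_iso_sequences:
  assumes k: "is_kernel A k d" and k': "is_kernel A k' d"
  shows "iso_sequences A k d k' d"
proof -
  note [simp] = kernelD[OF k] kernelD[OF k']
  obtain a where a [simp]: "a \<in> Arr A" "Dom A a = Dom A k" "Cod A a = Dom A k'" "k' \<cdot> a = k"
    by (rule kernel_ex[OF k', of k]) auto
  obtain b where b [simp]: "b \<in> Arr A" "Dom A b = Dom A k'" "Cod A b = Dom A k" "k \<cdot> b = k'"
    by (rule kernel_ex[OF k, of k']) auto
  have "k \<cdot> (b \<cdot> a) = k \<cdot> Ident A (Dom A k)" by (simp add: Comp_eq[OF b(4)])
  from kernel_ext[OF k _ _ this, of "Dom A k"] have "b \<cdot> a = Ident A (Dom A k)" by simp
  moreover have "k' \<cdot> (a \<cdot> b) = k' \<cdot> Ident A (Dom A k')" by (simp add: Comp_eq[OF a(4)])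
  from kernel_ext[OF k' _ _ this, of "Dom A k'"] have "a \<cdot> b = Ident A (Dom A k')" by simp
  ultimately have "is_iso A a" unfolding is_iso_def by (auto intro!: bexI[of _ b])
  moreover have "is_iso A (Ident A X)" if "X \<in> Obj A" for X
    using that unfolding is_iso_def by (auto intro!: bexI[of _ "Ident A X"])
  ultimately show ?thesis unfolding iso_sequences_def is_sequence_def
    by (intro conjI bexI[of _ a] bexI[of _ "Ident A (Dom A d)"] bexI[of _ "Ident A (Cod A d)"]) simp_all
qed

section \<open>Fully faithful embeddings for which every object is a summand of the image\<close>

locale dense_embedding = A: additive_category A + B: ambient_category B "Fo ` Obj A"
  for A :: "('o, 'm) cat" and B :: "('p, 'n) cat" and Fo :: "'o \<Rightarrow> 'p" and F :: "'m \<Rightarrow> 'n" +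
  assumes Fo_inj: "Fo X = Fo Y \<Longrightarrow> X = Y"
    and F_inj: "F f = F g \<Longrightarrow> f = g"
    and F_Arr: "f \<in> Arr A \<Longrightarrow> F f \<in> Hom B (Fo (Dom A f)) (Fo (Cod A f))"
    and F_full: "h \<in> Arr B \<Longrightarrow> Dom B h \<in> Fo ` Obj A \<Longrightarrow> Cod B h \<in> Fo ` Obj A \<Longrightarrow> h \<in> F ` Arr A"
    and F_Comp: "f \<in> Arr A \<Longrightarrow> g \<in> Arr A \<Longrightarrow> Cod A f = Dom A g \<Longrightarrow> F (g \<cdot>\<^bsub>A\<^esub> f) = F g \<cdot>\<^bsub>B\<^esub> F f"
    and F_Ident: "X \<in> Obj A \<Longrightarrow> F (Ident A X) = Ident B (Fo X)"
    and F_Null: "X \<in> Obj A \<Longrightarrow> Y \<in> Obj A \<Longrightarrow> F (Null A X Y) = Null B (Fo X) (Fo Y)"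
    and F_Plus: "f \<in> Arr A \<Longrightarrow> g \<in> Arr A \<Longrightarrow> Dom A f = Dom A g \<Longrightarrow> Cod A f = Cod A g \<Longrightarrow>
      F (f \<boxplus>\<^bsub>A\<^esub> g) = F f \<boxplus>\<^bsub>B\<^esub> F g"

lemma (in ambient_category) op_ambient: "ambient_category (opc A) S"
proof (intro ambient_category.intro ambient_category_axioms.intro op_additive)
  show "\<exists>V\<in>S. \<exists>U\<in>S. \<exists>i j p q. is_biproduct (opc A) W V U i j p q" if "W \<in> Obj (opc A)" for W
    unfolding opc_iff using S_complement[of W] that by simp blast
  show "\<exists>T\<in>S. \<exists>i j p q. is_biproduct (opc A) V U T i j p q" if "V \<in> S" "U \<in> S" for V U
    unfolding opc_iff using S_biproduct[OF that] by blast
  show "\<exists>Z j q. is_biproduct (opc A) X Z Y i j p q"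
    if "i \<in> Hom (opc A) X Y" "p \<in> Hom (opc A) Y X" "p \<cdot>\<^bsub>opc A\<^esub> i = Ident (opc A) X" for i X Y p
    unfolding opc_iff using retract_complement[of p X Y i] that by simp blast
qed (simp add: S_Obj)

context dense_embedding
begin

lemma op_dense_embedding: "dense_embedding (opc A) (opc B) Fo F"
proof (intro dense_embedding.intro dense_embedding_axioms.intro A.op_additive)
  show "ambient_category (opc B) (Fo ` Obj (opc A))" using B.op_ambient by simp
qed (use F_inj Fo_inj F_Arr F_full F_Comp F_Ident F_Null F_Plus in \<open>simp_all\<close>)

lemma F_simps [simp]:
  "f \<in> Arr A \<Longrightarrow> F f \<in> Arr B" "f \<in> Arr A \<Longrightarrow> Dom B (F f) = Fo (Dom A f)" "f \<in> Arr A \<Longrightarrow> Cod B (F f) = Fo (Cod A f)"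
  using F_Arr by simp_all

lemma Fo_eq [simp]: "Fo X = Fo Y \<longleftrightarrow> X = Y" and F_eq [simp]: "F f = F g \<longleftrightarrow> f = g"
  using Fo_inj F_inj by blast+

lemma Fo_Obj [simp]: "X \<in> Obj A \<Longrightarrow> Fo X \<in> Obj B"
  by (simp add: B.S_Obj)

lemma F_fullE:
  assumes "g \<in> Arr B" "Dom B g = Fo X" "Cod B g = Fo Y" "X \<in> Obj A" "Y \<in> Obj A"
  obtains f where "f \<in> Arr A" "Dom A f = X" "Cod A f = Y" "g = F f"
proof -
  have "g \<in> F ` Arr A" using F_full[of g] assms by simp
  then obtain f where f: "f \<in> Arr A" "g = F f" by blast
  with assms show thesis by (intro that[of f]) simp_all
qed

text \<open>This reduces test objects of \<open>B\<close> to objects of \<open>A\<close>: precompose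
  with \<open>q\<close>, solve the problem in \<open>A\<close> by fullness, and restrict the
  solution along \<open>i\<close>.\<close>

lemma ex_retraction:
  assumes "W \<in> Obj B"
  obtains U i q where "U \<in> Obj A" "i \<in> Arr B" "q \<in> Arr B" "Dom B i = W" "Cod B i = Fo U"
    "Dom B q = Fo U" "Cod B q = W" "q \<cdot>\<^bsub>B\<^esub> i = Ident B W"
proof -
  obtain V U i j q r where "is_biproduct B W V (Fo U) i j q r" "U \<in> Obj A"
    using B.S_complement[OF assms] by blast
  then show thesis by (intro that[of U i q]) (simp_all add: B.biproduct_simps)
qed

text \<open>A test arrow \<open>x\<close> becomes \<open>x q = F y\<close>, and a factorisation
  \<open>h\<close> of \<open>y\<close> in \<open>A\<close> yields the factorisation
  \<open>F h\<close> followed after \<open>i\<close>. For uniqueness, \<open>q\<close> is cancelled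
  as a split epimorphism. \<open>F_pullback\<close> uses the same reduction.\<close>

lemma F_kernel:
  assumes "is_kernel A k f"
  shows "is_kernel B (F k) (F f)"
proof -
  note [simp] = A.kernelD(1-3)[OF assms]
  show ?thesis
  proof (rule B.kernelI; simp?)
    show "F f \<cdot>\<^bsub>B\<^esub> F k = Null B (Fo (Dom A k)) (Fo (Cod A f))"
      by (simp add: F_Comp[symmetric] A.kernelD(4)[OF assms] F_Null)
  next
    fix x assume x [simp]: "x \<in> Arr B" "Cod B x = Fo (Dom A f)"
      and fx: "F f \<cdot>\<^bsub>B\<^esub> x = Null B (Dom B x) (Fo (Cod A f))"
    obtain U i q where U [simp]: "U \<in> Obj A" "i \<in> Arr B" "q \<in> Arr B" "Dom B i = Dom B x" "Cod B i = Fo U"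
      "Dom B q = Fo U" "Cod B q = Dom B x" and qi: "q \<cdot>\<^bsub>B\<^esub> i = Ident B (Dom B x)"
      by (rule ex_retraction[of "Dom B x"]) simp
    obtain y where y [simp]: "y \<in> Arr A" "Dom A y = U" "Cod A y = Dom A f" and xq: "x \<cdot>\<^bsub>B\<^esub> q = F y"
      by (rule F_fullE[of "x \<cdot>\<^bsub>B\<^esub> q" U "Dom A f"]) auto
    have "F (f \<cdot>\<^bsub>A\<^esub> y) = (F f \<cdot>\<^bsub>B\<^esub> x) \<cdot>\<^bsub>B\<^esub> q" by (simp add: F_Comp xq)
    also have "\<dots> = F (Null A U (Cod A f))" unfolding fx by (simp add: F_Null del: F_eq)
    finally have fy: "f \<cdot>\<^bsub>A\<^esub> y = Null A U (Cod A f)" by simp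
    obtain h where h [simp]: "h \<in> Arr A" "Dom A h = U" "Cod A h = Dom A k" "k \<cdot>\<^bsub>A\<^esub> h = y"
      by (rule A.kernel_ex[OF assms, of y]) (use fy in auto)
    have "F k \<cdot>\<^bsub>B\<^esub> (F h \<cdot>\<^bsub>B\<^esub> i) = F (k \<cdot>\<^bsub>A\<^esub> h) \<cdot>\<^bsub>B\<^esub> i" by (simp add: F_Comp del: h(4))
    also have "\<dots> = x" using qi by (simp add: xq[symmetric])
    finally show "\<exists>h\<in>Arr B. Dom B h = Dom B x \<and> Cod B h = Fo (Dom A k) \<and> F k \<cdot>\<^bsub>B\<^esub> h = x"
      by (rule_tac bexI[of _ "F h \<cdot>\<^bsub>B\<^esub> i"]) simp_all
  next
    fix x y assume [simp]: "x \<in> Arr B" "y \<in> Arr B" "Dom B x = Dom B y" "Cod B x = Fo (Dom A k)" "Cod B y = Fo (Dom A k)"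
      and e: "F k \<cdot>\<^bsub>B\<^esub> x = F k \<cdot>\<^bsub>B\<^esub> y"
    obtain U i q where U [simp]: "U \<in> Obj A" "i \<in> Arr B" "q \<in> Arr B" "Dom B i = Dom B y" "Cod B i = Fo U"
      "Dom B q = Fo U" "Cod B q = Dom B y" and qi: "q \<cdot>\<^bsub>B\<^esub> i = Ident B (Dom B y)"
      by (rule ex_retraction[of "Dom B y"]) simp
    obtain x' where x' [simp]: "x' \<in> Arr A" "Dom A x' = U" "Cod A x' = Dom A k" and xq: "x \<cdot>\<^bsub>B\<^esub> q = F x'"
      by (rule F_fullE[of "x \<cdot>\<^bsub>B\<^esub> q" U "Dom A k"]) auto
    obtain y' where y' [simp]: "y' \<in> Arr A" "Dom A y' = U" "Cod A y' = Dom A k" and yq: "y \<cdot>\<^bsub>B\<^esub> q = F y'"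
      by (rule F_fullE[of "y \<cdot>\<^bsub>B\<^esub> q" U "Dom A k"]) auto
    have "F k \<cdot>\<^bsub>B\<^esub> (x \<cdot>\<^bsub>B\<^esub> q) = F k \<cdot>\<^bsub>B\<^esub> (y \<cdot>\<^bsub>B\<^esub> q)" by (rule B.Comp_eq_Comp[OF e]) simp_all
    then have "F (k \<cdot>\<^bsub>A\<^esub> x') = F (k \<cdot>\<^bsub>A\<^esub> y')" unfolding xq yq by (simp add: F_Comp del: F_eq)
    then have kxy: "k \<cdot>\<^bsub>A\<^esub> x' = k \<cdot>\<^bsub>A\<^esub> y'" by simp
    from A.kernel_ext[OF assms _ _ kxy, of U] have "x \<cdot>\<^bsub>B\<^esub> q = y \<cdot>\<^bsub>B\<^esub> q" unfolding xq yq by simp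
    from B.Comp_eq_Comp[OF this, of i] show "x = y" using qi by simp
  qed
qed

lemma F_cokernel: "is_cokernel A c f \<Longrightarrow> is_cokernel B (F c) (F f)"
  using dense_embedding.F_kernel[OF op_dense_embedding] by (simp add: opc_iff)

lemma F_kernel_cokernel_pair: "kernel_cokernel_pair A k p \<Longrightarrow> kernel_cokernel_pair B (F k) (F p)"
  unfolding kernel_cokernel_pair_def using F_kernel F_cokernel by blast

lemma F_kernelD:
  assumes F: "is_kernel B (F k) (F f)" and [simp]: "k \<in> Arr A" "f \<in> Arr A"
  shows "is_kernel A k f"
proof (rule A.kernelI; simp?)
  show [simp]: "Cod A k = Dom A f" using B.kernelD(3)[OF F] by simp
  have "F (f \<cdot>\<^bsub>A\<^esub> k) = F (Null A (Dom A k) (Cod A f))"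
    using B.kernelD(4)[OF F] by (simp add: F_Comp F_Null del: F_eq)
  then show "f \<cdot>\<^bsub>A\<^esub> k = Null A (Dom A k) (Cod A f)" by simp
next
  fix x assume [simp]: "x \<in> Arr A" "Cod A x = Dom A f" and fx: "f \<cdot>\<^bsub>A\<^esub> x = Null A (Dom A x) (Cod A f)"
  have "F f \<cdot>\<^bsub>B\<^esub> F x = Null B (Fo (Dom A x)) (Fo (Cod A f))"
    using fx by (simp add: F_Comp[symmetric] F_Null)
  then obtain h where h: "h \<in> Arr B" "Dom B h = Fo (Dom A x)" "Cod B h = Fo (Dom A k)" "F k \<cdot>\<^bsub>B\<^esub> h = F x"
    by (rule_tac B.kernel_ex[OF F, of "F x"]) auto
  obtain h' where h' [simp]: "h' \<in> Arr A" "Dom A h' = Dom A x" "Cod A h' = Dom A k" "h = F h'"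
    by (rule F_fullE[OF h(1-3)]) auto
  have "F (k \<cdot>\<^bsub>A\<^esub> h') = F x" using h(4) by (simp add: F_Comp del: F_eq)
  then show "\<exists>h\<in>Arr A. Dom A h = Dom A x \<and> Cod A h = Dom A k \<and> k \<cdot>\<^bsub>A\<^esub> h = x"
    by (rule_tac bexI[of _ h']) simp_all
next
  fix x y assume [simp]: "x \<in> Arr A" "y \<in> Arr A" "Dom A x = Dom A y" "Cod A x = Dom A k" "Cod A y = Dom A k"
    and e: "k \<cdot>\<^bsub>A\<^esub> x = k \<cdot>\<^bsub>A\<^esub> y"
  have "F k \<cdot>\<^bsub>B\<^esub> F x = F k \<cdot>\<^bsub>B\<^esub> F y" by (simp add: F_Comp[symmetric] e)
  from B.kernel_ext[OF F _ _ this, of "Fo (Dom A y)"] show "x = y" by simp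
qed

lemma F_pullback:
  assumes "is_pullback A f p f' p'"
  shows "is_pullback B (F f) (F p) (F f') (F p')"
proof -
  note [simp] = A.pullbackD(1-8)[OF assms]
  show ?thesis
  proof (rule B.pullbackI; simp?)
    show "F p \<cdot>\<^bsub>B\<^esub> F f' = F f \<cdot>\<^bsub>B\<^esub> F p'" by (simp add: F_Comp[symmetric] A.pullbackD(9)[OF assms])
  next
    fix u v assume [simp]: "u \<in> Arr B" "v \<in> Arr B" "Dom B u = Dom B v" "Cod B u = Fo (Dom A p)" "Cod B v = Fo (Dom A f)"
      and uv: "F p \<cdot>\<^bsub>B\<^esub> u = F f \<cdot>\<^bsub>B\<^esub> v"
    obtain U i q where U [simp]: "U \<in> Obj A" "i \<in> Arr B" "q \<in> Arr B" "Dom B i = Dom B v" "Cod B i = Fo U"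
      "Dom B q = Fo U" "Cod B q = Dom B v" and qi: "q \<cdot>\<^bsub>B\<^esub> i = Ident B (Dom B v)"
      by (rule ex_retraction[of "Dom B v"]) simp
    obtain u' where u' [simp]: "u' \<in> Arr A" "Dom A u' = U" "Cod A u' = Dom A p" and uq: "u \<cdot>\<^bsub>B\<^esub> q = F u'"
      by (rule F_fullE[of "u \<cdot>\<^bsub>B\<^esub> q" U "Dom A p"]) auto
    obtain v' where v' [simp]: "v' \<in> Arr A" "Dom A v' = U" "Cod A v' = Dom A f" and vq: "v \<cdot>\<^bsub>B\<^esub> q = F v'"
      by (rule F_fullE[of "v \<cdot>\<^bsub>B\<^esub> q" U "Dom A f"]) auto
    have "F p \<cdot>\<^bsub>B\<^esub> (u \<cdot>\<^bsub>B\<^esub> q) = F f \<cdot>\<^bsub>B\<^esub> (v \<cdot>\<^bsub>B\<^esub> q)" by (rule B.Comp_eq_Comp[OF uv]) simp_all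
    then have "F (p \<cdot>\<^bsub>A\<^esub> u') = F (f \<cdot>\<^bsub>A\<^esub> v')" unfolding uq vq by (simp add: F_Comp del: F_eq)
    then have uv': "p \<cdot>\<^bsub>A\<^esub> u' = f \<cdot>\<^bsub>A\<^esub> v'" by simp
    obtain h where h [simp]: "h \<in> Arr A" "Dom A h = U" "Cod A h = Dom A p'" and h': "f' \<cdot>\<^bsub>A\<^esub> h = u'" "p' \<cdot>\<^bsub>A\<^esub> h = v'"
      by (rule A.pullback_ex[OF assms _ _ uv', of U]) auto
    have "F f' \<cdot>\<^bsub>B\<^esub> (F h \<cdot>\<^bsub>B\<^esub> i) = F (f' \<cdot>\<^bsub>A\<^esub> h) \<cdot>\<^bsub>B\<^esub> i" by (simp add: F_Comp)
    also have "\<dots> = u" using qi unfolding h' by (simp add: uq[symmetric])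
    finally have 1: "F f' \<cdot>\<^bsub>B\<^esub> (F h \<cdot>\<^bsub>B\<^esub> i) = u" .
    have "F p' \<cdot>\<^bsub>B\<^esub> (F h \<cdot>\<^bsub>B\<^esub> i) = F (p' \<cdot>\<^bsub>A\<^esub> h) \<cdot>\<^bsub>B\<^esub> i" by (simp add: F_Comp)
    also have "\<dots> = v" using qi unfolding h' by (simp add: vq[symmetric])
    finally have 2: "F p' \<cdot>\<^bsub>B\<^esub> (F h \<cdot>\<^bsub>B\<^esub> i) = v" .
    show "\<exists>h\<in>Arr B. Dom B h = Dom B v \<and> Cod B h = Fo (Dom A p') \<and> F f' \<cdot>\<^bsub>B\<^esub> h = u \<and> F p' \<cdot>\<^bsub>B\<^esub> h = v"
      by (rule bexI[of _ "F h \<cdot>\<^bsub>B\<^esub> i"]) (simp_all add: 1 2)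
  next
    fix x y assume [simp]: "x \<in> Arr B" "y \<in> Arr B" "Dom B x = Dom B y" "Cod B x = Fo (Dom A p')" "Cod B y = Fo (Dom A p')"
      and e: "F f' \<cdot>\<^bsub>B\<^esub> x = F f' \<cdot>\<^bsub>B\<^esub> y" "F p' \<cdot>\<^bsub>B\<^esub> x = F p' \<cdot>\<^bsub>B\<^esub> y"
    obtain U i q where U [simp]: "U \<in> Obj A" "i \<in> Arr B" "q \<in> Arr B" "Dom B i = Dom B y" "Cod B i = Fo U"
      "Dom B q = Fo U" "Cod B q = Dom B y" and qi: "q \<cdot>\<^bsub>B\<^esub> i = Ident B (Dom B y)"
      by (rule ex_retraction[of "Dom B y"]) simp
    obtain x' where x' [simp]: "x' \<in> Arr A" "Dom A x' = U" "Cod A x' = Dom A p'" and xq: "x \<cdot>\<^bsub>B\<^esub> q = F x'"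
      by (rule F_fullE[of "x \<cdot>\<^bsub>B\<^esub> q" U "Dom A p'"]) auto
    obtain y' where y' [simp]: "y' \<in> Arr A" "Dom A y' = U" "Cod A y' = Dom A p'" and yq: "y \<cdot>\<^bsub>B\<^esub> q = F y'"
      by (rule F_fullE[of "y \<cdot>\<^bsub>B\<^esub> q" U "Dom A p'"]) auto
    have "F f' \<cdot>\<^bsub>B\<^esub> (x \<cdot>\<^bsub>B\<^esub> q) = F f' \<cdot>\<^bsub>B\<^esub> (y \<cdot>\<^bsub>B\<^esub> q)" by (rule B.Comp_eq_Comp[OF e(1)]) simp_all
    then have "F (f' \<cdot>\<^bsub>A\<^esub> x') = F (f' \<cdot>\<^bsub>A\<^esub> y')" unfolding xq yq by (simp add: F_Comp del: F_eq)
    then have 1: "f' \<cdot>\<^bsub>A\<^esub> x' = f' \<cdot>\<^bsub>A\<^esub> y'" by simp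
    have "F p' \<cdot>\<^bsub>B\<^esub> (x \<cdot>\<^bsub>B\<^esub> q) = F p' \<cdot>\<^bsub>B\<^esub> (y \<cdot>\<^bsub>B\<^esub> q)" by (rule B.Comp_eq_Comp[OF e(2)]) simp_all
    then have "F (p' \<cdot>\<^bsub>A\<^esub> x') = F (p' \<cdot>\<^bsub>A\<^esub> y')" unfolding xq yq by (simp add: F_Comp del: F_eq)
    then have 2: "p' \<cdot>\<^bsub>A\<^esub> x' = p' \<cdot>\<^bsub>A\<^esub> y'" by simp
    from A.pullback_ext[OF assms _ _ 1 2, of U] have "x \<cdot>\<^bsub>B\<^esub> q = y \<cdot>\<^bsub>B\<^esub> q" unfolding xq yq by simp
    from B.Comp_eq_Comp[OF this, of i] show "x = y" using qi by simp
  qed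
qed

lemma F_pullbackD:
  assumes F: "is_pullback B (F f) (F p) (F f') (F p')" and [simp]: "f \<in> Arr A" "p \<in> Arr A" "f' \<in> Arr A" "p' \<in> Arr A"
  shows "is_pullback A f p f' p'"
proof -
  have [simp]: "Cod A f = Cod A p" "Dom A f' = Dom A p'" "Cod A f' = Dom A p" "Cod A p' = Dom A f"
    using B.pullbackD(5-8)[OF F] by simp_all
  show ?thesis
  proof (rule A.pullbackI; simp?)
    have "F (p \<cdot>\<^bsub>A\<^esub> f') = F (f \<cdot>\<^bsub>A\<^esub> p')" using B.pullbackD(9)[OF F] by (simp add: F_Comp del: F_eq)
    then show "p \<cdot>\<^bsub>A\<^esub> f' = f \<cdot>\<^bsub>A\<^esub> p'" by simp
  next
    fix u v assume [simp]: "u \<in> Arr A" "v \<in> Arr A" "Dom A u = Dom A v" "Cod A u = Dom A p" "Cod A v = Dom A f"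
      and uv: "p \<cdot>\<^bsub>A\<^esub> u = f \<cdot>\<^bsub>A\<^esub> v"
    have "F p \<cdot>\<^bsub>B\<^esub> F u = F f \<cdot>\<^bsub>B\<^esub> F v" by (simp add: F_Comp[symmetric] uv)
    then obtain h where h: "h \<in> Arr B" "Dom B h = Fo (Dom A v)" "Cod B h = Fo (Dom A p')"
      "F f' \<cdot>\<^bsub>B\<^esub> h = F u" "F p' \<cdot>\<^bsub>B\<^esub> h = F v"
      by (rule_tac B.pullback_ex[OF F, of "F u" "Fo (Dom A v)" "F v"]) auto
    obtain h' where h' [simp]: "h' \<in> Arr A" "Dom A h' = Dom A v" "Cod A h' = Dom A p'" "h = F h'"
      by (rule F_fullE[OF h(1-3)]) auto
    have "F (f' \<cdot>\<^bsub>A\<^esub> h') = F u" "F (p' \<cdot>\<^bsub>A\<^esub> h') = F v" using h(4,5) by (simp_all add: F_Comp del: F_eq)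
    then show "\<exists>h\<in>Arr A. Dom A h = Dom A v \<and> Cod A h = Dom A p' \<and> f' \<cdot>\<^bsub>A\<^esub> h = u \<and> p' \<cdot>\<^bsub>A\<^esub> h = v"
      by (rule_tac bexI[of _ h']) simp_all
  next
    fix x y assume [simp]: "x \<in> Arr A" "y \<in> Arr A" "Dom A x = Dom A y" "Cod A x = Dom A p'" "Cod A y = Dom A p'"
      and e: "f' \<cdot>\<^bsub>A\<^esub> x = f' \<cdot>\<^bsub>A\<^esub> y" "p' \<cdot>\<^bsub>A\<^esub> x = p' \<cdot>\<^bsub>A\<^esub> y"
    have 1: "F f' \<cdot>\<^bsub>B\<^esub> F x = F f' \<cdot>\<^bsub>B\<^esub> F y" by (simp add: F_Comp[symmetric] e)
    have 2: "F p' \<cdot>\<^bsub>B\<^esub> F x = F p' \<cdot>\<^bsub>B\<^esub> F y" by (simp add: F_Comp[symmetric] e)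
    from B.pullback_ext[OF F _ _ 1 2, of "Fo (Dom A y)"] show "x = y" by simp
  qed
qed

lemma F_biproductD:
  assumes F: "is_biproduct B (Fo X) (Fo Y) (Fo Z) i' j' p' q'" and [simp]: "X \<in> Obj A" "Y \<in> Obj A" "Z \<in> Obj A"
  obtains i j p q where "is_biproduct A X Y Z i j p q" "i' = F i" "j' = F j" "p' = F p" "q' = F q"
proof -
  note F' = B.biproduct_simps[OF F]
  obtain i where i [simp]: "i \<in> Arr A" "Dom A i = X" "Cod A i = Z" and Fi: "i' = F i"
    by (rule F_fullE[of i' X Z]) (use F' in auto)
  obtain j where j [simp]: "j \<in> Arr A" "Dom A j = Y" "Cod A j = Z" and Fj: "j' = F j"
    by (rule F_fullE[of j' Y Z]) (use F' in auto)
  obtain p where p [simp]: "p \<in> Arr A" "Dom A p = Z" "Cod A p = X" and Fp: "p' = F p"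
    by (rule F_fullE[of p' Z X]) (use F' in auto)
  obtain q where q [simp]: "q \<in> Arr A" "Dom A q = Z" "Cod A q = Y" and Fq: "q' = F q"
    by (rule F_fullE[of q' Z Y]) (use F' in auto)
  have "F (i \<cdot>\<^bsub>A\<^esub> p \<boxplus>\<^bsub>A\<^esub> j \<cdot>\<^bsub>A\<^esub> q) = F (Ident A Z)"
    using F by (simp add: F_Plus F_Comp F_Ident is_biproduct_def Fi Fj Fp Fq del: F_eq)
  moreover have "F (p \<cdot>\<^bsub>A\<^esub> i) = F (Ident A X)" "F (q \<cdot>\<^bsub>A\<^esub> j) = F (Ident A Y)"
    "F (q \<cdot>\<^bsub>A\<^esub> i) = F (Null A X Y)" "F (p \<cdot>\<^bsub>A\<^esub> j) = F (Null A Y X)"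
    using F' by (simp_all add: F_Comp F_Ident F_Null Fi Fj Fp Fq del: F_eq)
  ultimately have "is_biproduct A X Y Z i j p q" by (simp add: is_biproduct_def)
  then show thesis using Fi Fj Fp Fq by (rule that)
qed

definition F_pairs :: "('m \<times> 'm) set \<Rightarrow> ('n \<times> 'n) set" where
  "F_pairs C = {(F i, F p) | i p. (i, p) \<in> C}"

text \<open>Since \<open>F\<close> preserves and reflects kernels and pullbacks between objects of
  \<open>A\<close>, the axioms can be checked in \<open>A\<close> after replacing the given arrows
  by preimages, which fullness provides.\<close>

lemma deflation_class_image:
  assumes "deflation_exact_structure A D"
    and split: "\<And>X Y B i j p q. is_biproduct A X Y B i j p q \<Longrightarrow> (i, q) \<in> D"
  shows "deflation_class B (Fo ` Obj A) (F ` {d. deflation D d})"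
    and "conflations_of B (Fo ` Obj A) (F ` {d. deflation D d}) = F_pairs D"
proof -
  interpret D: deflation_exact_structure A D by fact
  have kc: "is_kernel A k d" if "(k, d) \<in> D" for k d
    using D.conflation[OF that] by (simp add: kernel_cokernel_pair_def)
  have arr: "d \<in> Arr A" if "deflation D d" for d
    using that A.kernelD(2)[OF kc] unfolding deflation_def by blast
  show "deflation_class B (Fo ` Obj A) (F ` {d. deflation D d})"
  proof (intro deflation_class.intro deflation_class_axioms.intro B.ambient_category_axioms)
    fix d assume "d \<in> F ` {d. deflation D d}"
    then show "d \<in> Arr B \<and> Dom B d \<in> Fo ` Obj A \<and> Cod B d \<in> Fo ` Obj A" using arr by auto
  next
    fix d' assume "d' \<in> F ` {d. deflation D d}"
    then obtain d k where d: "d' = F d" "(k, d) \<in> D" unfolding deflation_def by blast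
    have "kernel_cokernel_pair B (F k) (F d)" by (intro F_kernel_cokernel_pair D.conflation d)
    moreover have "Dom B (F k) \<in> Fo ` Obj A" using A.kernelD(1)[OF kc[OF d(2)]] by simp
    ultimately show "\<exists>k. kernel_cokernel_pair B k d' \<and> Dom B k \<in> Fo ` Obj A" using d by blast
  next
    fix d e assume "d \<in> F ` {d. deflation D d}" "e \<in> F ` {d. deflation D d}" and de: "Cod B d = Dom B e"
    then obtain d' e' where [simp]: "d = F d'" "e = F e'" and *: "deflation D d'" "deflation D e'" by blast
    note [simp] = arr[OF *(1)] arr[OF *(2)]
    have [simp]: "Cod A d' = Dom A e'" using de by simp
    have "deflation D (e' \<cdot>\<^bsub>A\<^esub> d')" by (rule D.R1[OF *]) simp
    moreover have "e \<cdot>\<^bsub>B\<^esub> d = F (e' \<cdot>\<^bsub>A\<^esub> d')" by (simp add: F_Comp)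
    ultimately show "e \<cdot>\<^bsub>B\<^esub> d \<in> F ` {d. deflation D d}" by blast
  next
    fix d f assume "d \<in> F ` {d. deflation D d}" and f: "f \<in> Arr B" "Dom B f \<in> Fo ` Obj A" and df: "Cod B f = Cod B d"
    then obtain d' where d' [simp]: "d = F d'" and *: "deflation D d'" by blast
    note [simp] = arr[OF *(1)]
    have "f \<in> F ` Arr A" using f df by (intro F_full) simp_all
    then obtain f' where f': "f' \<in> Arr A" "f = F f'" by blast
    then obtain a d1 where pb: "is_pullback A f' d' a d1" using D.R2_ex[OF * f'(1)] df by auto
    from F_pullback[OF this] have "is_pullback B f d (F a) (F d1)" using f' by simp
    moreover have "Dom B (F d1) \<in> Fo ` Obj A" using A.pullbackD(4)[OF pb] by simp
    ultimately show "\<exists>a d'. is_pullback B f d a d' \<and> Dom B d' \<in> Fo ` Obj A" by blast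
  next
    fix d f a d1 assume "d \<in> F ` {d. deflation D d}" and pb: "is_pullback B f d a d1"
      and S: "Dom B f \<in> Fo ` Obj A" "Dom B d1 \<in> Fo ` Obj A"
    then obtain d' where d' [simp]: "d = F d'" and *: "deflation D d'" by blast
    note [simp] = arr[OF *(1)]
    have "f \<in> F ` Arr A" "a \<in> F ` Arr A" "d1 \<in> F ` Arr A"
      using B.pullbackD[OF pb] S by (auto intro!: F_full)
    then obtain f' a' d1' where *: "f' \<in> Arr A" "f = F f'" "a' \<in> Arr A" "a = F a'" "d1' \<in> Arr A" "d1 = F d1'" "deflation D d'"
      using * by blast
    have "is_pullback A f' d' a' d1'" using pb * by (intro F_pullbackD) simp_all
    then have "deflation D d1'" by (rule D.R2_stable[OF *(7)])
    then show "d1 \<in> F ` {d. deflation D d}" using * by blast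
  next
    fix X Y Z i j p q assume b: "is_biproduct B X Y Z i j p q"
      and "X \<in> Fo ` Obj A" "Y \<in> Fo ` Obj A" "Z \<in> Fo ` Obj A"
    then obtain X' Y' Z' where *: "X = Fo X'" "Y = Fo Y'" "Z = Fo Z'" "X' \<in> Obj A" "Y' \<in> Obj A" "Z' \<in> Obj A" by blast
    obtain i' j' p' q' where "is_biproduct A X' Y' Z' i' j' p' q'" "q = F q'"
      using F_biproductD[OF b[unfolded *(1-3)] *(4-6)] by metis
    then show "q \<in> F ` {d. deflation D d}" using split unfolding deflation_def by blast
  qed
  show "conflations_of B (Fo ` Obj A) (F ` {d. deflation D d}) = F_pairs D"
  proof
    show "F_pairs D \<subseteq> conflations_of B (Fo ` Obj A) (F ` {d. deflation D d})"
    proof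
      fix x assume "x \<in> F_pairs D"
      then obtain k d where x: "x = (F k, F d)" "(k, d) \<in> D" unfolding F_pairs_def by blast
      have "kernel_cokernel_pair B (F k) (F d)" by (intro F_kernel_cokernel_pair D.conflation x)
      moreover have "k \<in> Arr A" by (rule A.kernelD(1)[OF kc[OF x(2)]])
      ultimately show "x \<in> conflations_of B (Fo ` Obj A) (F ` {d. deflation D d})"
        using x unfolding conflations_of_def deflation_def by auto
    qed
    show "conflations_of B (Fo ` Obj A) (F ` {d. deflation D d}) \<subseteq> F_pairs D"
    proof (rule subrelI)
      fix k d' assume "(k, d') \<in> conflations_of B (Fo ` Obj A) (F ` {d. deflation D d})"
      then obtain d k0 where k: "is_kernel B k (F d)" "Dom B k \<in> Fo ` Obj A" and d: "d' = F d" "(k0, d) \<in> D"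
        unfolding conflations_of_def kernel_cokernel_pair_def deflation_def by blast
      have [simp]: "d \<in> Arr A" by (rule A.kernelD(2)[OF kc[OF d(2)]])
      have "k \<in> F ` Arr A" using B.kernelD[OF k(1)] k(2) by (intro F_full) simp_all
      then obtain k1 where k1: "k1 \<in> Arr A" "k = F k1" by blast
      \<comment> \<open>The kernel \<open>k1\<close> may differ from the kernel \<open>k0\<close>
        that makes \<open>d\<close> a deflation; they are isomorphic, and \<open>D\<close> is closed
        under isomorphisms.\<close>
      have "is_kernel A k1 d" using k k1 by (intro F_kernelD) simp_all
      then have "(k1, d) \<in> D" using D.iso_closed[OF d(2)] A.kernel_iso_sequences[OF kc[OF d(2)]] by blast
      then show "(k, d') \<in> F_pairs D" using d k1 unfolding F_pairs_def by blast
    qed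
  qed
qed

theorem exact_summands:
  assumes D: "deflation_exact_structure A D" and I: "inflation_exact_structure A I"
    and splitD: "\<And>i p. split_kernel_cokernel_pair A i p \<Longrightarrow> (i, p) \<in> D"
    and splitI: "\<And>i p. split_kernel_cokernel_pair A i p \<Longrightarrow> (i, p) \<in> I"
  shows "summands B (F_pairs D) \<inter> summands B (F_pairs I) = summands B (F_pairs (D \<inter> I))"
    and "exact_structure B (summands B (F_pairs D) \<inter> summands B (F_pairs I))"
proof -
  interpret op: dense_embedding "opc A" "opc B" Fo F by (rule op_dense_embedding)
  have split: "split_kernel_cokernel_pair A i q" if "is_biproduct A X Y Z i j p q" for X Y Z i j p q
    using that A.biproduct_kernel_cokernel_pair[OF that] A.biproduct_simps[OF that]
    unfolding split_kernel_cokernel_pair_def by auto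
  \<comment> \<open>After this dualisation the same construction, applied to the opposite embedding,
    produces the class for \<open>I\<close>.\<close>
  have I': "deflation_exact_structure (opc A) (I\<inverse>)"
    using I inflation_exact_op[OF A.additive_category_axioms] by simp
  have splitI': "(i, q) \<in> I\<inverse>" if "is_biproduct (opc A) X Y Z i j p q" for X Y Z i j p q
    using A.biproduct_swap that splitI split unfolding opc_iff converse_iff by blast
  let ?\<Delta> = "F ` {d. deflation D d}" and ?\<Gamma> = "F ` {d. deflation (I\<inverse>) d}"
  interpret D: deflation_class B "Fo ` Obj A" ?\<Delta>
    by (rule deflation_class_image(1)[OF D]) (use split splitD in blast)
  interpret I: deflation_class "opc B" "Fo ` Obj A" ?\<Gamma>
    using op.deflation_class_image(1)[OF I' splitI'] by simp
  interpret two_sided B "Fo ` Obj A" ?\<Delta> ?\<Gamma> ..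
  have D_eq: "conflations_of B (Fo ` Obj A) ?\<Delta> = F_pairs D"
    by (rule deflation_class_image(2)[OF D]) (use split splitD in blast)
  have I_eq: "(conflations_of (opc B) (Fo ` Obj A) ?\<Gamma>)\<inverse> = F_pairs I"
    using op.deflation_class_image(2)[OF I' splitI'] by (auto simp: op.F_pairs_def F_pairs_def)
  \<comment> \<open>Injectivity of \<open>F\<close> makes the image commute with
    intersections.\<close>
  have "F_pairs D \<inter> F_pairs I = F_pairs (D \<inter> I)" by (auto simp: F_pairs_def)
  then show "summands B (F_pairs D) \<inter> summands B (F_pairs I) = summands B (F_pairs (D \<inter> I))"
    and "exact_structure B (summands B (F_pairs D) \<inter> summands B (F_pairs I))"
    using exact_pairs_Int exact_pairs_summands exact_structure_exact_pairs unfolding D_eq I_eq by simp_all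
qed

end

section \<open>The weak idempotent completion as an ambient category\<close>

text \<open>Forgetting the structure maps turns the rearrangement of iterated sums into a
  calculation with objects.\<close>

definition biproduct_of :: "('o, 'm) cat \<Rightarrow> 'o \<Rightarrow> 'o \<Rightarrow> 'o \<Rightarrow> bool" where
  "biproduct_of A X Y B \<longleftrightarrow> (\<exists>i j p q. is_biproduct A X Y B i j p q)"

context additive_category
begin

lemma biproduct_of_comm: "biproduct_of A X Y B \<Longrightarrow> biproduct_of A Y X B"
  unfolding biproduct_of_def using biproduct_swap by blast

text \<open>The sums \<open>U\<close>, \<open>V\<close> and \<open>U'\<close> are prescribed
  objects, so later calculations with several summands need no comparison isomorphisms.\<close>

lemma biproduct_of_assoc:
  assumes "biproduct_of A X Y U" "biproduct_of A U W V" "biproduct_of A Y W U'"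
  shows "biproduct_of A X U' V"
proof -
  obtain i j p q where b1: "is_biproduct A X Y U i j p q" using assms unfolding biproduct_of_def by blast
  obtain k l m n where b2: "is_biproduct A U W V k l m n" using assms unfolding biproduct_of_def by blast
  obtain a b c d where b3: "is_biproduct A Y W U' a b c d" using assms unfolding biproduct_of_def by blast
  note [simp] = biproduct_simps[OF b1] biproduct_simps[OF b2] biproduct_simps[OF b3]
    biproduct_Comp[OF b1] biproduct_Comp[OF b2] biproduct_Comp[OF b3]
  \<comment> \<open>\<open>J\<close> is the inclusion of \<open>Y \<oplus> W\<close> into
    \<open>V\<close>, and \<open>Q\<close> below is the projection of \<open>V\<close> onto
    it.\<close>
  obtain J where J [simp]: "J \<in> Arr A" "Dom A J = U'" "Cod A J = V" "J \<cdot> a = k \<cdot> j" "J \<cdot> b = l"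
    by (rule biproduct_coex[OF b3, of "k \<cdot> j" V l]) auto
  obtain Q where Q [simp]: "Q \<in> Arr A" "Dom A Q = V" "Cod A Q = U'" "c \<cdot> Q = q \<cdot> m" "d \<cdot> Q = n"
    by (rule biproduct_ex[OF b3, of "q \<cdot> m" V n]) auto
  have [simp]: "c \<cdot> (Q \<cdot> x) = q \<cdot> (m \<cdot> x)" "d \<cdot> (Q \<cdot> x) = n \<cdot> x" if "x \<in> Arr A" "Cod A x = V" for x
    using that by (simp_all add: Comp_eq[OF Q(4)] Comp_eq[OF Q(5)])
  have Qki: "Q \<cdot> (k \<cdot> i) = Null A X U'" by (rule biproduct_ext[OF b3, of _ X]) simp_all
  have Qkj: "Q \<cdot> (k \<cdot> j) = a" by (rule biproduct_ext[OF b3, of _ Y]) simp_all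
  have Ql: "Q \<cdot> l = b" by (rule biproduct_ext[OF b3, of _ W]) simp_all
  have QJ: "Q \<cdot> J = Ident A U'" by (rule biproduct_coext[OF b3, of _ U']) (simp_all add: Qkj Ql)
  have pmJ: "p \<cdot> (m \<cdot> J) = Null A U' X" by (rule biproduct_coext[OF b3, of _ X]) simp_all
  have mJ: "m \<cdot> J = j \<cdot> c" by (rule biproduct_coext[OF b3, of _ U]) simp_all
  have nJ: "n \<cdot> J = d" by (rule biproduct_coext[OF b3, of _ W]) simp_all
  have "i \<cdot> p \<boxplus> j \<cdot> q = Ident A U" using b1 by (simp add: is_biproduct_def)
  then have "(i \<cdot> p \<boxplus> j \<cdot> q) \<cdot> m = m" by simp
  then have m: "i \<cdot> (p \<cdot> m) \<boxplus> j \<cdot> (q \<cdot> m) = m" by (simp add: Comp_Plus)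
  have "k \<cdot> (i \<cdot> (p \<cdot> m)) \<boxplus> J \<cdot> Q = Ident A V"
  proof (rule biproduct_ext[OF b2, of _ V])
    show "m \<cdot> (k \<cdot> (i \<cdot> (p \<cdot> m)) \<boxplus> J \<cdot> Q) = m \<cdot> Ident A V"
      by (simp add: Comp_Plus Comp_eq[OF mJ] m)
    show "n \<cdot> (k \<cdot> (i \<cdot> (p \<cdot> m)) \<boxplus> J \<cdot> Q) = n \<cdot> Ident A V"
      by (simp add: Comp_Plus Comp_eq[OF nJ])
  qed simp_all
  then have "is_biproduct A X U' V (k \<cdot> i) J (p \<cdot> m) Q"
    by (simp add: is_biproduct_def QJ Qki pmJ)
  then show ?thesis unfolding biproduct_of_def by blast
qed

lemma ex_biproduct_of: "X \<in> Obj A \<Longrightarrow> Y \<in> Obj A \<Longrightarrow> \<exists>B. biproduct_of A X Y B"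
  using ex_biproduct unfolding biproduct_of_def by blast

lemma biproduct_of_Obj: "biproduct_of A X Y B \<Longrightarrow> X \<in> Obj A \<and> Y \<in> Obj A \<and> B \<in> Obj A"
  by (auto simp: biproduct_of_def is_biproduct_def)

end

section \<open>Full subcategories\<close>

lemma full_subcategory_simps [simp]:
  "Obj (full_subcategory A T) = Obj A \<inter> T"
  "Arr (full_subcategory A T) = {f \<in> Arr A. Dom A f \<in> T \<and> Cod A f \<in> T}"
  "Dom (full_subcategory A T) = Dom A" "Cod (full_subcategory A T) = Cod A"
  "Ident (full_subcategory A T) = Ident A" "g \<cdot>\<^bsub>full_subcategory A T\<^esub> f = g \<cdot>\<^bsub>A\<^esub> f"
  "f \<boxplus>\<^bsub>full_subcategory A T\<^esub> g = f \<boxplus>\<^bsub>A\<^esub> g" "Null (full_subcategory A T) = Null A"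
  by (simp_all add: full_subcategory_def)

lemma full_subcategory_biproduct:
  "is_biproduct (full_subcategory A T) X Y B i j p q \<longleftrightarrow>
    X \<in> T \<and> Y \<in> T \<and> B \<in> T \<and> is_biproduct A X Y B i j p q"
  unfolding is_biproduct_def by auto

lemma (in additive_category) full_subcategory_additive:
  assumes "\<exists>Z\<in>T. is_zero_object A Z" and "\<And>X Y. X \<in> T \<Longrightarrow> Y \<in> T \<Longrightarrow> X \<in> Obj A \<Longrightarrow> Y \<in> Obj A \<Longrightarrow>
    \<exists>B\<in>T. biproduct_of A X Y B"
  shows "additive_category (full_subcategory A T)"
proof (intro additive_category.intro additive_category_axioms.intro)
  show "category (full_subcategory A T)" by unfold_locales auto
next
  fix X Y assume "X \<in> Obj (full_subcategory A T)" "Y \<in> Obj (full_subcategory A T)"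
  moreover from this have "Hom (full_subcategory A T) X Y = Hom A X Y" by auto
  moreover have "Plus (full_subcategory A T) = Plus A" by (simp add: full_subcategory_def)
  ultimately show "comm_group (hom_group (full_subcategory A T) X Y)"
    using Hom_comm_group[of X Y] by (simp add: hom_group_def)
next
  obtain Z where "Z \<in> T" "is_zero_object A Z" using assms(1) by blast
  moreover from this have "Hom (full_subcategory A T) Z X = Hom A Z X" "Hom (full_subcategory A T) X Z = Hom A X Z"
    if "X \<in> T" for X using that by auto
  ultimately have "is_zero_object (full_subcategory A T) Z" unfolding is_zero_object_def by (simp del: Hom_iff)
  then show "\<exists>Z. is_zero_object (full_subcategory A T) Z" by blast
next
  fix X Y assume "X \<in> Obj (full_subcategory A T)" "Y \<in> Obj (full_subcategory A T)"
  then show "\<exists>B i j p q. is_biproduct (full_subcategory A T) X Y B i j p q"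
    using assms(2)[of X Y] unfolding full_subcategory_biproduct biproduct_of_def full_subcategory_simps by blast
qed (auto simp: Comp_Plus)

section \<open>Objects with a complement in an idempotent complete category\<close>

locale karoubian_category = additive_category +
  fixes S
  assumes idempotent_split: "e \<in> Hom A X X \<Longrightarrow> e \<cdot> e = e \<Longrightarrow>
      \<exists>Z i p. i \<in> Hom A Z X \<and> p \<in> Hom A X Z \<and> p \<cdot> i = Ident A Z \<and> i \<cdot> p = e"
    and S_Obj: "X \<in> S \<Longrightarrow> X \<in> Obj A"
    and S_zero: "\<exists>Z\<in>S. is_zero_object A Z"
    and S_biproduct: "X \<in> S \<Longrightarrow> Y \<in> S \<Longrightarrow> \<exists>B\<in>S. biproduct_of A X Y B"
begin

definition T where
  "T = {X \<in> Obj A. \<exists>Y\<in>S. \<exists>B\<in>S. biproduct_of A X Y B}"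

lemma S_T: "X \<in> S \<Longrightarrow> X \<in> T"
  using S_Obj S_biproduct unfolding T_def by blast

text \<open>The complement of \<open>V = X \<oplus> Y\<close> is \<open>Wc = Yc \<oplus> Xc\<close>,
  and the total sum is \<open>W = BX \<oplus> BY\<close>.\<close>

lemma T_biproduct:
  assumes "X \<in> T" "Y \<in> T" "biproduct_of A X Y V"
  shows "V \<in> T"
proof -
  obtain Xc BX where X: "Xc \<in> S" "BX \<in> S" "biproduct_of A X Xc BX" using assms(1) unfolding T_def by blast
  obtain Yc BY where Y: "Yc \<in> S" "BY \<in> S" "biproduct_of A Y Yc BY" using assms(2) unfolding T_def by blast
  obtain W where W: "W \<in> S" "biproduct_of A BX BY W" using S_biproduct X Y by blast
  obtain Wc where Wc: "Wc \<in> S" "biproduct_of A Yc Xc Wc" using S_biproduct X Y by blast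
  have V: "V \<in> Obj A" using biproduct_of_Obj[OF assms(3)] by simp
  obtain U where U: "biproduct_of A V Yc U" using ex_biproduct_of[OF V S_Obj[OF Y(1)]] by blast
  have "biproduct_of A X BY U" using biproduct_of_assoc[OF assms(3) U Y(3)] .
  then have "biproduct_of A Xc U W" using biproduct_of_assoc[OF biproduct_of_comm[OF X(3)] W(2)] by blast
  then have "biproduct_of A V Wc W" using biproduct_of_assoc[OF U biproduct_of_comm Wc(2)] by blast
  then show ?thesis using V W Wc unfolding T_def by blast
qed

text \<open>A complement of \<open>Z\<close> is \<open>T3 = BX \<oplus> Yc\<close>: from
  \<open>BY = Z \<oplus> X \<oplus> Yc\<close> one gets
  \<open>Z \<oplus> T3 = BY \<oplus> Xc = V\<close>. This is why retracts have complements within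
  \<open>T\<close>.\<close>

lemma T_complement:
  assumes "X \<in> T" "Y \<in> T" "biproduct_of A X Z Y"
  shows "Z \<in> T"
proof -
  obtain Xc BX where X: "Xc \<in> S" "BX \<in> S" "biproduct_of A X Xc BX" using assms(1) unfolding T_def by blast
  obtain Yc BY where Y: "Yc \<in> S" "BY \<in> S" "biproduct_of A Y Yc BY" using assms(2) unfolding T_def by blast
  obtain V where V: "V \<in> S" "biproduct_of A BY Xc V" using S_biproduct X Y by blast
  have "X \<in> Obj A" using assms(1) by (simp add: T_def)
  then obtain T1 where T1: "biproduct_of A X Yc T1" using ex_biproduct_of S_Obj[OF Y(1)] by blast
  obtain T3 where T3: "T3 \<in> S" "biproduct_of A BX Yc T3" using S_biproduct X Y by blast
  have ZT1: "biproduct_of A Z T1 BY" using biproduct_of_assoc[OF biproduct_of_comm[OF assms(3)] Y(3) T1] .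
  have "biproduct_of A T1 Xc T3"
    using biproduct_of_comm[OF biproduct_of_assoc[OF biproduct_of_comm[OF X(3)] T3(2) T1]] .
  then have "biproduct_of A Z T3 V" using biproduct_of_assoc[OF ZT1 V(2)] by blast
  then show ?thesis using biproduct_of_Obj[of Z] T3 V unfolding T_def by blast
qed

text \<open>The complement is obtained by splitting the idempotent \<open>1 - i p\<close>.\<close>

lemma retract_complement:
  assumes "i \<in> Hom A X Y" "p \<in> Hom A Y X" "p \<cdot> i = Ident A X"
  obtains Z j q where "is_biproduct A X Z Y i j p q"
proof -
  have [simp]: "i \<in> Arr A" "p \<in> Arr A" "Dom A i = X" "Cod A i = Y" "Dom A p = Y" "Cod A p = X"
    "X \<in> Obj A" "Y \<in> Obj A" using assms(1,2) by auto
  note [simp] = assms(3)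
  have [simp]: "p \<cdot> (i \<cdot> x) = x" if "x \<in> Arr A" "Cod A x = X" for x
    using that by (simp add: Comp_eq[OF assms(3)])
  let ?e = "Ident A Y \<boxplus> neg A (i \<cdot> p)"
  have "?e \<cdot> ?e = ?e" by (simp add: Comp_Plus neg_Comp)
  then obtain Z j q where jq: "j \<in> Hom A Z Y" "q \<in> Hom A Y Z" "q \<cdot> j = Ident A Z" "j \<cdot> q = ?e"
    using idempotent_split[of ?e Y] by auto
  have [simp]: "j \<in> Arr A" "q \<in> Arr A" "Dom A j = Z" "Cod A j = Y" "Dom A q = Y" "Cod A q = Z" "Z \<in> Obj A"
    using jq by auto
  \<comment> \<open>Inserting \<open>q j = 1\<close> exposes \<open>j q = 1 - i p\<close>, which
    kills \<open>i\<close> on its right and \<open>p\<close> on its left.\<close>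
  have "q \<cdot> i = (q \<cdot> j) \<cdot> (q \<cdot> i)" unfolding jq(3) by simp
  also have "\<dots> = q \<cdot> ((j \<cdot> q) \<cdot> i)" by simp
  also have "\<dots> = Null A X Z" unfolding jq(4) by (simp add: Comp_Plus neg_Comp)
  finally have qi: "q \<cdot> i = Null A X Z" .
  have "p \<cdot> j = (p \<cdot> j) \<cdot> (q \<cdot> j)" unfolding jq(3) by simp
  also have "\<dots> = (p \<cdot> (j \<cdot> q)) \<cdot> j" by simp
  also have "\<dots> = Null A Z X" unfolding jq(4) by (simp add: Comp_Plus neg_Comp)
  finally have pj: "p \<cdot> j = Null A Z X" .
  have "i \<cdot> p \<boxplus> ?e = ?e \<boxplus> i \<cdot> p" by (rule Plus_comm) simp_all
  also have "\<dots> = Ident A Y" by (subst Plus_assoc) simp_all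
  finally have "is_biproduct A X Z Y i j p q" using jq(3,4) by (simp add: is_biproduct_def qi pj)
  then show thesis by (rule that)
qed

lemma ambient_full_subcategory: "ambient_category (full_subcategory A T) S"
proof (intro ambient_category.intro ambient_category_axioms.intro full_subcategory_additive)
  show "\<exists>Z\<in>T. is_zero_object A Z" using S_zero S_T by blast
  show "\<exists>B\<in>T. biproduct_of A X Y B" if "X \<in> T" "Y \<in> T" "X \<in> Obj A" "Y \<in> Obj A" for X Y
    using ex_biproduct_of T_biproduct that by blast
  show "X \<in> Obj (full_subcategory A T)" if "X \<in> S" for X using that S_T S_Obj by simp
  show "\<exists>V\<in>S. \<exists>U\<in>S. \<exists>i j p q. is_biproduct (full_subcategory A T) W V U i j p q"
    if "W \<in> Obj (full_subcategory A T)" for W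
    using that S_T unfolding full_subcategory_biproduct by (auto simp: T_def biproduct_of_def)
  show "\<exists>B\<in>S. \<exists>i j p q. is_biproduct (full_subcategory A T) V U B i j p q" if "V \<in> S" "U \<in> S" for V U
    using S_biproduct[OF that] that S_T unfolding full_subcategory_biproduct biproduct_of_def by blast
  show "\<exists>Z j q. is_biproduct (full_subcategory A T) X Z Y i j p q"
    if i: "i \<in> Hom (full_subcategory A T) X Y" and p: "p \<in> Hom (full_subcategory A T) Y X"
      and pi: "p \<cdot>\<^bsub>full_subcategory A T\<^esub> i = Ident (full_subcategory A T) X" for i X Y p
  proof -
    have XY: "X \<in> T" "Y \<in> T" using i by auto
    obtain Z j q where b: "is_biproduct A X Z Y i j p q"
      by (rule retract_complement[of i X Y p]) (use i p pi in simp_all)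
    then have "Z \<in> T" using T_complement[OF XY] unfolding biproduct_of_def by blast
    then show ?thesis unfolding full_subcategory_biproduct using XY b by blast
  qed
qed

end

section \<open>The idempotent completion\<close>

lemma idem_simps [simp]:
  "Obj (idempotent_completion A) = idem_objects A"
  "Dom (idempotent_completion A) (P, f, Q) = P" "Cod (idempotent_completion A) (P, f, Q) = Q"
  "Ident (idempotent_completion A) P = (P, snd P, P)"
  "(Q', g, R) \<cdot>\<^bsub>idempotent_completion A\<^esub> (P, f, Q) = (P, g \<cdot>\<^bsub>A\<^esub> f, R)"
  "(P, f, Q) \<boxplus>\<^bsub>idempotent_completion A\<^esub> (P', f', Q') = (P, f \<boxplus>\<^bsub>A\<^esub> f', Q)"
  "Null (idempotent_completion A) P Q = (P, Null A (fst P) (fst Q), Q)"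
  by (simp_all add: idempotent_completion_def)

context additive_category
begin

lemma idem_objects_iff [simp]: "(X, e) \<in> idem_objects A \<longleftrightarrow> e \<in> Arr A \<and> Dom A e = X \<and> Cod A e = X \<and> e \<cdot> e = e"
  by (auto simp: idem_objects_def)

text \<open>The condition \<open>d f e = f\<close> is split into \<open>d f = f\<close> and
  \<open>f e = f\<close>, which are usable as rewrite rules.\<close>

lemma idem_Arr [simp]:
  "(P, f, Q) \<in> Arr (idempotent_completion A) \<longleftrightarrow> P \<in> idem_objects A \<and> Q \<in> idem_objects A \<and>
     f \<in> Arr A \<and> Dom A f = fst P \<and> Cod A f = fst Q \<and> snd Q \<cdot> f = f \<and> f \<cdot> snd P = f"
proof (cases P; cases Q)
  fix X e Y d assume [simp]: "P = (X, e)" "Q = (Y, d)"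
  have "d \<cdot> f = f \<and> f \<cdot> e = f" if "d \<cdot> (f \<cdot> e) = f" "e \<in> Arr A" "d \<in> Arr A" "f \<in> Arr A" "Dom A f = Cod A e"
    "Cod A f = Dom A d" "e \<cdot> e = e" "d \<cdot> d = d" "Cod A e = Dom A e" "Cod A d = Dom A d"
  proof -
    have "d \<cdot> f = d \<cdot> (d \<cdot> (f \<cdot> e))" unfolding that(1) ..
    also have "\<dots> = (d \<cdot> d) \<cdot> (f \<cdot> e)" using that(2-6,9,10) by simp
    also have "\<dots> = f" unfolding that(8) that(1) ..
    finally have df: "d \<cdot> f = f" .
    have "f \<cdot> e = (d \<cdot> (f \<cdot> e)) \<cdot> e" unfolding that(1) ..
    also have "\<dots> = d \<cdot> (f \<cdot> (e \<cdot> e))" using that(2-6,9,10) by simp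
    also have "\<dots> = f" unfolding that(7) that(1) ..
    finally show ?thesis using df by simp
  qed
  then show ?thesis by (auto simp: idempotent_completion_def)
qed

lemma idem_HomE:
  assumes "f \<in> Hom (idempotent_completion A) P Q"
  obtains g where "f = (P, g, Q)" "g \<in> Arr A" "Dom A g = fst P" "Cod A g = fst Q"
  using assms by (cases f rule: prod_cases3) simp

lemma emb_obj_simps [simp]:
  "fst (emb_obj A X) = X" "snd (emb_obj A X) = Ident A X" "emb_obj A X = emb_obj A Y \<longleftrightarrow> X = Y"
  "X \<in> Obj A \<Longrightarrow> emb_obj A X \<in> idem_objects A"
  by (auto simp: emb_obj_def)

lemma idem_zero:
  assumes "is_zero_object A Z"
  shows "is_zero_object (idempotent_completion A) (emb_obj A Z)"
proof -
  have Z [simp]: "Z \<in> Obj A" using assms by (simp add: is_zero_object_def)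
  have from_Z: "f = g" if "f \<in> Hom A Z X" "g \<in> Hom A Z X" for f g X
    using assms that unfolding is_zero_object_def Hom_iff by (metis Obj_simps(2))
  have to_Z: "f = g" if "f \<in> Hom A X Z" "g \<in> Hom A X Z" for f g X
    using assms that unfolding is_zero_object_def Hom_iff by (metis Obj_simps(1))
  show ?thesis unfolding is_zero_object_def
  proof (intro conjI ballI)
    fix P assume P: "P \<in> Obj (idempotent_completion A)"
    obtain X e where [simp]: "P = (X, e)" by (cases P)
    have [simp]: "e \<in> Arr A" "Dom A e = X" "Cod A e = X" "X \<in> Obj A" "e \<cdot> e = e" using P by auto
    show "\<exists>!f. f \<in> Hom (idempotent_completion A) (emb_obj A Z) P"
    proof (rule ex1I[of _ "(emb_obj A Z, Null A Z X, P)"])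
      fix f assume "f \<in> Hom (idempotent_completion A) (emb_obj A Z) P"
      then show "f = (emb_obj A Z, Null A Z X, P)"
        by (rule idem_HomE) (simp add: from_Z[of _ X])
    qed simp
    show "\<exists>!f. f \<in> Hom (idempotent_completion A) P (emb_obj A Z)"
    proof (rule ex1I[of _ "(P, Null A X Z, emb_obj A Z)"])
      fix f assume "f \<in> Hom (idempotent_completion A) P (emb_obj A Z)"
      then show "f = (P, Null A X Z, emb_obj A Z)"
        by (rule idem_HomE) (simp add: to_Z[of _ X])
    qed simp
  qed simp
qed

lemma idem_biproduct:
  assumes "P \<in> idem_objects A" "Q \<in> idem_objects A"
  shows "\<exists>B i j p q. is_biproduct (idempotent_completion A) P Q B i j p q"
proof -
  obtain X e Y d where [simp]: "P = (X, e)" "Q = (Y, d)" by (cases P; cases Q)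
  have [simp]: "e \<in> Arr A" "Dom A e = X" "Cod A e = X" "e \<cdot> e = e" "X \<in> Obj A"
    "d \<in> Arr A" "Dom A d = Y" "Cod A d = Y" "d \<cdot> d = d" "Y \<in> Obj A" using assms by auto
  have [simp]: "e \<cdot> (e \<cdot> x) = e \<cdot> x" if "x \<in> Arr A" "Cod A x = X" for x
    using that Comp_eq[OF \<open>e \<cdot> e = e\<close>] by simp
  have [simp]: "d \<cdot> (d \<cdot> x) = d \<cdot> x" if "x \<in> Arr A" "Cod A x = Y" for x
    using that Comp_eq[OF \<open>d \<cdot> d = d\<close>] by simp
  obtain B i j p q where b: "is_biproduct A X Y B i j p q" using ex_biproduct[of X Y] by auto
  note [simp] = biproduct_simps[OF b] biproduct_Comp[OF b]
  \<comment> \<open>\<open>?b\<close> is the idempotent \<open>e \<oplus> d\<close> on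
    \<open>B\<close>; the structure maps are those of \<open>B\<close>, cut down by \<open>e\<close>
    and \<open>d\<close>.\<close>
  let ?b = "i \<cdot> (e \<cdot> p) \<boxplus> j \<cdot> (d \<cdot> q)"
  let ?B = "(B, ?b)"
  have "is_biproduct (idempotent_completion A) P Q ?B (P, i \<cdot> e, ?B) (Q, j \<cdot> d, ?B) (?B, e \<cdot> p, P) (?B, d \<cdot> q, Q)"
    unfolding is_biproduct_def by (simp add: Comp_Plus)
  then show ?thesis by blast
qed

lemma idem_additive: "additive_category (idempotent_completion A)"
proof (intro additive_category.intro additive_category_axioms.intro)
  show "category (idempotent_completion A)"
  proof unfold_locales
    fix f assume "f \<in> Arr (idempotent_completion A)"
    then show "Dom (idempotent_completion A) f \<in> Obj (idempotent_completion A)"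
      "Cod (idempotent_completion A) f \<in> Obj (idempotent_completion A)" by (cases f; auto)+
  next
    fix P assume "P \<in> Obj (idempotent_completion A)"
    then show "Ident (idempotent_completion A) P \<in> Hom (idempotent_completion A) P P" by (cases P) auto
  next
    fix f g P Q R assume "f \<in> Hom (idempotent_completion A) P Q" "g \<in> Hom (idempotent_completion A) Q R"
    then show "g \<cdot>\<^bsub>idempotent_completion A\<^esub> f \<in> Hom (idempotent_completion A) P R"
      by (cases f; cases g; cases P; cases Q; cases R) (auto simp: Comp_eq)
  next
    fix f g h P Q R N assume "f \<in> Hom (idempotent_completion A) N P" "g \<in> Hom (idempotent_completion A) P Q"
      "h \<in> Hom (idempotent_completion A) Q R"
    then show "(h \<cdot>\<^bsub>idempotent_completion A\<^esub> g) \<cdot>\<^bsub>idempotent_completion A\<^esub> f =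
        h \<cdot>\<^bsub>idempotent_completion A\<^esub> (g \<cdot>\<^bsub>idempotent_completion A\<^esub> f)"
      by (cases f; cases g; cases h) auto
  next
    fix f P Q assume "f \<in> Hom (idempotent_completion A) P Q"
    then show "Ident (idempotent_completion A) Q \<cdot>\<^bsub>idempotent_completion A\<^esub> f = f"
      "f \<cdot>\<^bsub>idempotent_completion A\<^esub> Ident (idempotent_completion A) P = f"
      by (cases f; auto)+
  qed
next
  fix P Q assume PQ: "P \<in> Obj (idempotent_completion A)" "Q \<in> Obj (idempotent_completion A)"
  obtain X e Y d where [simp]: "P = (X, e)" "Q = (Y, d)" by (cases P; cases Q)
  have [simp]: "e \<in> Arr A" "Dom A e = X" "Cod A e = X" "e \<cdot> e = e" "X \<in> Obj A"
    "d \<in> Arr A" "Dom A d = Y" "Cod A d = Y" "d \<cdot> d = d" "Y \<in> Obj A" using PQ by auto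
  have Hom: "Hom (idempotent_completion A) P Q =
      (\<lambda>f. (P, f, Q)) ` {f \<in> Arr A. Dom A f = X \<and> Cod A f = Y \<and> d \<cdot> f = f \<and> f \<cdot> e = f}"
    by (auto simp: image_iff)
  show "comm_group (hom_group (idempotent_completion A) P Q)"
  proof (rule comm_groupI)
    fix x assume "x \<in> carrier (hom_group (idempotent_completion A) P Q)"
    then obtain f where [simp]: "x = (P, f, Q)" "f \<in> Arr A" "Dom A f = X" "Cod A f = Y" "d \<cdot> f = f" "f \<cdot> e = f"
      unfolding hom_group_def monoid.simps partial_object.simps Hom by blast
    show "\<exists>y\<in>carrier (hom_group (idempotent_completion A) P Q).
        y \<otimes>\<^bsub>hom_group (idempotent_completion A) P Q\<^esub> x = \<one>\<^bsub>hom_group (idempotent_completion A) P Q\<^esub>"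
      by (rule bexI[of _ "(P, neg A f, Q)"]) (simp_all add: hom_group_def neg_Comp)
  qed (auto simp: hom_group_def Hom Comp_Plus Plus_assoc intro!: Plus_comm)
next
  fix f g h P Q R assume "f \<in> Hom (idempotent_completion A) P Q"
    "g \<in> Hom (idempotent_completion A) Q R" "h \<in> Hom (idempotent_completion A) Q R"
  then show "(g \<boxplus>\<^bsub>idempotent_completion A\<^esub> h) \<cdot>\<^bsub>idempotent_completion A\<^esub> f =
      g \<cdot>\<^bsub>idempotent_completion A\<^esub> f \<boxplus>\<^bsub>idempotent_completion A\<^esub> h \<cdot>\<^bsub>idempotent_completion A\<^esub> f"
    by (cases f; cases g; cases h) (auto simp: Comp_Plus)
next
  fix f g h P Q R assume "f \<in> Hom (idempotent_completion A) P Q"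
    "g \<in> Hom (idempotent_completion A) P Q" "h \<in> Hom (idempotent_completion A) Q R"
  then show "h \<cdot>\<^bsub>idempotent_completion A\<^esub> (f \<boxplus>\<^bsub>idempotent_completion A\<^esub> g) =
      h \<cdot>\<^bsub>idempotent_completion A\<^esub> f \<boxplus>\<^bsub>idempotent_completion A\<^esub> h \<cdot>\<^bsub>idempotent_completion A\<^esub> g"
    by (cases f; cases g; cases h) (auto simp: Comp_Plus)
next
  show "\<exists>Z. is_zero_object (idempotent_completion A) Z" using ex_zero_object idem_zero by blast
next
  fix P Q assume "P \<in> Obj (idempotent_completion A)" "Q \<in> Obj (idempotent_completion A)"
  then show "\<exists>B i j p q. is_biproduct (idempotent_completion A) P Q B i j p q"
    using idem_biproduct[of P Q] by simp
qed

lemma emb_biproduct: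
  assumes "is_biproduct A X Y B i j p q"
  shows "is_biproduct (idempotent_completion A) (emb_obj A X) (emb_obj A Y) (emb_obj A B)
    (emb_arr A i) (emb_arr A j) (emb_arr A p) (emb_arr A q)"
  using biproduct_simps[OF assms] assms by (simp add: is_biproduct_def emb_arr_def)

text \<open>An idempotent \<open>f\<close> on \<open>(X, c)\<close> splits through
  \<open>(X, f)\<close>, and both maps of the splitting are given by \<open>f\<close>
  itself.\<close>

lemma idem_split:
  assumes "e \<in> Hom (idempotent_completion A) P P" "e \<cdot>\<^bsub>idempotent_completion A\<^esub> e = e"
  shows "\<exists>Q i p. i \<in> Hom (idempotent_completion A) Q P \<and> p \<in> Hom (idempotent_completion A) P Q \<and>
    p \<cdot>\<^bsub>idempotent_completion A\<^esub> i = Ident (idempotent_completion A) Q \<and> i \<cdot>\<^bsub>idempotent_completion A\<^esub> p = e"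
proof -
  obtain X c f where [simp]: "P = (X, c)" "e = (P, f, P)" using assms(1) by (cases e; cases P) auto
  show ?thesis
    by (rule exI[of _ "(X, f)"], rule exI[of _ "((X, f), f, P)"], rule exI[of _ "(P, f, (X, f))"])
      (use assms in auto)
qed

lemma karoubian_idem: "karoubian_category (idempotent_completion A) (emb_obj A ` Obj A)"
proof (intro karoubian_category.intro karoubian_category_axioms.intro idem_additive)
  show "\<exists>Z\<in>emb_obj A ` Obj A. is_zero_object (idempotent_completion A) Z"
    using ex_zero_object idem_zero unfolding is_zero_object_def[of A] by blast
  show "\<exists>B\<in>emb_obj A ` Obj A. biproduct_of (idempotent_completion A) X Y B"
    if "X \<in> emb_obj A ` Obj A" "Y \<in> emb_obj A ` Obj A" for X Y
  proof -
    obtain X' Y' where *: "X = emb_obj A X'" "Y = emb_obj A Y'" "X' \<in> Obj A" "Y' \<in> Obj A" using \<open>X \<in> _\<close> \<open>Y \<in> _\<close> by blast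
    obtain B i j p q where b: "is_biproduct A X' Y' B i j p q" using ex_biproduct[OF *(3,4)] by blast
    then have "B \<in> Obj A" by (rule biproduct_simps)
    with emb_biproduct[OF b] show ?thesis unfolding * biproduct_of_def by blast
  qed
qed (use idem_split in auto)

lemma weak_idempotent_completion_eq:
  "weak_idempotent_completion A =
    full_subcategory (idempotent_completion A) (karoubian_category.T (idempotent_completion A) (emb_obj A ` Obj A))"
  unfolding weak_idempotent_completion_def karoubian_category.T_def[OF karoubian_idem] biproduct_of_def by simp

lemma dense_embedding_emb: "dense_embedding A (weak_idempotent_completion A) (emb_obj A) (emb_arr A)"
proof -
  interpret K: karoubian_category "idempotent_completion A" "emb_obj A ` Obj A" by (rule karoubian_idem)
  have T: "emb_obj A X \<in> K.T" if "X \<in> Obj A" for X using K.S_T that by blast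
  show ?thesis unfolding weak_idempotent_completion_eq
  proof (intro dense_embedding.intro dense_embedding_axioms.intro additive_category_axioms K.ambient_full_subcategory)
    fix h assume "h \<in> Arr (full_subcategory (idempotent_completion A) K.T)"
      "Dom (full_subcategory (idempotent_completion A) K.T) h \<in> emb_obj A ` Obj A"
      "Cod (full_subcategory (idempotent_completion A) K.T) h \<in> emb_obj A ` Obj A"
    then obtain X Y f where "h = (emb_obj A X, f, emb_obj A Y)" "f \<in> Arr A" "Dom A f = X" "Cod A f = Y"
      by (cases h rule: prod_cases3) auto
    then show "h \<in> emb_arr A ` Arr A" by (auto simp: emb_arr_def)
  qed (auto simp: T emb_arr_def)
qed

end

lemma (in dense_embedding) F_pairs_eq: "F_pairs C = map_prod F F ` C"
  by (force simp: F_pairs_def image_iff)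

theorem proposition9p4:
  fixes A :: "('o, 'm) cat" and D I :: "('m \<times> 'm) set"
  assumes "additive_category A"
    and "deflation_exact_structure A D"
    and "inflation_exact_structure A I"
    and "\<And>i p. split_kernel_cokernel_pair A i p \<Longrightarrow> (i, p) \<in> D"
    and "\<And>i p. split_kernel_cokernel_pair A i p \<Longrightarrow> (i, p) \<in> I"
  shows "completed_conflations A D \<inter> completed_conflations A I = completed_conflations A (D \<inter> I)
    \<and> exact_structure (weak_idempotent_completion A)
        (completed_conflations A D \<inter> completed_conflations A I)"
proof -
  interpret dense_embedding A "weak_idempotent_completion A" "emb_obj A" "emb_arr A"
    by (rule additive_category.dense_embedding_emb) fact
  \<comment> \<open>Membership is tested against embedded conflations, that is, against the image of
    \<open>C\<close> under the embedding.\<close>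
  have "completed_conflations A C = summands (weak_idempotent_completion A) (F_pairs C)" for C
    by (simp add: completed_conflations_def summands_def F_pairs_eq split_beta)
  then show ?thesis using exact_summands[OF assms(2-5)] by simp
qed

end
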